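(* Let $R$ be a PID and let $S$ be a specialisation closed subset of $\mathrm{Spec}(R)$. Then: 1. If $S=\mathrm{Spec}(R)$, then $K_0(\mathcal{T}_S)$ is an infinite cyclic group generated by (the class of) $R$. 2. If $S\neq\mathrm{Spec}(R)$, then $K_0(\mathcal{T}_S)$ is a free abelian group on the Grothendieck classes of the Moore complexes $M(p)$, for $p\in S$.
   Context: $D^b(\mathrm{proj}\,R)$ is the chain homotopy category of perfect complexes (bounded complexes of finitely generated projective $R$-modules). $\mathrm{Supp}(X)=\{p\in\mathrm{Spec}(R): X\otimes^L_RK(p)\neq0\}$ with $K(p)$ the fraction field of $R/p$. $S\subseteq\mathrm{Spec}(R)$ is specialisation closed if it is a union of Zariski closed sets. $\mathcal{T}_S=\{X\in D^b(\mathrm{proj}\,R):\mathrm{Supp}(X)\subseteq S\}$, a thick subcategory. For $x\in R$, the Moore complex $M(x)$ is the cofibre of $R\xrightarrow{x}R$ in $D(R)$; for $S\ne\mathrm{Spec}(R)$ the elements of $S$ are nonzero prime ideals $(p)$, and $p\in S$ means one chooses a generator $p$ of each. $K_0$ of an essentially small triangulated category is the free abelian group on isomorphism classes of objects modulo $[Y]=[X]+[Z]$ for each exact triangle $X\to Y\to Z\to\Sigma X$. *)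

theory Defs
  imports "HOL-Algebra.Algebra"
begin

section \<open>Prime spectrum\<close>

definition Spec :: "('a, 'r) ring_scheme \<Rightarrow> 'a set set" where
  "Spec R = {P. primeideal P R}"

definition zariski_closed :: "('a, 'r) ring_scheme \<Rightarrow> 'a set set \<Rightarrow> bool" where
  "zariski_closed R C \<longleftrightarrow> (\<exists>I. ideal I R \<and> C = {P \<in> Spec R. I \<subseteq> P})"

definition specialisation_closed :: "('a, 'r) ring_scheme \<Rightarrow> 'a set set \<Rightarrow> bool" where
  "specialisation_closed R S \<longleftrightarrow> (\<exists>\<C>. (\<forall>C\<in>\<C>. zariski_closed R C) \<and> S = \<Union>\<C>)"


section \<open>Modules\<close>

text \<open>The ring fields \<open>mult\<close> and \<open>one\<close> of a module record are irrelevant throughout; they are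
  left \<open>undefined\<close> where there is no natural choice.\<close>

definition mod_hom ::
  "('a, 'r) ring_scheme \<Rightarrow> ('a, 'm) module \<Rightarrow> ('a, 'n) module \<Rightarrow> ('m \<Rightarrow> 'n) set" where
  "mod_hom R M N = {f \<in> hom (add_monoid M) (add_monoid N).
     \<forall>r\<in>carrier R. \<forall>x\<in>carrier M. f (r \<odot>\<^bsub>M\<^esub> x) = r \<odot>\<^bsub>N\<^esub> f x}"

definition regular_mod :: "('a, 'r) ring_scheme \<Rightarrow> ('a, 'a) module" where
  "regular_mod R = \<lparr>carrier = carrier R, monoid.mult = monoid.mult R, one = one R,
     ring.zero = ring.zero R, ring.add = ring.add R, smult = monoid.mult R\<rparr>"

definition zero_submod :: "('a, 'm) module \<Rightarrow> ('a, 'm) module" where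
  "zero_submod M = M\<lparr>carrier := {\<zero>\<^bsub>M\<^esub>}\<rparr>"

definition dsum_mod :: "('a, 'm) module \<Rightarrow> ('a, 'n) module \<Rightarrow> ('a, 'm \<times> 'n) module" where
  "dsum_mod M N = \<lparr>carrier = carrier M \<times> carrier N, monoid.mult = undefined, one = undefined,
     ring.zero = (\<zero>\<^bsub>M\<^esub>, \<zero>\<^bsub>N\<^esub>),
     ring.add = (\<lambda>(x, y) (x', y'). (x \<oplus>\<^bsub>M\<^esub> x', y \<oplus>\<^bsub>N\<^esub> y')),
     smult = (\<lambda>r (x, y). (r \<odot>\<^bsub>M\<^esub> x, r \<odot>\<^bsub>N\<^esub> y))\<rparr>"

definition fin_gen_mod :: "('a, 'r) ring_scheme \<Rightarrow> ('a, 'm) module \<Rightarrow> bool" where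
  "fin_gen_mod R M \<longleftrightarrow> (\<exists>A. finite A \<and> A \<subseteq> carrier M \<and>
     (\<forall>N. submodule N R M \<and> A \<subseteq> N \<longrightarrow> N = carrier M))"

text \<open>Projectivity is the lifting property against surjections \<open>N \<rightarrow> L\<close>.  HOL requires a fixed type
  for the underlying sets of \<open>N\<close> and \<open>L\<close>; \<^typ>\<open>nat \<Rightarrow> 'a\<close> contains a copy of every finitely
  generated \<open>R\<close>-module, so for finitely generated \<open>M\<close> the tests include a surjection
  \<open>R\<^sup>n \<rightarrow> M\<close>, whose splitting already gives the lifting property against all surjections.\<close>

definition fg_projective :: "('a, 'r) ring_scheme \<Rightarrow> ('a, 'm) module \<Rightarrow> bool" where
  "fg_projective R M \<longleftrightarrow> module R M \<and> fin_gen_mod R M \<and>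
     (\<forall>(N :: ('a, nat \<Rightarrow> 'a) module) (L :: ('a, nat \<Rightarrow> 'a) module).
        \<forall>e\<in>mod_hom R N L. \<forall>f\<in>mod_hom R M L.
          module R N \<and> module R L \<and> e ` carrier N = carrier L \<longrightarrow>
          (\<exists>g\<in>mod_hom R M N. \<forall>x\<in>carrier M. e (g x) = f x))"


subsection \<open>Tensor products\<close>

definition tensor_rels ::
  "('a, 'r) ring_scheme \<Rightarrow> ('a, 'm) module \<Rightarrow> ('a, 'n) module \<Rightarrow> ('m \<times> 'n \<Rightarrow>\<^sub>0 int) set" where
  "tensor_rels R M N = generate (free_Abelian_group (carrier M \<times> carrier N))
     ({frag_of (x \<oplus>\<^bsub>M\<^esub> x', y) - frag_of (x, y) - frag_of (x', y) | x x' y.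
         x \<in> carrier M \<and> x' \<in> carrier M \<and> y \<in> carrier N} \<union>
      {frag_of (x, y \<oplus>\<^bsub>N\<^esub> y') - frag_of (x, y) - frag_of (x, y') | x y y'.
         x \<in> carrier M \<and> y \<in> carrier N \<and> y' \<in> carrier N} \<union>
      {frag_of (r \<odot>\<^bsub>M\<^esub> x, y) - frag_of (x, r \<odot>\<^bsub>N\<^esub> y) | r x y.
         r \<in> carrier R \<and> x \<in> carrier M \<and> y \<in> carrier N})"

text \<open>The map \<open>f \<otimes> N : M \<otimes> N \<rightarrow> M' \<otimes> N\<close>, on cosets of \<^const>\<open>tensor_rels\<close>.\<close>

definition tensor_map ::
  "('a, 'r) ring_scheme \<Rightarrow> ('a, 'm) module \<Rightarrow> ('a, 'n) module \<Rightarrow> ('l \<Rightarrow> 'm) \<Rightarrow>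
   ('l \<times> 'n \<Rightarrow>\<^sub>0 int) set \<Rightarrow> ('m \<times> 'n \<Rightarrow>\<^sub>0 int) set" where
  "tensor_map R M' N f C =
     tensor_rels R M' N <#>\<^bsub>free_Abelian_group (carrier M' \<times> carrier N)\<^esub>
       (frag_extend (\<lambda>(x, y). frag_of (f x, y)) ` C)"

definition tensor_mod ::
  "('a, 'r) ring_scheme \<Rightarrow> ('a, 'm) module \<Rightarrow> ('a, 'n) module \<Rightarrow>
   ('a, ('m \<times> 'n \<Rightarrow>\<^sub>0 int) set) module" where
  "tensor_mod R M N =
     (let G = free_Abelian_group (carrier M \<times> carrier N) Mod tensor_rels R M N
      in \<lparr>carrier = carrier G, monoid.mult = undefined, one = undefined,
          ring.zero = one G, ring.add = monoid.mult G,
          smult = (\<lambda>r. tensor_map R M N (\<lambda>x. r \<odot>\<^bsub>M\<^esub> x))\<rparr>)"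


subsection \<open>Residue fields\<close>

definition frac_rel :: "('b, 'r) ring_scheme \<Rightarrow> (('b \<times> 'b) \<times> ('b \<times> 'b)) set" where
  "frac_rel D = {((a, b), (c, d)) | a b c d.
     a \<in> carrier D \<and> b \<in> carrier D - {\<zero>\<^bsub>D\<^esub>} \<and> c \<in> carrier D \<and> d \<in> carrier D - {\<zero>\<^bsub>D\<^esub>} \<and>
     a \<otimes>\<^bsub>D\<^esub> d = c \<otimes>\<^bsub>D\<^esub> b}"

definition mk_frac :: "('b, 'r) ring_scheme \<Rightarrow> 'b \<Rightarrow> 'b \<Rightarrow> ('b \<times> 'b) set" where
  "mk_frac D a b = frac_rel D `` {(a, b)}"

definition fraction_field :: "('b, 'r) ring_scheme \<Rightarrow> ('b \<times> 'b) set ring" where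
  "fraction_field D =
     \<lparr>carrier = (carrier D \<times> (carrier D - {\<zero>\<^bsub>D\<^esub>})) // frac_rel D,
      monoid.mult = (\<lambda>x y. \<Union>(a, b)\<in>x. \<Union>(c, d)\<in>y. mk_frac D (a \<otimes>\<^bsub>D\<^esub> c) (b \<otimes>\<^bsub>D\<^esub> d)),
      one = mk_frac D \<one>\<^bsub>D\<^esub> \<one>\<^bsub>D\<^esub>,
      ring.zero = mk_frac D \<zero>\<^bsub>D\<^esub> \<one>\<^bsub>D\<^esub>,
      ring.add = (\<lambda>x y. \<Union>(a, b)\<in>x. \<Union>(c, d)\<in>y.
               mk_frac D (a \<otimes>\<^bsub>D\<^esub> d \<oplus>\<^bsub>D\<^esub> c \<otimes>\<^bsub>D\<^esub> b) (b \<otimes>\<^bsub>D\<^esub> d))\<rparr>"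

definition residue_field_mod ::
  "('a, 'r) ring_scheme \<Rightarrow> 'a set \<Rightarrow> ('a, ('a set \<times> 'a set) set) module" where
  "residue_field_mod R P =
     (let K = fraction_field (R Quot P)
      in \<lparr>carrier = carrier K, monoid.mult = monoid.mult K, one = one K, ring.zero = ring.zero K,
          ring.add = ring.add K,
          smult = (\<lambda>r x. mk_frac (R Quot P) (P +>\<^bsub>R\<^esub> r) \<one>\<^bsub>R Quot P\<^esub> \<otimes>\<^bsub>K\<^esub> x)\<rparr>)"


section \<open>Chain complexes\<close>

text \<open>Homological grading: \<open>cdiff U n\<close> maps \<open>cobj U n\<close> to \<open>cobj U (n - 1)\<close>.\<close>

record ('a, 'm) cplx =
  cobj :: "int \<Rightarrow> ('a, 'm) module"
  cdiff :: "int \<Rightarrow> 'm \<Rightarrow> 'm"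

definition is_complex :: "('a, 'r) ring_scheme \<Rightarrow> ('a, 'm) cplx \<Rightarrow> bool" where
  "is_complex R U \<longleftrightarrow>
     (\<forall>n. module R (cobj U n) \<and> cdiff U n \<in> mod_hom R (cobj U n) (cobj U (n - 1)) \<and>
          (\<forall>x\<in>carrier (cobj U n). cdiff U (n - 1) (cdiff U n x) = \<zero>\<^bsub>cobj U (n - 2)\<^esub>))"

definition acyclic_cplx :: "('a, 'm) cplx \<Rightarrow> bool" where
  "acyclic_cplx U \<longleftrightarrow>
     (\<forall>n. {x \<in> carrier (cobj U n). cdiff U n x = \<zero>\<^bsub>cobj U (n - 1)\<^esub>}
          = cdiff U (n + 1) ` carrier (cobj U (n + 1)))"

definition chain_map ::
  "('a, 'r) ring_scheme \<Rightarrow> ('a, 'm) cplx \<Rightarrow> ('a, 'n) cplx \<Rightarrow> (int \<Rightarrow> 'm \<Rightarrow> 'n) \<Rightarrow> bool" where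
  "chain_map R U V f \<longleftrightarrow>
     (\<forall>n. f n \<in> mod_hom R (cobj U n) (cobj V n) \<and>
          (\<forall>x\<in>carrier (cobj U n). cdiff V n (f n x) = f (n - 1) (cdiff U n x)))"

definition chain_homotopic ::
  "('a, 'r) ring_scheme \<Rightarrow> ('a, 'm) cplx \<Rightarrow> ('a, 'n) cplx \<Rightarrow>
   (int \<Rightarrow> 'm \<Rightarrow> 'n) \<Rightarrow> (int \<Rightarrow> 'm \<Rightarrow> 'n) \<Rightarrow> bool" where
  "chain_homotopic R U V f g \<longleftrightarrow>
     (\<exists>s. \<forall>n. s n \<in> mod_hom R (cobj U n) (cobj V (n + 1)) \<and>
       (\<forall>x\<in>carrier (cobj U n).
          f n x \<ominus>\<^bsub>cobj V n\<^esub> g n x = cdiff V (n + 1) (s n x) \<oplus>\<^bsub>cobj V n\<^esub> s (n - 1) (cdiff U n x)))"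

definition homotopy_equiv ::
  "('a, 'r) ring_scheme \<Rightarrow> ('a, 'm) cplx \<Rightarrow> ('a, 'n) cplx \<Rightarrow> (int \<Rightarrow> 'm \<Rightarrow> 'n) \<Rightarrow> bool" where
  "homotopy_equiv R U V f \<longleftrightarrow> chain_map R U V f \<and>
     (\<exists>g. chain_map R V U g \<and>
       chain_homotopic R U U (\<lambda>n x. g n (f n x)) (\<lambda>n x. x) \<and>
       chain_homotopic R V V (\<lambda>n y. f n (g n y)) (\<lambda>n y. y))"

text \<open>Isomorphism in the homotopy category; \<open>U\<close> and \<open>V\<close> may have different underlying types.\<close>

definition homotopy_isomorphic ::
  "('a, 'r) ring_scheme \<Rightarrow> ('a, 'm) cplx \<Rightarrow> ('a, 'n) cplx \<Rightarrow> bool" where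
  "homotopy_isomorphic R U V \<longleftrightarrow> (\<exists>f. homotopy_equiv R U V f)"

definition stalk_cplx :: "('a, 'm) module \<Rightarrow> ('a, 'm) cplx" where
  "stalk_cplx M = \<lparr>cobj = (\<lambda>n. if n = 0 then M else zero_submod M), cdiff = (\<lambda>n x. \<zero>\<^bsub>M\<^esub>)\<rparr>"

definition shift_cplx :: "('a, 'm) cplx \<Rightarrow> ('a, 'm) cplx" where
  "shift_cplx U = \<lparr>cobj = (\<lambda>n. cobj U (n - 1)),
     cdiff = (\<lambda>n x. \<ominus>\<^bsub>cobj U (n - 2)\<^esub> cdiff U (n - 1) x)\<rparr>"

definition mapping_cone :: "('a, 'm) cplx \<Rightarrow> ('a, 'n) cplx \<Rightarrow> (int \<Rightarrow> 'm \<Rightarrow> 'n) \<Rightarrow> ('a, 'm \<times> 'n) cplx" where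
  "mapping_cone U V f = \<lparr>cobj = (\<lambda>n. dsum_mod (cobj U (n - 1)) (cobj V n)),
     cdiff = (\<lambda>n (x, y). (\<ominus>\<^bsub>cobj U (n - 2)\<^esub> cdiff U (n - 1) x,
                          f (n - 1) x \<oplus>\<^bsub>cobj V (n - 1)\<^esub> cdiff V n y))\<rparr>"

definition tensor_cplx ::
  "('a, 'r) ring_scheme \<Rightarrow> ('a, 'm) cplx \<Rightarrow> ('a, 'n) module \<Rightarrow> ('a, ('m \<times> 'n \<Rightarrow>\<^sub>0 int) set) cplx" where
  "tensor_cplx R U N = \<lparr>cobj = (\<lambda>n. tensor_mod R (cobj U n) N),
     cdiff = (\<lambda>n. tensor_map R (cobj U (n - 1)) N (cdiff U n))\<rparr>"


section \<open>Perfect complexes\<close>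

definition perfect_cplx :: "('a, 'r) ring_scheme \<Rightarrow> ('a, 'm) cplx \<Rightarrow> bool" where
  "perfect_cplx R U \<longleftrightarrow> is_complex R U \<and> (\<forall>n. fg_projective R (cobj U n)) \<and>
     (\<exists>N. \<forall>n. N < \<bar>n\<bar> \<longrightarrow> carrier (cobj U n) = {\<zero>\<^bsub>cobj U n\<^esub>})"

text \<open>The objects of \<open>D\<^sup>b(proj R)\<close>.  Every finitely generated \<open>R\<close>-module is isomorphic to one
  whose underlying set lies in \<^typ>\<open>nat \<Rightarrow> 'a\<close>, so this is an essentially small model containing every
  perfect complex up to isomorphism.  Morphisms are represented by chain maps modulo
  \<^const>\<open>chain_homotopic\<close>.\<close>

definition Dperf :: "('a, 'r) ring_scheme \<Rightarrow> ('a, nat \<Rightarrow> 'a) cplx set" where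
  "Dperf R = {U. perfect_cplx R U}"

text \<open>The exact triangles of the homotopy category: \<open>U \<rightarrow> V \<rightarrow> W \<rightarrow> \<Sigma>U\<close> is isomorphic, up to
  homotopy, to a mapping cone triangle \<open>A \<rightarrow> B \<rightarrow> cone u \<rightarrow> \<Sigma>A\<close>.\<close>

definition exact_triangle ::
  "('a, 'r) ring_scheme \<Rightarrow> ('a, nat \<Rightarrow> 'a) cplx \<Rightarrow> ('a, nat \<Rightarrow> 'a) cplx \<Rightarrow> ('a, nat \<Rightarrow> 'a) cplx \<Rightarrow>
   (int \<Rightarrow> (nat \<Rightarrow> 'a) \<Rightarrow> nat \<Rightarrow> 'a) \<Rightarrow> (int \<Rightarrow> (nat \<Rightarrow> 'a) \<Rightarrow> nat \<Rightarrow> 'a) \<Rightarrow>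
   (int \<Rightarrow> (nat \<Rightarrow> 'a) \<Rightarrow> nat \<Rightarrow> 'a) \<Rightarrow> bool" where
  "exact_triangle R U V W f g h \<longleftrightarrow>
     chain_map R U V f \<and> chain_map R V W g \<and> chain_map R W (shift_cplx U) h \<and>
     (\<exists>A\<in>Dperf R. \<exists>B\<in>Dperf R. \<exists>u a b c.
        chain_map R A B u \<and>
        homotopy_equiv R U A a \<and> homotopy_equiv R V B b \<and> homotopy_equiv R W (mapping_cone A B u) c \<and>
        chain_homotopic R U B (\<lambda>n x. b n (f n x)) (\<lambda>n x. u n (a n x)) \<and>
        chain_homotopic R V (mapping_cone A B u)
          (\<lambda>n y. c n (g n y)) (\<lambda>n y. (\<zero>\<^bsub>cobj A (n - 1)\<^esub>, b n y)) \<and>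
        chain_homotopic R W (shift_cplx A)
          (\<lambda>n z. a (n - 1) (h n z)) (\<lambda>n z. fst (c n z)))"

text \<open>As the terms of \<open>U\<close> are projective, \<open>U \<otimes>\<^sup>L K(P)\<close> is computed by the termwise tensor product;
  it vanishes in the derived category iff it is acyclic.\<close>

definition Supp :: "('a, 'r) ring_scheme \<Rightarrow> ('a, 'm) cplx \<Rightarrow> 'a set set" where
  "Supp R U = {P \<in> Spec R. \<not> acyclic_cplx (tensor_cplx R U (residue_field_mod R P))}"

definition T_supp :: "('a, 'r) ring_scheme \<Rightarrow> 'a set set \<Rightarrow> ('a, nat \<Rightarrow> 'a) cplx set" where
  "T_supp R S = {U \<in> Dperf R. Supp R U \<subseteq> S}"

definition moore_cplx :: "('a, 'r) ring_scheme \<Rightarrow> 'a \<Rightarrow> ('a, 'a \<times> 'a) cplx" where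
  "moore_cplx R x =
     mapping_cone (stalk_cplx (regular_mod R)) (stalk_cplx (regular_mod R)) (\<lambda>n y. x \<otimes>\<^bsub>R\<^esub> y)"


section \<open>Grothendieck groups\<close>

text \<open>Here \<open>T\<close> is the set of objects of a full triangulated subcategory of \<open>D\<^sup>b(proj R)\<close>.\<close>

definition iso_class ::
  "('a, 'r) ring_scheme \<Rightarrow> ('a, nat \<Rightarrow> 'a) cplx set \<Rightarrow> ('a, 'm) cplx \<Rightarrow> ('a, nat \<Rightarrow> 'a) cplx set" where
  "iso_class R T U = {V \<in> T. homotopy_isomorphic R U V}"

definition K0_free ::
  "('a, 'r) ring_scheme \<Rightarrow> ('a, nat \<Rightarrow> 'a) cplx set \<Rightarrow> (('a, nat \<Rightarrow> 'a) cplx set \<Rightarrow>\<^sub>0 int) monoid" where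
  "K0_free R T = free_Abelian_group (iso_class R T ` T)"

definition K0_rels ::
  "('a, 'r) ring_scheme \<Rightarrow> ('a, nat \<Rightarrow> 'a) cplx set \<Rightarrow> (('a, nat \<Rightarrow> 'a) cplx set \<Rightarrow>\<^sub>0 int) set" where
  "K0_rels R T = generate (K0_free R T)
     {frag_of (iso_class R T V) - frag_of (iso_class R T U) - frag_of (iso_class R T W) | U V W f g h.
        U \<in> T \<and> V \<in> T \<and> W \<in> T \<and> exact_triangle R U V W f g h}"

definition K0 ::
  "('a, 'r) ring_scheme \<Rightarrow> ('a, nat \<Rightarrow> 'a) cplx set \<Rightarrow>
   (('a, nat \<Rightarrow> 'a) cplx set \<Rightarrow>\<^sub>0 int) set monoid" where
  "K0 R T = K0_free R T Mod K0_rels R T"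

text \<open>The class of a complex whose modules may live on another type than \<^typ>\<open>nat \<Rightarrow> 'a\<close>, given by
  its isomorphic copies in \<open>T\<close>.\<close>

definition K0_class ::
  "('a, 'r) ring_scheme \<Rightarrow> ('a, nat \<Rightarrow> 'a) cplx set \<Rightarrow> ('a, 'm) cplx \<Rightarrow>
   (('a, nat \<Rightarrow> 'a) cplx set \<Rightarrow>\<^sub>0 int) set" where
  "K0_class R T U = K0_rels R T #>\<^bsub>K0_free R T\<^esub> frag_of (iso_class R T U)"

end

theory Submission
  imports Defs
begin

text \<open>
  A perfect complex over a PID splits, without choosing bases, into stalks \<open>R[n]\<close> and two-term complexes
  \<open>R \<rightarrow> R\<close> given by multiplication by some \<open>a \<noteq> 0\<close>: if \<open>d \<noteq> 0\<close>, a value \<open>\<phi> (d x)\<close> minimal for divisibility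
  splits off, and the ranks drop.  Summands stay in \<open>\<T>\<^sub>S\<close>, since supports shrink under retracts.  In \<open>K\<^sub>0\<close> the class of a
  two-term complex is additive in \<open>a\<close> and changes sign under shifts, so \<open>K\<^sub>0\<close> is generated by \<open>R\<close> if
  \<open>S = Spec R\<close>, and by the \<open>M(p)\<close> with \<open>p \<in> S\<close> otherwise, where stalks do not occur because \<open>0 \<notin> S\<close>.

  Independence is seen by the invariants \<open>\<Sum>\<^sub>n (-1)\<^sup>n length H\<^sub>n(U)\<^sub>P\<close>, the length being taken over \<open>R\<^sub>P\<close>.  They are additive on
  triangles by the long exact sequence of a cone.  For \<open>P = 0\<close> the value on \<open>R\<close> is \<open>1\<close>; for \<open>P = (p)\<close> in \<open>S\<close> the
  value on \<open>M(q)\<close> is \<open>1\<close> if \<open>(q) = (p)\<close> and \<open>0\<close> otherwise.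
\<close>

text \<open>Finiteness of lengths shapes the proof. At \<open>P = 0\<close> every finitely generated
  module has finite rank, so this invariant exists on all of \<open>Dperf R\<close>. At a nonzero
  \<open>P\<close> the complex \<open>R\<close> itself has infinite length, and the invariant exists
  only on objects without stalk summands; this is why the proper case first excludes stalks and then
  proves finiteness by the same decomposition that yields generators. Localisations and quotient
  modules would change types at every step. Lengths are therefore measured by chains of submodules
  between \<open>A\<close> and \<open>B\<close>, and an isomorphism of subquotients is expressed by
  conditions on elements. For the same reason complements are cut out inside the given complex and
  \<open>R\<close> is replaced by its copy \<open>rfun R\<close>: every complex in the induction
  stays on one type. Generation is reduced to membership in a set \<open>L\<close> of formal sums
  that contains the relations and is closed under addition and negation. Both cases instantiate
  \<open>L\<close>, and the passage from triangles to members of \<open>L\<close> is made only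
  once.\<close>

context abelian_group
begin

text \<open>Ordered rewriting with \<open>a_ac\<close> may leave a third term between
  \<open>x\<close> and \<open>\<ominus> x\<close>; each position in which they can end up gets its
  own cancellation rule.\<close>

lemma add_cancels:
  assumes "x \<in> carrier G" "y \<in> carrier G"
  shows "x \<oplus> (y \<oplus> \<ominus> x) = y" "\<ominus> x \<oplus> (y \<oplus> x) = y" "x \<oplus> (\<ominus> x \<oplus> y) = y"
    "\<ominus> x \<oplus> (x \<oplus> y) = y" "x \<oplus> \<ominus> x = \<zero>" "\<ominus> x \<oplus> x = \<zero>"
  using assms by (simp_all add: a_ac r_neg l_neg r_neg1 r_neg2 a_lcomm[of x y] a_lcomm[of _ y])

lemmas ag_simps = a_ac add_cancels minus_add a_minus_def

end

section \<open>Module homomorphisms and submodules\<close>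

lemma mod_homI:
  assumes "\<And>x. x \<in> carrier M \<Longrightarrow> f x \<in> carrier N"
    and "\<And>x y. x \<in> carrier M \<Longrightarrow> y \<in> carrier M \<Longrightarrow> f (x \<oplus>\<^bsub>M\<^esub> y) = f x \<oplus>\<^bsub>N\<^esub> f y"
    and "\<And>r x. r \<in> carrier R \<Longrightarrow> x \<in> carrier M \<Longrightarrow> f (r \<odot>\<^bsub>M\<^esub> x) = r \<odot>\<^bsub>N\<^esub> f x"
  shows "f \<in> mod_hom R M N"
  using assms unfolding mod_hom_def hom_def by auto

lemma mod_homD:
  assumes "f \<in> mod_hom R M N"
  shows mod_hom_closed: "x \<in> carrier M \<Longrightarrow> f x \<in> carrier N"
    and mod_hom_add: "x \<in> carrier M \<Longrightarrow> y \<in> carrier M \<Longrightarrow> f (x \<oplus>\<^bsub>M\<^esub> y) = f x \<oplus>\<^bsub>N\<^esub> f y"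
    and mod_hom_smult: "r \<in> carrier R \<Longrightarrow> x \<in> carrier M \<Longrightarrow> f (r \<odot>\<^bsub>M\<^esub> x) = r \<odot>\<^bsub>N\<^esub> f x"
  using assms unfolding mod_hom_def hom_def by auto

lemma mod_hom_zero:
  assumes "module R M" "module R N" "f \<in> mod_hom R M N"
  shows "f \<zero>\<^bsub>M\<^esub> = \<zero>\<^bsub>N\<^esub>"
proof -
  interpret M: module R M by fact
  interpret N: module R N by fact
  have "f \<zero>\<^bsub>M\<^esub> \<oplus>\<^bsub>N\<^esub> f \<zero>\<^bsub>M\<^esub> = f \<zero>\<^bsub>M\<^esub>"
    using mod_hom_add[OF assms(3), of "\<zero>\<^bsub>M\<^esub>" "\<zero>\<^bsub>M\<^esub>"] by simp
  then show ?thesis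
    using mod_hom_closed[OF assms(3)] by (metis M.zero_closed N.add.l_cancel_one)
qed

lemma mod_hom_minus:
  assumes "module R M" "module R N" "f \<in> mod_hom R M N" "x \<in> carrier M"
  shows "f (\<ominus>\<^bsub>M\<^esub> x) = \<ominus>\<^bsub>N\<^esub> f x"
proof -
  interpret M: module R M by fact
  interpret N: module R N by fact
  have "f x \<oplus>\<^bsub>N\<^esub> f (\<ominus>\<^bsub>M\<^esub> x) = \<zero>\<^bsub>N\<^esub>"
    using mod_hom_add[OF assms(3,4), of "\<ominus>\<^bsub>M\<^esub> x"] assms(4) mod_hom_zero[OF assms(1-3)]
    by (simp add: M.r_neg)
  then show ?thesis
    using mod_hom_closed[OF assms(3)] assms(4) by (metis M.a_inv_closed N.minus_equality N.add.m_comm)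
qed

lemma mod_hom_comp:
  assumes "f \<in> mod_hom R L M" "g \<in> mod_hom R M N"
  shows "(\<lambda>x. g (f x)) \<in> mod_hom R L N"
  by (rule mod_homI) (simp_all add: mod_homD[OF assms(1)] mod_homD[OF assms(2)])

lemma mod_hom_id: "(\<lambda>x. x) \<in> mod_hom R M M"
  by (rule mod_homI) auto

lemma mod_hom_const_zero:
  assumes "module R M" "module R N"
  shows "(\<lambda>x. \<zero>\<^bsub>N\<^esub>) \<in> mod_hom R M N"
proof -
  interpret N: module R N by fact
  show ?thesis by (rule mod_homI) auto
qed

lemma mod_hom_plus:
  assumes "module R M" "module R N" "f \<in> mod_hom R M N" "g \<in> mod_hom R M N"
  shows "(\<lambda>x. f x \<oplus>\<^bsub>N\<^esub> g x) \<in> mod_hom R M N"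
proof -
  interpret N: module R N by fact
  show ?thesis
    by (rule mod_homI)
      (simp_all add: mod_homD[OF assms(3)] mod_homD[OF assms(4)] N.a_ac N.smult_r_distr)
qed

lemma mod_hom_uminus:
  assumes "module R M" "module R N" "f \<in> mod_hom R M N"
  shows "(\<lambda>x. \<ominus>\<^bsub>N\<^esub> f x) \<in> mod_hom R M N"
proof -
  interpret N: module R N by fact
  show ?thesis
    by (rule mod_homI)
      (simp_all add: mod_homD[OF assms(3)] N.a_ac N.smult_r_minus N.minus_add)
qed

lemma mod_hom_minus_fun:
  assumes "module R M" "module R N" "f \<in> mod_hom R M N" "g \<in> mod_hom R M N"
  shows "(\<lambda>x. f x \<ominus>\<^bsub>N\<^esub> g x) \<in> mod_hom R M N"
  unfolding a_minus_def by (intro mod_hom_plus mod_hom_uminus assms)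

lemma mod_hom_scale:
  assumes "module R M" "a \<in> carrier R"
  shows "(\<lambda>x. a \<odot>\<^bsub>M\<^esub> x) \<in> mod_hom R M M"
proof -
  interpret M: module R M by fact
  show ?thesis
    by (rule mod_homI)
      (use assms(2) in \<open>simp_all add: M.smult_r_distr M.smult_assoc1[symmetric] M.R.m_comm\<close>)
qed

lemma submodule_sum:
  assumes "module R M" "submodule A R M" "submodule B R M"
  shows "submodule {x \<oplus>\<^bsub>M\<^esub> y |x y. x \<in> A \<and> y \<in> B} R M"
proof -
  interpret M: module R M by fact
  note A = M.submoduleE[OF assms(2)] and B = M.submoduleE[OF assms(3)]
  have A0: "\<zero>\<^bsub>M\<^esub> \<in> A" "\<zero>\<^bsub>M\<^esub> \<in> B"
    using assms(2,3) by (auto simp: submodule_def dest: subgroup.one_closed)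
  show ?thesis
  proof (rule M.submoduleI)
    show "{x \<oplus>\<^bsub>M\<^esub> y |x y. x \<in> A \<and> y \<in> B} \<subseteq> carrier M" using A(1) B(1) by auto
    show "\<zero>\<^bsub>M\<^esub> \<in> {x \<oplus>\<^bsub>M\<^esub> y |x y. x \<in> A \<and> y \<in> B}" using A0 by force
    show "\<ominus>\<^bsub>M\<^esub> a \<in> {x \<oplus>\<^bsub>M\<^esub> y |x y. x \<in> A \<and> y \<in> B}" if a: "a \<in> {x \<oplus>\<^bsub>M\<^esub> y |x y. x \<in> A \<and> y \<in> B}" for a
    proof -
      from a obtain x y where xy: "x \<in> A" "y \<in> B" "a = x \<oplus>\<^bsub>M\<^esub> y" by blast
      then have "\<ominus>\<^bsub>M\<^esub> a = \<ominus>\<^bsub>M\<^esub> x \<oplus>\<^bsub>M\<^esub> \<ominus>\<^bsub>M\<^esub> y" using A(1) B(1) by (simp add: M.minus_add subset_iff)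
      then show ?thesis using xy A(3) B(3) by blast
    qed
    show "a \<oplus>\<^bsub>M\<^esub> b \<in> {x \<oplus>\<^bsub>M\<^esub> y |x y. x \<in> A \<and> y \<in> B}"
      if ab: "a \<in> {x \<oplus>\<^bsub>M\<^esub> y |x y. x \<in> A \<and> y \<in> B}" "b \<in> {x \<oplus>\<^bsub>M\<^esub> y |x y. x \<in> A \<and> y \<in> B}" for a b
    proof -
      from ab obtain x y x' y' where xy: "x \<in> A" "y \<in> B" "a = x \<oplus>\<^bsub>M\<^esub> y"
        "x' \<in> A" "y' \<in> B" "b = x' \<oplus>\<^bsub>M\<^esub> y'" by blast
      then have "a \<oplus>\<^bsub>M\<^esub> b = (x \<oplus>\<^bsub>M\<^esub> x') \<oplus>\<^bsub>M\<^esub> (y \<oplus>\<^bsub>M\<^esub> y')"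
        using A(1) B(1) by (simp add: M.a_ac subset_iff)
      then show ?thesis using xy A(5) B(5) by blast
    qed
    show "r \<odot>\<^bsub>M\<^esub> a \<in> {x \<oplus>\<^bsub>M\<^esub> y |x y. x \<in> A \<and> y \<in> B}"
      if a: "r \<in> carrier R" "a \<in> {x \<oplus>\<^bsub>M\<^esub> y |x y. x \<in> A \<and> y \<in> B}" for r a
    proof -
      from a obtain x y where xy: "x \<in> A" "y \<in> B" "a = x \<oplus>\<^bsub>M\<^esub> y" by blast
      then have "r \<odot>\<^bsub>M\<^esub> a = r \<odot>\<^bsub>M\<^esub> x \<oplus>\<^bsub>M\<^esub> r \<odot>\<^bsub>M\<^esub> y" using A(1) B(1) a(1) by (simp add: M.smult_r_distr subset_iff)
      then show ?thesis using xy A(4) B(4) a(1) by blast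
    qed
  qed
qed

lemma submodule_zeroD:
  assumes "submodule A R M" shows "\<zero>\<^bsub>M\<^esub> \<in> A"
  using assms by (auto simp: submodule_def dest: subgroup.one_closed)

lemma submodule_zero:
  assumes "module R M" shows "submodule {\<zero>\<^bsub>M\<^esub>} R M"
proof -
  interpret M: module R M by fact
  show ?thesis by (rule M.submoduleI) auto
qed

lemma submodule_inter:
  assumes "module R M" "submodule A R M" "submodule B R M"
  shows "submodule (A \<inter> B) R M"
proof -
  interpret M: module R M by fact
  show ?thesis
    using M.submoduleE[OF assms(2)] M.submoduleE[OF assms(3)] submodule_zeroD[OF assms(2)]
      submodule_zeroD[OF assms(3)]
    by (intro M.submoduleI) auto
qed

lemma submodule_image:
  assumes "module R M" "module R N" "f \<in> mod_hom R M N" "submodule A R M"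
  shows "submodule (f ` A) R N"
proof -
  interpret M: module R M by fact
  interpret N: module R N by fact
  note A = M.submoduleE[OF assms(4)]
  show ?thesis
  proof (rule N.submoduleI)
    show "f ` A \<subseteq> carrier N" using A(1) mod_hom_closed[OF assms(3)] by auto
    show "\<zero>\<^bsub>N\<^esub> \<in> f ` A" using submodule_zeroD[OF assms(4)] mod_hom_zero[OF assms(1-3)] by (metis imageI)
    show "\<ominus>\<^bsub>N\<^esub> a \<in> f ` A" if "a \<in> f ` A" for a
      using that A(1,3) by (auto simp: mod_hom_minus[OF assms(1-3), symmetric] subset_iff)
    show "a \<oplus>\<^bsub>N\<^esub> b \<in> f ` A" if "a \<in> f ` A" "b \<in> f ` A" for a b
      using that A(1,5) by (auto simp: mod_hom_add[OF assms(3), symmetric] subset_iff)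
    show "r \<odot>\<^bsub>N\<^esub> a \<in> f ` A" if "r \<in> carrier R" "a \<in> f ` A" for r a
      using that A(1,4) by (auto simp: mod_hom_smult[OF assms(3), symmetric] subset_iff)
  qed
qed

text \<open>Stated relative to a submodule \<open>B\<close> since most preimages below are taken
  inside the cycles of a complex.\<close>

lemma submodule_vimage:
  assumes "module R M" "module R N" "f \<in> mod_hom R M N" "submodule B R M" "submodule A R N"
  shows "submodule {x \<in> B. f x \<in> A} R M"
proof -
  interpret M: module R M by fact
  interpret N: module R N by fact
  note A = N.submoduleE[OF assms(5)] and B = M.submoduleE[OF assms(4)]
  show ?thesis
    by (rule M.submoduleI)
      (use A B submodule_zeroD[OF assms(4)] submodule_zeroD[OF assms(5)] in
        \<open>auto simp: subset_iff mod_hom_zero[OF assms(1-3)] mod_hom_minus[OF assms(1-3)]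
          mod_homD[OF assms(3)]\<close>)
qed


section \<open>Lengths of subquotients at a prime\<close>

text \<open>\<open>pstrict R P M A B\<close> says that the localisation \<open>(B / A)\<^sub>P\<close> is nonzero, so \<open>plen\<close> is the
  length of the \<open>R\<^sub>P\<close>-module \<open>(B / A)\<^sub>P\<close>; it is meaningless unless \<open>pfin\<close> holds.\<close>

definition pstrict ::
  "('a, 'r) ring_scheme \<Rightarrow> 'a set \<Rightarrow> ('a, 'm) module \<Rightarrow> 'm set \<Rightarrow> 'm set \<Rightarrow> bool" where
  "pstrict R P M A B \<longleftrightarrow> A \<subseteq> B \<and> (\<exists>x\<in>B. \<forall>r\<in>carrier R. r \<odot>\<^bsub>M\<^esub> x \<in> A \<longrightarrow> r \<in> P)"

text \<open>The chain is peeled off from the top, and at the bottom it only has to contain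
  \<open>A\<close>. The relation is thus monotone at both ends, and \<open>n\<close> counts the
  steps that stay strict at \<open>P\<close>.\<close>

primrec pchain ::
  "('a, 'r) ring_scheme \<Rightarrow> 'a set \<Rightarrow> ('a, 'm) module \<Rightarrow> nat \<Rightarrow> 'm set \<Rightarrow> 'm set \<Rightarrow> bool" where
  "pchain R P M 0 A B \<longleftrightarrow> A \<subseteq> B"
| "pchain R P M (Suc n) A B \<longleftrightarrow> (\<exists>N. submodule N R M \<and> pchain R P M n A N \<and> pstrict R P M N B)"

definition pfin ::
  "('a, 'r) ring_scheme \<Rightarrow> 'a set \<Rightarrow> ('a, 'm) module \<Rightarrow> 'm set \<Rightarrow> 'm set \<Rightarrow> bool" where
  "pfin R P M A B \<longleftrightarrow> (\<exists>n. \<not> pchain R P M n A B)"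

definition plen ::
  "('a, 'r) ring_scheme \<Rightarrow> 'a set \<Rightarrow> ('a, 'm) module \<Rightarrow> 'm set \<Rightarrow> 'm set \<Rightarrow> nat" where
  "plen R P M A B = (LEAST n. \<not> pchain R P M (Suc n) A B)"

lemma pstrict_mono: "pstrict R P M A B \<Longrightarrow> A' \<subseteq> A \<Longrightarrow> B \<subseteq> B' \<Longrightarrow> pstrict R P M A' B'"
  unfolding pstrict_def by blast

lemma pchain_subset: "pchain R P M n A B \<Longrightarrow> A \<subseteq> B"
  by (induction n arbitrary: B) (auto simp: pstrict_def)

lemma pchain_mono:
  "pchain R P M n A B \<Longrightarrow> A' \<subseteq> A \<Longrightarrow> B \<subseteq> B' \<Longrightarrow> pchain R P M n A' B'"
proof (induction n arbitrary: B B')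
  case (Suc n)
  then obtain N where "submodule N R M" "pchain R P M n A N" "pstrict R P M N B" by auto
  then show ?case using Suc.IH[of N N] Suc.prems(2,3) pstrict_mono[of R P M N B N B'] by auto
qed auto

lemma pchain_Suc_imp: "pchain R P M (Suc n) A B \<Longrightarrow> pchain R P M n A B"
  using pchain_mono by (fastforce simp: pstrict_def)

lemma pchain_le: "pchain R P M n A B \<Longrightarrow> m \<le> n \<Longrightarrow> pchain R P M m A B"
proof (induction n)
  case (Suc n)
  then show ?case using pchain_Suc_imp by (metis le_Suc_eq)
qed auto

text \<open>Chains can be shortened, so the attained lengths form an initial segment of the
  naturals; finiteness bounds it, and the least failure in \<open>plen\<close> marks its
  end.\<close>

lemma pchain_iff:
  assumes "pfin R P M A B" "A \<subseteq> B"
  shows "pchain R P M n A B \<longleftrightarrow> n \<le> plen R P M A B"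
proof -
  have ex: "\<exists>n. \<not> pchain R P M (Suc n) A B"
    using assms(1) pchain_Suc_imp unfolding pfin_def by blast
  have 1: "\<not> pchain R P M (Suc (plen R P M A B)) A B"
    unfolding plen_def using LeastI_ex[OF ex] .
  have 2: "pchain R P M (plen R P M A B) A B"
  proof (cases "plen R P M A B")
    case (Suc k)
    then show ?thesis
      using not_less_Least[of k "\<lambda>n. \<not> pchain R P M (Suc n) A B"] unfolding plen_def by auto
  qed (use assms(2) in auto)
  show ?thesis using 1 2 pchain_le by (metis not_less_eq_eq)
qed

lemma plen_eqI:
  assumes "\<And>n. pchain R P M n A B \<longleftrightarrow> n \<le> k"
  shows "pfin R P M A B" "plen R P M A B = k"
proof -
  show fin: "pfin R P M A B" unfolding pfin_def using assms by (metis not_less_eq_eq le_refl)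
  have "A \<subseteq> B" using assms[of 0] by auto
  then show "plen R P M A B = k" using pchain_iff[OF fin] assms by (metis le_refl le_antisym)
qed

lemma plen_eqI2:
  assumes "pchain R P M k A B" "\<not> pchain R P M (Suc k) A B"
  shows "pfin R P M A B" "plen R P M A B = k"
  using plen_eqI[of R P M A B k] assms pchain_le by (metis not_less_eq_eq)+

lemma pchain_append:
  assumes "pchain R P M m A B" "pchain R P M n B C"
  shows "pchain R P M (m + n) A C"
  using assms(2)
proof (induction n arbitrary: C)
  case 0
  then show ?case using assms(1) pchain_mono[of R P M m A B A C] by simp
next
  case (Suc n)
  then show ?case by auto
qed

text \<open>If \<open>(C / N)\<^sub>P \<noteq> 0\<close>, then \<open>(C \<inter> B) / (N \<inter> B)\<close> or \<open>(C + B) / (N + B)\<close> is nonzero at \<open>P\<close>.  Hence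
  lengths add up without any appeal to composition series.\<close>

lemma pchain_split:
  assumes "module R M" "primeideal P R" "submodule A R M" "submodule B R M" "A \<subseteq> B"
    and "submodule C R M" "pchain R P M n A C"
  shows "\<exists>i j. i + j = n \<and> pchain R P M i A (C \<inter> B) \<and>
    pchain R P M j B {x \<oplus>\<^bsub>M\<^esub> y |x y. x \<in> C \<and> y \<in> B}"
  using assms(6,7)
proof (induction n arbitrary: C)
  case 0
  interpret M: module R M by fact
  have "y \<in> {x \<oplus>\<^bsub>M\<^esub> y |x y. x \<in> C \<and> y \<in> B}" if "y \<in> B" for y
  proof -
    have "y = \<zero>\<^bsub>M\<^esub> \<oplus>\<^bsub>M\<^esub> y" using that M.submoduleE(1)[OF assms(4)] by auto
    then show ?thesis using submodule_zeroD[OF 0(1)] that by blast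
  qed
  then show ?case using 0 assms(5) by (intro exI[of _ 0]) auto
next
  case (Suc n)
  interpret M: module R M by fact
  interpret P: primeideal P R by fact
  note B = M.submoduleE[OF assms(4)] and C = M.submoduleE[OF Suc.prems(1)]
  let ?s = "\<lambda>C. {x \<oplus>\<^bsub>M\<^esub> y |x y. x \<in> C \<and> y \<in> B}"
  from Suc.prems obtain N where N: "submodule N R M" "pchain R P M n A N" "pstrict R P M N C" by auto
  from Suc.IH[OF N(1,2)] obtain i j where ij: "i + j = n" "pchain R P M i A (N \<inter> B)"
    "pchain R P M j B (?s N)" by auto
  note NE = M.submoduleE[OF N(1)]
  have NC: "N \<subseteq> C" using N(3) by (auto simp: pstrict_def)
  from N(3) obtain x where x: "x \<in> C" "\<And>r. r \<in> carrier R \<Longrightarrow> r \<odot>\<^bsub>M\<^esub> x \<in> N \<Longrightarrow> r \<in> P"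
    unfolding pstrict_def by auto
  have xM: "x \<in> carrier M" using x C(1) by auto
  have sub: "?s N \<subseteq> ?s C" using NC by blast
  have "pstrict R P M (N \<inter> B) (C \<inter> B) \<or> pstrict R P M (?s N) (?s C)"
  proof (rule disjCI)
    assume "\<not> pstrict R P M (?s N) (?s C)"
    moreover have "x \<in> ?s C" 
      using x(1) submodule_zeroD[OF assms(4)] M.r_zero[OF xM, symmetric] by blast
    \<comment> \<open>If the step is trivial at \<open>P\<close> after adding \<open>B\<close>, some
      \<open>r\<close> outside \<open>P\<close> moves \<open>x\<close> into \<open>N + B\<close>.
      The component \<open>v\<close> in \<open>B\<close> then replaces \<open>x\<close>: modulo
      \<open>N\<close> it equals \<open>r x\<close>, and primality of \<open>P\<close> allows
      \<open>r\<close> to be cancelled.\<close>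
    ultimately obtain r where r: "r \<in> carrier R" "r \<odot>\<^bsub>M\<^esub> x \<in> ?s N" "r \<notin> P"
      using sub unfolding pstrict_def by blast
    then obtain m v where mv: "m \<in> N" "v \<in> B" "r \<odot>\<^bsub>M\<^esub> x = m \<oplus>\<^bsub>M\<^esub> v" by blast
    have mvM: "m \<in> carrier M" "v \<in> carrier M" using mv NE(1) B(1) by auto
    have v: "v = r \<odot>\<^bsub>M\<^esub> x \<oplus>\<^bsub>M\<^esub> \<ominus>\<^bsub>M\<^esub> m" using mv(3) mvM by (simp add: M.ag_simps)
    then have "v \<in> C" using C(3-5) NC mv(1) r(1) x(1) by auto
    moreover have "t \<in> P" if t: "t \<in> carrier R" "t \<odot>\<^bsub>M\<^esub> v \<in> N \<inter> B" for t
    proof -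
      have "(t \<otimes>\<^bsub>R\<^esub> r) \<odot>\<^bsub>M\<^esub> x = t \<odot>\<^bsub>M\<^esub> m \<oplus>\<^bsub>M\<^esub> t \<odot>\<^bsub>M\<^esub> v"
        using t(1) r(1) xM mv(3) mvM by (simp add: M.smult_assoc1 M.smult_r_distr)
      also have "\<dots> \<in> N" using t mv(1) NE(4,5) by auto
      finally have "t \<otimes>\<^bsub>R\<^esub> r \<in> P" using x(2) t(1) r(1) by auto
      then show ?thesis using P.I_prime[OF t(1) r(1)] r(3) by auto
    qed
    ultimately show "pstrict R P M (N \<inter> B) (C \<inter> B)" using NC mv(2) unfolding pstrict_def by blast
  qed
  then show ?case
  proof
    assume "pstrict R P M (N \<inter> B) (C \<inter> B)"
    then have "pchain R P M (Suc i) A (C \<inter> B)"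
      using ij submodule_inter[OF assms(1) N(1) assms(4)] by auto
    moreover have "Suc i + j = Suc n" using ij(1) by simp
    ultimately show ?thesis using pchain_mono[OF ij(3) order_refl sub] by blast
  next
    assume "pstrict R P M (?s N) (?s C)"
    then have "pchain R P M (Suc j) B (?s C)"
      using ij submodule_sum[OF assms(1) N(1) assms(4)] by auto
    moreover have "pchain R P M i A (C \<inter> B)" using pchain_mono[OF ij(2) order_refl, of "C \<inter> B"] NC by blast
    moreover have "i + Suc j = Suc n" using ij(1) by simp
    ultimately show ?thesis by blast
  qed
qed

text \<open>For \<open>B \<subseteq> C\<close> the intersection and the sum in
  \<open>pchain_split\<close> collapse to \<open>B\<close> and \<open>C\<close>.\<close>

lemma pchain_add_iff:
  assumes "module R M" "primeideal P R" "submodule A R M" "submodule B R M" "submodule C R M" "A \<subseteq> B" "B \<subseteq> C"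
  shows "pchain R P M n A C \<longleftrightarrow> (\<exists>i j. i + j = n \<and> pchain R P M i A B \<and> pchain R P M j B C)"
proof
  interpret M: module R M by fact
  assume "pchain R P M n A C"
  from pchain_split[OF assms(1-4,6,5) this] obtain i j where ij: "i + j = n" "pchain R P M i A (C \<inter> B)"
    "pchain R P M j B {x \<oplus>\<^bsub>M\<^esub> y |x y. x \<in> C \<and> y \<in> B}" by auto
  have "C \<inter> B = B" using assms(7) by auto
  moreover have "{x \<oplus>\<^bsub>M\<^esub> y |x y. x \<in> C \<and> y \<in> B} \<subseteq> C"
    using M.submoduleE(5)[OF assms(5)] assms(7) by auto
  ultimately show "\<exists>i j. i + j = n \<and> pchain R P M i A B \<and> pchain R P M j B C"
    using ij pchain_mono[OF ij(3) order_refl, of C] by auto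
qed (use pchain_append in blast)

lemma pfin_plen_add:
  assumes "module R M" "primeideal P R" "submodule A R M" "submodule B R M" "submodule C R M" "A \<subseteq> B" "B \<subseteq> C"
  shows pfin_add_iff: "pfin R P M A C \<longleftrightarrow> pfin R P M A B \<and> pfin R P M B C"
    and plen_add: "pfin R P M A C \<Longrightarrow> plen R P M A C = plen R P M A B + plen R P M B C"
proof -
  note iff = pchain_add_iff[OF assms]
  have AC: "A \<subseteq> C" using assms(6,7) by auto
  have 1: "pfin R P M A B" if "pfin R P M A C"
    using that pchain_mono[OF _ order_refl assms(7)] unfolding pfin_def by blast
  have 2: "pfin R P M B C" if "pfin R P M A C"
    using that pchain_mono[OF _ assms(6) order_refl] unfolding pfin_def by blast
  have 3: "pchain R P M n A C \<longleftrightarrow> n \<le> plen R P M A B + plen R P M B C"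
    if "pfin R P M A B" "pfin R P M B C" for n
  proof -
    have "pchain R P M n A C \<longleftrightarrow> (\<exists>i j. i + j = n \<and> i \<le> plen R P M A B \<and> j \<le> plen R P M B C)"
      using iff pchain_iff[OF that(1) assms(6)] pchain_iff[OF that(2) assms(7)] by simp
    also have "\<dots> \<longleftrightarrow> n \<le> plen R P M A B + plen R P M B C"
    proof
      assume "n \<le> plen R P M A B + plen R P M B C"
      then show "\<exists>i j. i + j = n \<and> i \<le> plen R P M A B \<and> j \<le> plen R P M B C"
        by (intro exI[of _ "min n (plen R P M A B)"] exI[of _ "n - min n (plen R P M A B)"]) auto
    qed auto
    finally show ?thesis .
  qed
  show "pfin R P M A C \<longleftrightarrow> pfin R P M A B \<and> pfin R P M B C"
    using 1 2 plen_eqI(1)[OF 3] by blast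
  show "pfin R P M A C \<Longrightarrow> plen R P M A C = plen R P M A B + plen R P M B C"
    using 1 2 plen_eqI(2)[OF 3] by blast
qed

text \<open>All scalars map an element of \<open>A\<close> into \<open>A\<close>, so a strict step
  would force \<open>P\<close> to be the whole ring.\<close>

lemma plen_refl:
  assumes "submodule A R M" "primeideal P R"
  shows "pfin R P M A A" "plen R P M A A = 0"
proof -
  have "\<not> pchain R P M (Suc 0) A A"
  proof
    assume "pchain R P M (Suc 0) A A"
    then obtain N where N: "submodule N R M" "A \<subseteq> N" "pstrict R P M N A" by auto
    then obtain x where "x \<in> A" "\<forall>r\<in>carrier R. r \<odot>\<^bsub>M\<^esub> x \<in> N \<longrightarrow> r \<in> P" by (auto simp: pstrict_def)
    then have "carrier R \<subseteq> P" using N(2) submodule.smult_closed[OF assms(1)] by blast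
    then show False using assms(2) by (metis primeideal.I_notcarr ideal.Icarr primeideal.axioms(1) subsetI subset_antisym)
  qed
  then show "pfin R P M A A" "plen R P M A A = 0" by (auto intro!: plen_eqI2[where k = 0])
qed

lemma pchain_transfer:
  assumes "module R M" "module R N" "f \<in> mod_hom R M N"
    and "submodule A R M" "submodule B R M" "submodule A' R N" "submodule B' R N" "A' \<subseteq> B'"
    and im: "\<And>x. x \<in> B \<Longrightarrow> f x \<in> B'"
    and surj: "\<And>y. y \<in> B' \<Longrightarrow> \<exists>x\<in>B. \<exists>a\<in>A'. y = f x \<oplus>\<^bsub>N\<^esub> a"
    and ker: "\<And>x. x \<in> B \<Longrightarrow> f x \<in> A' \<longleftrightarrow> x \<in> A" and AB: "A \<subseteq> B"
  shows "pchain R P M n A B \<longleftrightarrow> pchain R P N n A' B'"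
proof -
  interpret M: module R M by fact
  interpret N: module R N by fact
  note A = M.submoduleE[OF assms(4)] and B = M.submoduleE[OF assms(5)]
    and A' = N.submoduleE[OF assms(6)] and B' = N.submoduleE[OF assms(7)]
  note f = mod_homD[OF assms(3)]
  define F where "F C = {x \<oplus>\<^bsub>N\<^esub> y |x y. x \<in> f ` C \<and> y \<in> A'}" for C
  define G where "G C = {x \<in> B. f x \<in> C}" for C
  have F: "submodule (F C) R N" if "submodule C R M" for C
    unfolding F_def by (intro submodule_sum submodule_image[OF assms(1)] that assms)
  have G: "submodule (G C) R M" if "submodule C R N" for C
    unfolding G_def by (intro submodule_vimage[of R M N f B C] that assms)
  have A'F: "A' \<subseteq> F C" if "submodule C R M" for C
  proof
    fix y assume "y \<in> A'"
    moreover have "y = f \<zero>\<^bsub>M\<^esub> \<oplus>\<^bsub>N\<^esub> y" using \<open>y \<in> A'\<close> A'(1) by (auto simp: mod_hom_zero[OF assms(1-3)])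
    ultimately show "y \<in> F C" using submodule_zeroD[OF that] unfolding F_def by blast
  qed
  have Fstrict: "pstrict R P N (F C) (F D)"
    if CD: "pstrict R P M C D" "submodule C R M" "submodule D R M" "A \<subseteq> C" "D \<subseteq> B" for C D
  proof -
    note C = M.submoduleE[OF CD(2)] and D = M.submoduleE[OF CD(3)]
    from CD(1) obtain x where x: "x \<in> D" "C \<subseteq> D" "\<And>r. r \<in> carrier R \<Longrightarrow> r \<odot>\<^bsub>M\<^esub> x \<in> C \<Longrightarrow> r \<in> P"
      unfolding pstrict_def by auto
    have xM: "x \<in> carrier M" using x D by auto
    have "f x \<in> F D" unfolding F_def 
      using x(1) submodule_zeroD[OF assms(6)] N.r_zero[OF f(1)[OF xM], symmetric] by blast
    moreover have "r \<in> P" if r: "r \<in> carrier R" "r \<odot>\<^bsub>N\<^esub> f x \<in> F C" for r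
    proof -
      from r(2) obtain c a where ca: "c \<in> C" "a \<in> A'" "r \<odot>\<^bsub>N\<^esub> f x = f c \<oplus>\<^bsub>N\<^esub> a"
        unfolding F_def by auto
      have caM: "c \<in> carrier M" "a \<in> carrier N" using ca C(1) A'(1) by auto
      \<comment> \<open>The difference of \<open>r x\<close> and \<open>c\<close> is mapped to
        \<open>a \<in> A'\<close>, so by \<open>ker\<close> it lies in \<open>A\<close>, hence in
        \<open>C\<close>. This is where injectivity of the induced map enters.\<close>
      define y where "y = r \<odot>\<^bsub>M\<^esub> x \<oplus>\<^bsub>M\<^esub> \<ominus>\<^bsub>M\<^esub> c"
      have yB: "y \<in> B" unfolding y_def using B(3-5) r(1) x(1,2) CD(5) ca(1) by (meson subsetD)
      have "f y = r \<odot>\<^bsub>N\<^esub> f x \<oplus>\<^bsub>N\<^esub> \<ominus>\<^bsub>N\<^esub> f c" unfolding y_def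
        using r(1) xM caM f by (simp add: mod_hom_minus[OF assms(1-3)])
      also have "\<dots> = a" unfolding ca(3) using caM f(1) by (simp add: N.ag_simps)
      finally have "y \<in> A" using ker[OF yB] ca(2) by simp
      then have "y \<oplus>\<^bsub>M\<^esub> c \<in> C" using CD(4) ca(1) C(5) by auto
      moreover have "y \<oplus>\<^bsub>M\<^esub> c = r \<odot>\<^bsub>M\<^esub> x" unfolding y_def using r(1) xM caM
        by (simp add: M.ag_simps)
      ultimately show ?thesis using x(3) r(1) by auto
    qed
    ultimately show ?thesis using x(2) unfolding pstrict_def F_def by blast
  qed
  have Gstrict: "pstrict R P M (G C) (G D)"
    if CD: "pstrict R P N C D" "submodule C R N" "submodule D R N" "A' \<subseteq> C" "D \<subseteq> B'" for C D
  proof -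
    note C = N.submoduleE[OF CD(2)] and D = N.submoduleE[OF CD(3)]
    from CD(1) obtain y where y: "y \<in> D" "C \<subseteq> D" "\<And>r. r \<in> carrier R \<Longrightarrow> r \<odot>\<^bsub>N\<^esub> y \<in> C \<Longrightarrow> r \<in> P"
      unfolding pstrict_def by auto
    from surj y CD(5) obtain x a where xa: "x \<in> B" "a \<in> A'" "y = f x \<oplus>\<^bsub>N\<^esub> a" by blast
    have xM: "x \<in> carrier M" "a \<in> carrier N" using xa A'(1) B(1) by auto
    have "f x = y \<oplus>\<^bsub>N\<^esub> \<ominus>\<^bsub>N\<^esub> a" unfolding xa(3) using xM f(1) by (simp add: N.ag_simps)
    also have "\<dots> \<in> D" using D(3,5) y(1,2) xa(2) CD(4) by (meson subsetD)
    finally have "x \<in> G D" using xa(1) unfolding G_def by auto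
    moreover have "r \<in> P" if r: "r \<in> carrier R" "r \<odot>\<^bsub>M\<^esub> x \<in> G C" for r
    proof -
      have "f (r \<odot>\<^bsub>M\<^esub> x) \<in> C" using r(2) by (simp add: G_def)
      then have "r \<odot>\<^bsub>N\<^esub> f x \<oplus>\<^bsub>N\<^esub> r \<odot>\<^bsub>N\<^esub> a \<in> C"
        using C(4,5) xa(2) CD(4) r(1) xM(1) by (auto simp: f)
      then have "r \<odot>\<^bsub>N\<^esub> y \<in> C" unfolding xa(3) using r(1) xM f(1) by (simp add: N.smult_r_distr)
      then show ?thesis using y(3) r(1) by auto
    qed
    ultimately show ?thesis using y(2) unfolding pstrict_def G_def by blast
  qed
  have 1: "pchain R P M n A C \<Longrightarrow> submodule C R M \<Longrightarrow> C \<subseteq> B \<Longrightarrow> pchain R P N n A' (F C)" for C n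
  proof (induction n arbitrary: C)
    case (Suc n)
    then obtain D where D: "submodule D R M" "pchain R P M n A D" "pstrict R P M D C" by auto
    have "D \<subseteq> C" using D(3) by (simp add: pstrict_def)
    then show ?case
      using Suc.IH[OF D(2,1)] F[OF D(1)] Fstrict[OF D(3,1) Suc.prems(2) pchain_subset[OF D(2)]] Suc.prems(3)
      by auto
  qed (simp add: A'F)
  have 2: "pchain R P N n A' C \<Longrightarrow> submodule C R N \<Longrightarrow> C \<subseteq> B' \<Longrightarrow> pchain R P M n A (G C)" for C n
  proof (induction n arbitrary: C)
    case (Suc n)
    then obtain D where D: "submodule D R N" "pchain R P N n A' D" "pstrict R P N D C" by auto
    have "D \<subseteq> C" using D(3) by (simp add: pstrict_def)
    then show ?case
      using Suc.IH[OF D(2,1)] G[OF D(1)] Gstrict[OF D(3,1) Suc.prems(2) pchain_subset[OF D(2)]] Suc.prems(3)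
      by auto
  next
    case 0
    then show ?case using ker AB unfolding G_def by auto
  qed
  have "F B = B'" 
  proof
    show "F B \<subseteq> B'" unfolding F_def using im B'(5) assms(8) by blast
    show "B' \<subseteq> F B" unfolding F_def using surj by blast
  qed
  moreover have "G B' = B" unfolding G_def using im by auto
  ultimately show ?thesis
    using 1[OF _ assms(5) order_refl, of n] 2[OF _ assms(7) order_refl, of n] by auto
qed

lemma plen_cong_pchain:
  assumes "\<And>n. pchain R P M n A B \<longleftrightarrow> pchain R P N n A' B'"
  shows "pfin R P M A B \<longleftrightarrow> pfin R P N A' B'" "plen R P M A B = plen R P N A' B'"
  using assms by (simp_all add: pfin_def plen_def del: pchain.simps)

lemmas plen_transfer = plen_cong_pchain[OF pchain_transfer]

section \<open>Complexes and homotopy equivalences\<close>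

text \<open>The \<open>_Suc\<close> forms have the index \<open>n + 1 - 1\<close> already
  simplified, so that they can be used by resolution.\<close>

lemma is_complexD:
  assumes "is_complex R U"
  shows cx_module: "module R (cobj U n)"
    and cx_diff: "cdiff U n \<in> mod_hom R (cobj U n) (cobj U (n - 1))"
    and cx_diff_Suc: "cdiff U (n + 1) \<in> mod_hom R (cobj U (n + 1)) (cobj U n)"
    and cx_dd: "x \<in> carrier (cobj U n) \<Longrightarrow> cdiff U (n - 1) (cdiff U n x) = \<zero>\<^bsub>cobj U (n - 2)\<^esub>"
    and cx_dd_Suc: "y \<in> carrier (cobj U (n + 1)) \<Longrightarrow> cdiff U n (cdiff U (n + 1) y) = \<zero>\<^bsub>cobj U (n - 1)\<^esub>"
proof -
  have "\<forall>n. module R (cobj U n) \<and> cdiff U n \<in> mod_hom R (cobj U n) (cobj U (n - 1)) \<and>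
          (\<forall>x\<in>carrier (cobj U n). cdiff U (n - 1) (cdiff U n x) = \<zero>\<^bsub>cobj U (n - 2)\<^esub>)"
    using assms unfolding is_complex_def .
  note a = this[rule_format]
  show "module R (cobj U n)" "cdiff U n \<in> mod_hom R (cobj U n) (cobj U (n - 1))"
    "x \<in> carrier (cobj U n) \<Longrightarrow> cdiff U (n - 1) (cdiff U n x) = \<zero>\<^bsub>cobj U (n - 2)\<^esub>"
    using a by auto
  show "cdiff U (n + 1) \<in> mod_hom R (cobj U (n + 1)) (cobj U n)"
    "y \<in> carrier (cobj U (n + 1)) \<Longrightarrow> cdiff U n (cdiff U (n + 1) y) = \<zero>\<^bsub>cobj U (n - 1)\<^esub>"
    using a[of "n + 1"] by auto
qed

lemma chain_mapD:
  assumes "chain_map R U V f"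
  shows chain_map_hom: "f n \<in> mod_hom R (cobj U n) (cobj V n)"
    and chain_map_comm: "x \<in> carrier (cobj U n) \<Longrightarrow> cdiff V n (f n x) = f (n - 1) (cdiff U n x)"
    and chain_map_comm_Suc: "y \<in> carrier (cobj U (n + 1)) \<Longrightarrow>
      cdiff V (n + 1) (f (n + 1) y) = f n (cdiff U (n + 1) y)"
proof -
  have "\<forall>n. f n \<in> mod_hom R (cobj U n) (cobj V n) \<and>
          (\<forall>x\<in>carrier (cobj U n). cdiff V n (f n x) = f (n - 1) (cdiff U n x))"
    using assms unfolding chain_map_def .
  note a = this[rule_format]
  show "f n \<in> mod_hom R (cobj U n) (cobj V n)"
    "x \<in> carrier (cobj U n) \<Longrightarrow> cdiff V n (f n x) = f (n - 1) (cdiff U n x)"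
    using a by auto
  show "y \<in> carrier (cobj U (n + 1)) \<Longrightarrow> cdiff V (n + 1) (f (n + 1) y) = f n (cdiff U (n + 1) y)"
    using a[of "n + 1"] by auto
qed

lemma chain_mapI:
  assumes "\<And>n. f n \<in> mod_hom R (cobj U n) (cobj V n)"
    and "\<And>n x. x \<in> carrier (cobj U n) \<Longrightarrow> cdiff V n (f n x) = f (n - 1) (cdiff U n x)"
  shows "chain_map R U V f"
  using assms unfolding chain_map_def by auto

lemma chain_map_id: "chain_map R U U (\<lambda>n x. x)"
  by (rule chain_mapI) (auto intro: mod_hom_id)

lemma chain_map_comp:
  assumes "is_complex R U" "chain_map R U V f" "chain_map R V W g"
  shows "chain_map R U W (\<lambda>n x. g n (f n x))"
proof (rule chain_mapI)
  show "(\<lambda>x. g n (f n x)) \<in> mod_hom R (cobj U n) (cobj W n)" for n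
    by (rule mod_hom_comp[OF chain_map_hom[OF assms(2)] chain_map_hom[OF assms(3)]])
  show "cdiff W n (g n (f n x)) = g (n - 1) (f (n - 1) (cdiff U n x))" if "x \<in> carrier (cobj U n)" for n x
    using chain_map_comm[OF assms(2) that]
      chain_map_comm[OF assms(3) mod_hom_closed[OF chain_map_hom[OF assms(2)] that]] by simp
qed

lemma (in abelian_group) minus_eq_iff:
  assumes "x \<in> carrier G" "y \<in> carrier G" "z \<in> carrier G"
  shows "x \<ominus> y = z \<longleftrightarrow> x = z \<oplus> y"
proof
  assume "x \<ominus> y = z"
  then have "z \<oplus> y = x \<ominus> y \<oplus> y" by simp
  then show "x = z \<oplus> y" using assms by (simp add: ag_simps)
next
  assume "x = z \<oplus> y"
  then show "x \<ominus> y = z" using assms by (simp add: ag_simps)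
qed

text \<open>The homotopy identity is solved for \<open>f n x\<close>, which makes it a rewrite rule
  free of subtraction.\<close>

lemma chain_homotopicE:
  assumes "chain_homotopic R U V f g" "is_complex R U" "is_complex R V"
    and "\<And>n x. x \<in> carrier (cobj U n) \<Longrightarrow> f n x \<in> carrier (cobj V n)"
    and "\<And>n x. x \<in> carrier (cobj U n) \<Longrightarrow> g n x \<in> carrier (cobj V n)"
  obtains s where "\<And>n. s n \<in> mod_hom R (cobj U n) (cobj V (n + 1))"
    and "\<And>n. s (n - 1) \<in> mod_hom R (cobj U (n - 1)) (cobj V n)"
    and "\<And>n x. x \<in> carrier (cobj U n) \<Longrightarrow>
      f n x = cdiff V (n + 1) (s n x) \<oplus>\<^bsub>cobj V n\<^esub> s (n - 1) (cdiff U n x) \<oplus>\<^bsub>cobj V n\<^esub> g n x"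
proof -
  interpret V: module R "cobj V m" for m by (rule cx_module[OF assms(3)])
  from assms(1) obtain s where "\<forall>n. s n \<in> mod_hom R (cobj U n) (cobj V (n + 1)) \<and>
       (\<forall>x\<in>carrier (cobj U n).
          f n x \<ominus>\<^bsub>cobj V n\<^esub> g n x = cdiff V (n + 1) (s n x) \<oplus>\<^bsub>cobj V n\<^esub> s (n - 1) (cdiff U n x))"
    unfolding chain_homotopic_def by blast
  note s = this[rule_format]
  have s1: "s n \<in> mod_hom R (cobj U n) (cobj V (n + 1))" for n using s by blast
  have s2: "s (n - 1) \<in> mod_hom R (cobj U (n - 1)) (cobj V n)" for n using s1[of "n - 1"] by simp
  have "f n x = cdiff V (n + 1) (s n x) \<oplus>\<^bsub>cobj V n\<^esub> s (n - 1) (cdiff U n x) \<oplus>\<^bsub>cobj V n\<^esub> g n x"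
    if x: "x \<in> carrier (cobj U n)" for n x
  proof -
    have "f n x \<ominus>\<^bsub>cobj V n\<^esub> g n x = cdiff V (n + 1) (s n x) \<oplus>\<^bsub>cobj V n\<^esub> s (n - 1) (cdiff U n x)"
      using s[of n] x by blast
    moreover have "cdiff V (n + 1) (s n x) \<oplus>\<^bsub>cobj V n\<^esub> s (n - 1) (cdiff U n x) \<in> carrier (cobj V n)"
      using mod_hom_closed[OF s1] mod_hom_closed[OF s2] mod_hom_closed[OF cx_diff[OF assms(2)]]
        mod_hom_closed[OF cx_diff_Suc[OF assms(3)]] x by (intro V.a_closed) auto
    ultimately show ?thesis using V.minus_eq_iff[OF assms(4)[OF x] assms(5)[OF x]] by blast
  qed
  then show ?thesis using s1 s2 that by blast
qed

lemma chain_homotopicI: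
  assumes "is_complex R U" "is_complex R V"
    and "\<And>n x. x \<in> carrier (cobj U n) \<Longrightarrow> f n x \<in> carrier (cobj V n)"
    and "\<And>n x. x \<in> carrier (cobj U n) \<Longrightarrow> g n x \<in> carrier (cobj V n)"
    and s: "\<And>n. s n \<in> mod_hom R (cobj U n) (cobj V (n + 1))"
    and eq: "\<And>n x. x \<in> carrier (cobj U n) \<Longrightarrow>
      f n x = cdiff V (n + 1) (s n x) \<oplus>\<^bsub>cobj V n\<^esub> s (n - 1) (cdiff U n x) \<oplus>\<^bsub>cobj V n\<^esub> g n x"
  shows "chain_homotopic R U V f g"
proof -
  interpret V: module R "cobj V m" for m by (rule cx_module[OF assms(2)])
  have s2: "s (n - 1) \<in> mod_hom R (cobj U (n - 1)) (cobj V n)" for n using s[of "n - 1"] by simp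
  have "f n x \<ominus>\<^bsub>cobj V n\<^esub> g n x = cdiff V (n + 1) (s n x) \<oplus>\<^bsub>cobj V n\<^esub> s (n - 1) (cdiff U n x)"
    if x: "x \<in> carrier (cobj U n)" for n x
  proof -
    have "cdiff V (n + 1) (s n x) \<oplus>\<^bsub>cobj V n\<^esub> s (n - 1) (cdiff U n x) \<in> carrier (cobj V n)"
      using mod_hom_closed[OF s] mod_hom_closed[OF s2] mod_hom_closed[OF cx_diff[OF assms(1)]]
        mod_hom_closed[OF cx_diff_Suc[OF assms(2)]] x by (intro V.a_closed) auto
    then show ?thesis using V.minus_eq_iff[OF assms(3)[OF x] assms(4)[OF x]] eq[OF x] by blast
  qed
  then show ?thesis unfolding chain_homotopic_def using s by (intro exI[of _ s]) auto
qed

lemma chain_homotopic_cong: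
  assumes "is_complex R U" "is_complex R V"
    and "\<And>n x. x \<in> carrier (cobj U n) \<Longrightarrow> f n x \<in> carrier (cobj V n)"
    and "\<And>n x. x \<in> carrier (cobj U n) \<Longrightarrow> f n x = g n x"
  shows "chain_homotopic R U V f g"
proof (rule chain_homotopicI[where s = "\<lambda>n x. \<zero>\<^bsub>cobj V (n + 1)\<^esub>"])
  interpret V: module R "cobj V m" for m by (rule cx_module[OF assms(2)])
  fix n x assume x: "x \<in> carrier (cobj U n)"
  show "g n x \<in> carrier (cobj V n)" using assms(3,4) x by metis
  show "f n x = cdiff V (n + 1) \<zero>\<^bsub>cobj V (n + 1)\<^esub> \<oplus>\<^bsub>cobj V n\<^esub> \<zero>\<^bsub>cobj V (n - 1 + 1)\<^esub> \<oplus>\<^bsub>cobj V n\<^esub> g n x"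
    using assms(3)[OF x] assms(4)[OF x]
    by (simp add: mod_hom_zero[OF cx_module[OF assms(2)] cx_module[OF assms(2)] cx_diff_Suc[OF assms(2)]])
next
  show "(\<lambda>x. \<zero>\<^bsub>cobj V (n + 1)\<^esub>) \<in> mod_hom R (cobj U n) (cobj V (n + 1))" for n
    by (rule mod_hom_const_zero[OF cx_module[OF assms(1)] cx_module[OF assms(2)]])
qed (use assms in auto)

lemma chain_homotopic_trans:
  assumes "chain_homotopic R U V f g" "chain_homotopic R U V g h" "is_complex R U" "is_complex R V"
    and "\<And>n x. x \<in> carrier (cobj U n) \<Longrightarrow> f n x \<in> carrier (cobj V n)"
    and "\<And>n x. x \<in> carrier (cobj U n) \<Longrightarrow> g n x \<in> carrier (cobj V n)"
    and "\<And>n x. x \<in> carrier (cobj U n) \<Longrightarrow> h n x \<in> carrier (cobj V n)"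
  shows "chain_homotopic R U V f h"
proof -
  interpret V: module R "cobj V m" for m by (rule cx_module[OF assms(4)])
  obtain s where s: "\<And>n. s n \<in> mod_hom R (cobj U n) (cobj V (n + 1))"
    "\<And>n. s (n - 1) \<in> mod_hom R (cobj U (n - 1)) (cobj V n)"
    "\<And>n x. x \<in> carrier (cobj U n) \<Longrightarrow>
      f n x = cdiff V (n + 1) (s n x) \<oplus>\<^bsub>cobj V n\<^esub> s (n - 1) (cdiff U n x) \<oplus>\<^bsub>cobj V n\<^esub> g n x"
    using chain_homotopicE[OF assms(1,3,4,5,6)] by blast
  obtain t where t: "\<And>n. t n \<in> mod_hom R (cobj U n) (cobj V (n + 1))"
    "\<And>n. t (n - 1) \<in> mod_hom R (cobj U (n - 1)) (cobj V n)"
    "\<And>n x. x \<in> carrier (cobj U n) \<Longrightarrow>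
      g n x = cdiff V (n + 1) (t n x) \<oplus>\<^bsub>cobj V n\<^esub> t (n - 1) (cdiff U n x) \<oplus>\<^bsub>cobj V n\<^esub> h n x"
    using chain_homotopicE[OF assms(2,3,4,6,7)] by blast
  show ?thesis
  proof (rule chain_homotopicI[OF assms(3,4,5,7), where s = "\<lambda>n x. s n x \<oplus>\<^bsub>cobj V (n + 1)\<^esub> t n x"])
    show "(\<lambda>x. s n x \<oplus>\<^bsub>cobj V (n + 1)\<^esub> t n x) \<in> mod_hom R (cobj U n) (cobj V (n + 1))" for n
      by (intro mod_hom_plus cx_module[OF assms(3)] cx_module[OF assms(4)] s t)
    fix n x assume x: "x \<in> carrier (cobj U n)"
    have c: "s n x \<in> carrier (cobj V (n + 1))" "t n x \<in> carrier (cobj V (n + 1))"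
      "s (n - 1) (cdiff U n x) \<in> carrier (cobj V n)" "t (n - 1) (cdiff U n x) \<in> carrier (cobj V n)"
      using mod_hom_closed[OF s(1)] mod_hom_closed[OF t(1)] mod_hom_closed[OF s(2)] mod_hom_closed[OF t(2)] x
        mod_hom_closed[OF cx_diff[OF assms(3)]] by auto
    note d = mod_homD[OF cx_diff_Suc[OF assms(4)]]
    show "f n x = cdiff V (n + 1) (s n x \<oplus>\<^bsub>cobj V (n + 1)\<^esub> t n x) \<oplus>\<^bsub>cobj V n\<^esub>
        (s (n - 1) (cdiff U n x) \<oplus>\<^bsub>cobj V (n - 1 + 1)\<^esub> t (n - 1) (cdiff U n x)) \<oplus>\<^bsub>cobj V n\<^esub> h n x"
      unfolding s(3)[OF x] t(3)[OF x] using c assms(7)[OF x] d by (simp add: V.a_ac)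
  qed
qed

lemma chain_homotopic_comp:
  assumes "chain_homotopic R U V f g" "is_complex R T" "is_complex R U" "is_complex R V" "is_complex R W"
    and "\<And>n x. x \<in> carrier (cobj U n) \<Longrightarrow> f n x \<in> carrier (cobj V n)"
    and "\<And>n x. x \<in> carrier (cobj U n) \<Longrightarrow> g n x \<in> carrier (cobj V n)"
    and "chain_map R T U h" "chain_map R V W k"
  shows "chain_homotopic R T W (\<lambda>n x. k n (f n (h n x))) (\<lambda>n x. k n (g n (h n x)))"
proof -
  interpret V: module R "cobj V m" for m by (rule cx_module[OF assms(4)])
  obtain s where s: "\<And>n. s n \<in> mod_hom R (cobj U n) (cobj V (n + 1))"
    "\<And>n. s (n - 1) \<in> mod_hom R (cobj U (n - 1)) (cobj V n)"
    "\<And>n x. x \<in> carrier (cobj U n) \<Longrightarrow>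
      f n x = cdiff V (n + 1) (s n x) \<oplus>\<^bsub>cobj V n\<^esub> s (n - 1) (cdiff U n x) \<oplus>\<^bsub>cobj V n\<^esub> g n x"
    using chain_homotopicE[OF assms(1,3,4,6,7)] by blast
  note h = mod_homD[OF chain_map_hom[OF assms(8)]] and k = mod_homD[OF chain_map_hom[OF assms(9)]]
  show ?thesis
  proof (rule chain_homotopicI[OF assms(2,5), where s = "\<lambda>n x. k (n + 1) (s n (h n x))"])
    show "(\<lambda>x. k (n + 1) (s n (h n x))) \<in> mod_hom R (cobj T n) (cobj W (n + 1))" for n
      by (rule mod_hom_comp[OF chain_map_hom[OF assms(8)] mod_hom_comp[OF s(1) chain_map_hom[OF assms(9)]]])
    fix n x assume x: "x \<in> carrier (cobj T n)"
    show "k n (f n (h n x)) \<in> carrier (cobj W n)" "k n (g n (h n x)) \<in> carrier (cobj W n)"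
      using x h k assms(6,7) by auto
    have hx: "h n x \<in> carrier (cobj U n)" using h x by auto
    have c: "s n (h n x) \<in> carrier (cobj V (n + 1))" "cdiff V (n + 1) (s n (h n x)) \<in> carrier (cobj V n)"
      "s (n - 1) (cdiff U n (h n x)) \<in> carrier (cobj V n)"
      using mod_hom_closed[OF s(1)] mod_hom_closed[OF s(2)] hx
        mod_hom_closed[OF cx_diff[OF assms(3)]] mod_hom_closed[OF cx_diff_Suc[OF assms(4)]] by auto
    show "k n (f n (h n x)) = cdiff W (n + 1) (k (n + 1) (s n (h n x))) \<oplus>\<^bsub>cobj W n\<^esub>
        k (n - 1 + 1) (s (n - 1) (h (n - 1) (cdiff T n x))) \<oplus>\<^bsub>cobj W n\<^esub> k n (g n (h n x))"
      unfolding s(3)[OF hx] using c assms(7)[OF hx] k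
      by (simp add: chain_map_comm_Suc[OF assms(9)] chain_map_comm[OF assms(8) x, symmetric])
  qed
qed

lemma homotopy_equivE:
  assumes "homotopy_equiv R U V f" "is_complex R U" "is_complex R V"
  obtains g where "chain_map R U V f" "chain_map R V U g"
    "chain_homotopic R U U (\<lambda>n x. g n (f n x)) (\<lambda>n x. x)"
    "chain_homotopic R V V (\<lambda>n x. f n (g n x)) (\<lambda>n x. x)"
    "homotopy_equiv R V U g"
  using assms unfolding homotopy_equiv_def by auto

lemma homotopy_isomorphic_refl: "is_complex R U \<Longrightarrow> homotopy_isomorphic R U U"
  unfolding homotopy_isomorphic_def homotopy_equiv_def
  by (auto intro!: exI[of _ "\<lambda>n x. x"] chain_map_id chain_homotopic_cong)

lemma homotopy_equiv_id: "is_complex R U \<Longrightarrow> homotopy_equiv R U U (\<lambda>n x. x)"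
  unfolding homotopy_equiv_def
  by (auto intro!: exI[of _ "\<lambda>n x. x"] chain_map_id chain_homotopic_cong)

lemma homotopy_isomorphic_sym: "homotopy_isomorphic R U V \<Longrightarrow> homotopy_isomorphic R V U"
  unfolding homotopy_isomorphic_def homotopy_equiv_def by auto

lemma homotopy_isomorphic_trans:
  assumes "homotopy_isomorphic R U V" "homotopy_isomorphic R V W"
    and "is_complex R U" "is_complex R V" "is_complex R W"
  shows "homotopy_isomorphic R U W"
proof -
  note cx = assms(3-5)
  obtain f where "homotopy_equiv R U V f" using assms(1) unfolding homotopy_isomorphic_def by auto
  then obtain g where fg: "chain_map R U V f" "chain_map R V U g"
    "chain_homotopic R U U (\<lambda>n x. g n (f n x)) (\<lambda>n x. x)"
    "chain_homotopic R V V (\<lambda>n x. f n (g n x)) (\<lambda>n x. x)"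
    using homotopy_equivE[OF _ assms(3,4)] by blast
  obtain h where "homotopy_equiv R V W h" using assms(2) unfolding homotopy_isomorphic_def by auto
  then obtain k where hk: "chain_map R V W h" "chain_map R W V k"
    "chain_homotopic R V V (\<lambda>n x. k n (h n x)) (\<lambda>n x. x)"
    "chain_homotopic R W W (\<lambda>n x. h n (k n x)) (\<lambda>n x. x)"
    using homotopy_equivE[OF _ assms(4,5)] by blast
  note f = mod_hom_closed[OF chain_map_hom[OF fg(1)]] and g = mod_hom_closed[OF chain_map_hom[OF fg(2)]]
    and h = mod_hom_closed[OF chain_map_hom[OF hk(1)]] and k = mod_hom_closed[OF chain_map_hom[OF hk(2)]]
  have "chain_homotopic R U U (\<lambda>n x. g n (k n (h n (f n x)))) (\<lambda>n x. g n (f n x))"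
    by (rule chain_homotopic_comp[OF hk(3) cx(1,2,2,1) _ _ fg(1,2)]) (use h k in auto)
  then have 1: "chain_homotopic R U U (\<lambda>n x. g n (k n (h n (f n x)))) (\<lambda>n x. x)"
    by (rule chain_homotopic_trans[OF _ fg(3) cx(1,1)]) (use f g h k in auto)
  have "chain_homotopic R W W (\<lambda>n x. h n (f n (g n (k n x)))) (\<lambda>n x. h n (k n x))"
    by (rule chain_homotopic_comp[OF fg(4) cx(3,2,2,3) _ _ hk(2,1)]) (use f g in auto)
  then have 2: "chain_homotopic R W W (\<lambda>n x. h n (f n (g n (k n x)))) (\<lambda>n x. x)"
    by (rule chain_homotopic_trans[OF _ hk(4) cx(3,3)]) (use f g h k in auto)
  have "homotopy_equiv R U W (\<lambda>n x. h n (f n x))"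
    unfolding homotopy_equiv_def using 1 2 chain_map_comp[OF cx(1) fg(1) hk(1)] chain_map_comp[OF cx(3) hk(2) fg(2)]
    by (intro conjI exI[of _ "\<lambda>n x. g n (k n x)"])
  then show ?thesis unfolding homotopy_isomorphic_def by blast
qed

lemma homotopy_isomorphicI_iso:
  assumes "is_complex R U" "is_complex R V" "chain_map R U V f" "chain_map R V U g"
    and "\<And>n x. x \<in> carrier (cobj U n) \<Longrightarrow> g n (f n x) = x"
    and "\<And>n x. x \<in> carrier (cobj V n) \<Longrightarrow> f n (g n x) = x"
  shows "homotopy_isomorphic R U V"
  unfolding homotopy_isomorphic_def homotopy_equiv_def
  using assms by (intro exI[of _ f] conjI exI[of _ g] chain_homotopic_cong) auto


section \<open>Homology and mapping cones\<close>

definition cyc :: "('a, 'm) cplx \<Rightarrow> int \<Rightarrow> 'm set" where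
  "cyc U n = {x \<in> carrier (cobj U n). cdiff U n x = \<zero>\<^bsub>cobj U (n - 1)\<^esub>}"

definition bdry :: "('a, 'm) cplx \<Rightarrow> int \<Rightarrow> 'm set" where
  "bdry U n = cdiff U (n + 1) ` carrier (cobj U (n + 1))"

definition hfin :: "('a, 'r) ring_scheme \<Rightarrow> 'a set \<Rightarrow> ('a, 'm) cplx \<Rightarrow> int \<Rightarrow> bool" where
  "hfin R P U n = pfin R P (cobj U n) (bdry U n) (cyc U n)"

definition hlen :: "('a, 'r) ring_scheme \<Rightarrow> 'a set \<Rightarrow> ('a, 'm) cplx \<Rightarrow> int \<Rightarrow> nat" where
  "hlen R P U n = plen R P (cobj U n) (bdry U n) (cyc U n)"

lemma submodule_cyc:
  assumes "is_complex R U"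
  shows "submodule (cyc U n) R (cobj U n)"
proof -
  interpret U: module R "cobj U m" for m by (rule cx_module[OF assms])
  have "submodule {x \<in> carrier (cobj U n). cdiff U n x \<in> {\<zero>\<^bsub>cobj U (n - 1)\<^esub>}} R (cobj U n)"
    by (rule submodule_vimage[OF cx_module[OF assms] cx_module[OF assms] cx_diff[OF assms]
          U.carrier_is_submodule submodule_zero[OF cx_module[OF assms]]])
  then show ?thesis by (simp add: cyc_def)
qed

lemma submodule_bdry:
  assumes "is_complex R U"
  shows "submodule (bdry U n) R (cobj U n)"
proof -
  interpret U: module R "cobj U m" for m by (rule cx_module[OF assms])
  show ?thesis unfolding bdry_def
    by (rule submodule_image[OF cx_module[OF assms] cx_module[OF assms] cx_diff_Suc[OF assms]
          U.carrier_is_submodule])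
qed

lemma bdry_subset_cyc: "is_complex R U \<Longrightarrow> bdry U n \<subseteq> cyc U n"
  unfolding bdry_def cyc_def using cx_dd_Suc mod_hom_closed[OF cx_diff_Suc] by fastforce

lemma cyc_subset: "cyc U n \<subseteq> carrier (cobj U n)"
  unfolding cyc_def by auto

lemma chain_map_cyc:
  assumes "is_complex R U" "is_complex R V" "chain_map R U V f" "x \<in> cyc U n"
  shows "f n x \<in> cyc V n"
  using assms(4) mod_hom_closed[OF chain_map_hom[OF assms(3)]]
    mod_hom_zero[OF cx_module[OF assms(1)] cx_module[OF assms(2)] chain_map_hom[OF assms(3)]]
  unfolding cyc_def by (auto simp: chain_map_comm[OF assms(3)])

lemma chain_map_bdry:
  assumes "chain_map R U V f" "x \<in> bdry U n"
  shows "f n x \<in> bdry V n"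
proof -
  from assms(2) obtain y where y: "y \<in> carrier (cobj U (n + 1))" "x = cdiff U (n + 1) y"
    unfolding bdry_def by auto
  then have "f n x = cdiff V (n + 1) (f (n + 1) y)" by (simp add: chain_map_comm_Suc[OF assms(1)])
  then show ?thesis unfolding bdry_def using mod_hom_closed[OF chain_map_hom[OF assms(1)] y(1)] by blast
qed

text \<open>On a cycle the summand \<open>s (n - 1) (cdiff U n x)\<close> of the homotopy vanishes,
  so \<open>f\<close> moves \<open>x\<close> only by the boundary of \<open>s n x\<close>.\<close>

lemma homotopic_id_cyc:
  assumes "is_complex R U" "chain_map R U U f" "chain_homotopic R U U f (\<lambda>n x. x)" "x \<in> cyc U n"
  shows "\<exists>b\<in>bdry U n. x = f n x \<oplus>\<^bsub>cobj U n\<^esub> b"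
proof -
  interpret U: module R "cobj U m" for m by (rule cx_module[OF assms(1)])
  have x: "x \<in> carrier (cobj U n)" "cdiff U n x = \<zero>\<^bsub>cobj U (n - 1)\<^esub>" using assms(4) by (auto simp: cyc_def)
  obtain s where s: "\<And>n. s n \<in> mod_hom R (cobj U n) (cobj U (n + 1))"
    "\<And>n. s (n - 1) \<in> mod_hom R (cobj U (n - 1)) (cobj U n)"
    "\<And>n x. x \<in> carrier (cobj U n) \<Longrightarrow>
      f n x = cdiff U (n + 1) (s n x) \<oplus>\<^bsub>cobj U n\<^esub> s (n - 1) (cdiff U n x) \<oplus>\<^bsub>cobj U n\<^esub> x"
    using chain_homotopicE[OF assms(3,1,1)] mod_hom_closed[OF chain_map_hom[OF assms(2)]] by blast
  have b: "cdiff U (n + 1) (s n x) \<in> bdry U n"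
    unfolding bdry_def using mod_hom_closed[OF s(1) x(1)] by blast
  then have b': "cdiff U (n + 1) (s n x) \<in> carrier (cobj U n)"
    using subsetD[OF cyc_subset subsetD[OF bdry_subset_cyc[OF assms(1)]]] by simp
  have "f n x = cdiff U (n + 1) (s n x) \<oplus>\<^bsub>cobj U n\<^esub> x"
    using s(3)[OF x(1)] x b' mod_hom_zero[OF cx_module[OF assms(1)] cx_module[OF assms(1)] s(2)] by simp
  then have "x = f n x \<oplus>\<^bsub>cobj U n\<^esub> \<ominus>\<^bsub>cobj U n\<^esub> cdiff U (n + 1) (s n x)"
    using x b' by (simp add: U.ag_simps)
  moreover have "\<ominus>\<^bsub>cobj U n\<^esub> cdiff U (n + 1) (s n x) \<in> bdry U n"
    using U.submoduleE(3)[OF submodule_bdry[OF assms(1)] b] .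
  ultimately show ?thesis by blast
qed

text \<open>\<open>f\<close> satisfies the transfer conditions between cycles modulo boundaries: the
  homotopy on \<open>V\<close> gives surjectivity, the one on \<open>U\<close> gives
  injectivity.\<close>

lemma hlen_homotopy_isomorphic:
  assumes "homotopy_isomorphic R U V" "is_complex R U" "is_complex R V"
  shows hfin_homotopy_isomorphic: "hfin R P U n \<longleftrightarrow> hfin R P V n"
    and hlen_eq: "hlen R P U n = hlen R P V n"
proof -
  interpret U: module R "cobj U m" for m by (rule cx_module[OF assms(2)])
  interpret V: module R "cobj V m" for m by (rule cx_module[OF assms(3)])
  obtain f where "homotopy_equiv R U V f" using assms(1) unfolding homotopy_isomorphic_def by auto
  then obtain g where fg: "chain_map R U V f" "chain_map R V U g"
    "chain_homotopic R U U (\<lambda>n x. g n (f n x)) (\<lambda>n x. x)"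
    "chain_homotopic R V V (\<lambda>n x. f n (g n x)) (\<lambda>n x. x)"
    using homotopy_equivE[OF _ assms(2,3)] by blast
  have surj: "\<exists>x\<in>cyc U n. \<exists>a\<in>bdry V n. y = f n x \<oplus>\<^bsub>cobj V n\<^esub> a" if "y \<in> cyc V n" for y
    using homotopic_id_cyc[OF assms(3) chain_map_comp[OF assms(3) fg(2,1)] fg(4) that]
      chain_map_cyc[OF assms(3,2) fg(2) that] by blast
  have ker: "f n x \<in> bdry V n \<longleftrightarrow> x \<in> bdry U n" if x: "x \<in> cyc U n" for x
  proof
    assume "f n x \<in> bdry V n"
    then have "g n (f n x) \<in> bdry U n" by (rule chain_map_bdry[OF fg(2)])
    moreover obtain b where "b \<in> bdry U n" "x = g n (f n x) \<oplus>\<^bsub>cobj U n\<^esub> b"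
      using homotopic_id_cyc[OF assms(2) chain_map_comp[OF assms(2) fg(1,2)] fg(3) x] by blast
    ultimately show "x \<in> bdry U n"
      using U.submoduleE(5)[OF submodule_bdry[OF assms(2)]] by metis
  qed (rule chain_map_bdry[OF fg(1)])
  note t = plen_transfer[OF cx_module[OF assms(2)] cx_module[OF assms(3)] chain_map_hom[OF fg(1)]
      submodule_bdry[OF assms(2)] submodule_cyc[OF assms(2)] submodule_bdry[OF assms(3)] submodule_cyc[OF assms(3)]
      bdry_subset_cyc[OF assms(3)] chain_map_cyc[OF assms(2,3) fg(1)] surj ker bdry_subset_cyc[OF assms(2)]]
  show "hfin R P U n \<longleftrightarrow> hfin R P V n" "hlen R P U n = hlen R P V n"
    unfolding hfin_def hlen_def using t by auto
qed

section \<open>Mapping cones and their long exact homology sequence\<close>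

lemma dsum_mod_simps [simp]:
  "carrier (dsum_mod M N) = carrier M \<times> carrier N"
  "\<zero>\<^bsub>dsum_mod M N\<^esub> = (\<zero>\<^bsub>M\<^esub>, \<zero>\<^bsub>N\<^esub>)"
  "(x, y) \<oplus>\<^bsub>dsum_mod M N\<^esub> (x', y') = (x \<oplus>\<^bsub>M\<^esub> x', y \<oplus>\<^bsub>N\<^esub> y')"
  "r \<odot>\<^bsub>dsum_mod M N\<^esub> (x, y) = (r \<odot>\<^bsub>M\<^esub> x, r \<odot>\<^bsub>N\<^esub> y)"
  by (simp_all add: dsum_mod_def)

lemma module_dsum:
  assumes "module R M" "module R N"
  shows "module R (dsum_mod M N)"
proof -
  interpret M: module R M by fact
  interpret N: module R N by fact
  show ?thesis
  proof (rule moduleI)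
    show "abelian_group (dsum_mod M N)"
    proof (rule abelian_groupI)
      fix x assume "x \<in> carrier (dsum_mod M N)"
      then show "\<exists>y\<in>carrier (dsum_mod M N). y \<oplus>\<^bsub>dsum_mod M N\<^esub> x = \<zero>\<^bsub>dsum_mod M N\<^esub>"
        by (intro bexI[of _ "(\<ominus>\<^bsub>M\<^esub> fst x, \<ominus>\<^bsub>N\<^esub> snd x)"]) (auto simp: M.l_neg N.l_neg)
    qed (auto simp: M.a_ac N.a_ac)
  qed (auto simp: M.is_cring M.smult_l_distr N.smult_l_distr M.smult_r_distr N.smult_r_distr
      M.smult_assoc1 N.smult_assoc1)
qed

lemma mapping_cone_simps [simp]:
  "cobj (mapping_cone U V f) n = dsum_mod (cobj U (n - 1)) (cobj V n)"
  "cdiff (mapping_cone U V f) n (x, y) = (\<ominus>\<^bsub>cobj U (n - 2)\<^esub> cdiff U (n - 1) x,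
     f (n - 1) x \<oplus>\<^bsub>cobj V (n - 1)\<^esub> cdiff V n y)"
  by (simp_all add: mapping_cone_def)

lemma is_complex_cone:
  assumes "is_complex R U" "is_complex R V" "chain_map R U V f"
  shows "is_complex R (mapping_cone U V f)"
  unfolding is_complex_def
proof (intro allI conjI ballI)
  interpret U: module R "cobj U m" for m by (rule cx_module[OF assms(1)])
  interpret V: module R "cobj V m" for m by (rule cx_module[OF assms(2)])
  fix n
  let ?C = "mapping_cone U V f"
  show "module R (cobj ?C n)" by (simp add: module_dsum U.module_axioms V.module_axioms)
  have dU: "cdiff U (n - 1) \<in> mod_hom R (cobj U (n - 1)) (cobj U (n - 2))" for n
    using cx_diff[OF assms(1), of "n - 1"] by simp
  note dU = mod_homD[OF this] mod_hom_minus[OF U.module_axioms U.module_axioms this]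
  note dV = mod_homD[OF cx_diff[OF assms(2)]]
    and f = mod_homD[OF chain_map_hom[OF assms(3)]]
  show "cdiff ?C n \<in> mod_hom R (cobj ?C n) (cobj ?C (n - 1))"
    by (rule mod_homI)
      (auto simp: dU dV f U.minus_add U.smult_r_minus V.smult_r_distr V.a_ac intro!: U.a_closed V.a_closed)
  fix x assume "x \<in> carrier (cobj ?C n)"
  then obtain y z where x: "x = (y, z)" "y \<in> carrier (cobj U (n - 1))" "z \<in> carrier (cobj V n)" by auto
  have 1: "cdiff U (n - 2) (cdiff U (n - 1) y) = \<zero>\<^bsub>cobj U (n - 3)\<^esub>"
    using cx_dd[OF assms(1) x(2)] by simp
  have 2: "cdiff V (n - 1) (f (n - 1) y) = f (n - 2) (cdiff U (n - 1) y)"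
    using chain_map_comm[OF assms(3) x(2)] by simp
  have 3: "f (n - 2) (\<ominus>\<^bsub>cobj U (n - 2)\<^esub> cdiff U (n - 1) y) = \<ominus>\<^bsub>cobj V (n - 2)\<^esub> f (n - 2) (cdiff U (n - 1) y)"
    using mod_hom_minus[OF U.module_axioms V.module_axioms chain_map_hom[OF assms(3)]] dU(1)[OF x(2)] by blast
  have 4: "cdiff U (n - 2) (\<ominus>\<^bsub>cobj U (n - 2)\<^esub> cdiff U (n - 1) y) = \<ominus>\<^bsub>cobj U (n - 3)\<^esub> cdiff U (n - 2) (cdiff U (n - 1) y)"
    using mod_hom_minus[OF U.module_axioms U.module_axioms cx_diff[OF assms(1)]] dU(1)[OF x(2)] by fastforce
  have 5: "cdiff V (n - 1) (f (n - 1) y \<oplus>\<^bsub>cobj V (n - 1)\<^esub> cdiff V n z) =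
    cdiff V (n - 1) (f (n - 1) y) \<oplus>\<^bsub>cobj V (n - 2)\<^esub> cdiff V (n - 1) (cdiff V n z)"
    using dV(2)[of "f (n - 1) y" "n - 1" "cdiff V n z"] f(1)[OF x(2)] dV(1)[OF x(3)] by simp
  have 6: "f (n - 2) (cdiff U (n - 1) y) \<in> carrier (cobj V (n - 2))"
    using f(1) dU(1)[OF x(2)] by auto
  show "cdiff ?C (n - 1) (cdiff ?C n x) = \<zero>\<^bsub>cobj ?C (n - 2)\<^esub>"
    using x 6 by (simp add: 1 2 3 4 5 cx_dd[OF assms(2)] V.l_neg)
qed

lemma bdry_pred: "bdry U (n - 1) = cdiff U n ` carrier (cobj U n)"
  by (simp add: bdry_def)

lemma (in abelian_group) a_inv_zero: "\<ominus> \<zero> = \<zero>"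
  by (rule minus_equality) auto

lemma (in abelian_group) minus_eq_zero_iff: "x \<in> carrier G \<Longrightarrow> \<ominus> x = \<zero> \<longleftrightarrow> x = \<zero>"
  using minus_minus[of x] a_inv_zero by auto

lemma (in abelian_group) add_eq_zero_iff:
  "x \<in> carrier G \<Longrightarrow> y \<in> carrier G \<Longrightarrow> x \<oplus> y = \<zero> \<longleftrightarrow> x = \<ominus> y"
  by (metis minus_equality l_neg)

lemma cyc_cone:
  assumes "is_complex R U" "is_complex R V" "chain_map R U V f"
  shows "(x, y) \<in> cyc (mapping_cone U V f) n \<longleftrightarrow>
    x \<in> cyc U (n - 1) \<and> y \<in> carrier (cobj V n) \<and> f (n - 1) x = \<ominus>\<^bsub>cobj V (n - 1)\<^esub> cdiff V n y"
proof -
  interpret U: module R "cobj U m" for m by (rule cx_module[OF assms(1)])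
  interpret V: module R "cobj V m" for m by (rule cx_module[OF assms(2)])
  have "cdiff U (n - 1) x \<in> carrier (cobj U (n - 2))" if "x \<in> carrier (cobj U (n - 1))" for x
    using mod_hom_closed[OF cx_diff[OF assms(1)] that] by simp
  then show ?thesis
    using mod_hom_closed[OF chain_map_hom[OF assms(3)]] mod_hom_closed[OF cx_diff[OF assms(2)]]
    by (auto simp: cyc_def U.minus_eq_zero_iff V.add_eq_zero_iff)
qed

lemma bdry_cone:
  "bdry (mapping_cone U V f) n =
    {(\<ominus>\<^bsub>cobj U (n - 1)\<^esub> cdiff U n x, f n x \<oplus>\<^bsub>cobj V n\<^esub> cdiff V (n + 1) y) |x y.
      x \<in> carrier (cobj U n) \<and> y \<in> carrier (cobj V (n + 1))}"
  unfolding bdry_def by force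

text \<open>The long exact homology sequence of a cone, cut into short exact pieces: \<open>k n\<close> and \<open>i n\<close> are the
  lengths of kernel and image of \<open>H\<^sub>n U \<rightarrow> H\<^sub>n V\<close>, and \<open>c n\<close> is that of its cokernel.\<close>

lemma hlen_cone:
  fixes U :: "('a, 'm) cplx" and V :: "('a, 'n) cplx"
  assumes "is_complex R U" "is_complex R V" "chain_map R U V f" "primeideal P R"
    and "\<And>n. hfin R P U n" "\<And>n. hfin R P V n"
  obtains k i c where "\<And>n. hlen R P U n = k n + i n" "\<And>n. hlen R P V n = i n + c n"
    "\<And>n. hlen R P (mapping_cone U V f) n = c n + k (n - 1)"
proof -
  interpret U: module R "cobj U m" for m by (rule cx_module[OF assms(1)])
  interpret V: module R "cobj V m" for m by (rule cx_module[OF assms(2)])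
  let ?C = "mapping_cone U V f"
  have cx: "is_complex R ?C" by (rule is_complex_cone[OF assms(1-3)])
  interpret C: module R "cobj ?C m" for m by (rule cx_module[OF cx])
  note f = mod_homD[OF chain_map_hom[OF assms(3)]]
    and f0 = mod_hom_zero[OF U.module_axioms V.module_axioms chain_map_hom[OF assms(3)]]
    and fm = mod_hom_minus[OF U.module_axioms V.module_axioms chain_map_hom[OF assms(3)]]
    and dU = mod_homD[OF cx_diff[OF assms(1)]]
    and dU0 = mod_hom_zero[OF U.module_axioms U.module_axioms cx_diff[OF assms(1)]]
    and dUm = mod_hom_minus[OF U.module_axioms U.module_axioms cx_diff[OF assms(1)]]
    and dV = mod_homD[OF cx_diff[OF assms(2)]]
    and dV0 = mod_hom_zero[OF V.module_axioms V.module_axioms cx_diff[OF assms(2)]]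
    and dV0' = mod_hom_zero[OF V.module_axioms V.module_axioms cx_diff_Suc[OF assms(2)]]
    and dVm = mod_hom_minus[OF V.module_axioms V.module_axioms cx_diff[OF assms(2)]]
  \<comment> \<open>Modulo boundaries, \<open>K\<close> is the kernel of
    \<open>H\<^sub>n U \<rightarrow> H\<^sub>n V\<close> and \<open>I\<close> its image.
    \<open>J\<close> filters the cycles of the cone by whether the component in \<open>U\<close>
    bounds; the lower layer will be the cokernel in degree \<open>n\<close>, the upper one the
    kernel in degree \<open>n - 1\<close>.\<close>
  define K where "K n = {z \<in> cyc U n. f n z \<in> bdry V n}" for n
  define I where "I n = {x \<oplus>\<^bsub>cobj V n\<^esub> y |x y. x \<in> f n ` cyc U n \<and> y \<in> bdry V n}" for n
  define J where "J n = {z \<in> cyc ?C n. fst z \<in> bdry U (n - 1)}" for n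
  have K: "submodule (K n) R (cobj U n)" for n
    unfolding K_def by (rule submodule_vimage[OF U.module_axioms V.module_axioms chain_map_hom[OF assms(3)]
          submodule_cyc[OF assms(1)] submodule_bdry[OF assms(2)]])
  have I: "submodule (I n) R (cobj V n)" for n
    unfolding I_def by (rule submodule_sum[OF V.module_axioms submodule_image[OF U.module_axioms
          V.module_axioms chain_map_hom[OF assms(3)] submodule_cyc[OF assms(1)]] submodule_bdry[OF assms(2)]])
  have fst: "fst \<in> mod_hom R (cobj ?C n) (cobj U (n - 1))" for n
    by (rule mod_homI) auto
  have J: "submodule (J n) R (cobj ?C n)" for n
    unfolding J_def by (rule submodule_vimage[OF C.module_axioms U.module_axioms fst
          submodule_cyc[OF cx] submodule_bdry[OF assms(1)]])
  have BK: "bdry U n \<subseteq> K n" for n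
    unfolding K_def using bdry_subset_cyc[OF assms(1)] chain_map_bdry[OF assms(3)] by blast
  have KZ: "K n \<subseteq> cyc U n" for n unfolding K_def by blast
  have BI: "bdry V n \<subseteq> I n" for n
  proof
    fix y assume y: "y \<in> bdry V n"
    then have "y \<in> carrier (cobj V n)" using bdry_subset_cyc[OF assms(2), of n] cyc_subset[of V n] by blast
    then have "y = f n \<zero>\<^bsub>cobj U n\<^esub> \<oplus>\<^bsub>cobj V n\<^esub> y" by (simp add: f0)
    then show "y \<in> I n" unfolding I_def using y submodule_zeroD[OF submodule_cyc[OF assms(1)]] by blast
  qed
  have IZ: "I n \<subseteq> cyc V n" for n
    unfolding I_def using chain_map_cyc[OF assms(1-3)] bdry_subset_cyc[OF assms(2), of n]
      V.submoduleE(5)[OF submodule_cyc[OF assms(2)]] by blast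
  have JZ: "J n \<subseteq> cyc ?C n" for n unfolding J_def by blast
  have inU: "x \<in> carrier (cobj U n)" if "x \<in> cyc U n" for x n using that by (simp add: cyc_def)
  have inV: "x \<in> carrier (cobj V n)" if "x \<in> cyc V n" for x n using that by (simp add: cyc_def)
  have inBV: "x \<in> carrier (cobj V n)" if "x \<in> bdry V n" for x n
    using subsetD[OF bdry_subset_cyc[OF assms(2)] that] inV by blast
  have BJ: "bdry ?C n \<subseteq> J n" for n
  proof
    fix z assume z: "z \<in> bdry ?C n"
    then obtain x y where xy: "x \<in> carrier (cobj U n)" "y \<in> carrier (cobj V (n + 1))"
      "z = (\<ominus>\<^bsub>cobj U (n - 1)\<^esub> cdiff U n x, f n x \<oplus>\<^bsub>cobj V n\<^esub> cdiff V (n + 1) y)"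
      by (auto simp: bdry_cone)
    have "\<ominus>\<^bsub>cobj U (n - 1)\<^esub> cdiff U n x = cdiff U n (\<ominus>\<^bsub>cobj U n\<^esub> x)" using dUm xy(1) by simp
    then have "fst z \<in> bdry U (n - 1)" unfolding bdry_pred using xy by auto
    then show "z \<in> J n" unfolding J_def using z bdry_subset_cyc[OF cx] by blast
  qed
  note iU = pfin_plen_add[OF U.module_axioms assms(4) submodule_bdry[OF assms(1)] K submodule_cyc[OF assms(1)] BK KZ]
  note iV = pfin_plen_add[OF V.module_axioms assms(4) submodule_bdry[OF assms(2)] I submodule_cyc[OF assms(2)] BI IZ]
  note iC = pfin_plen_add[OF C.module_axioms assms(4) submodule_bdry[OF cx] J submodule_cyc[OF cx] BJ JZ]
  \<comment> \<open>First isomorphism theorem: \<open>cyc U n\<close> modulo \<open>K n\<close> and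
    \<open>I n\<close> modulo \<open>bdry V n\<close> are both the image on homology.\<close>
  have im: "plen R P (cobj U n) (K n) (cyc U n) = plen R P (cobj V n) (bdry V n) (I n)" for n
  proof (rule plen_transfer(2)[OF U.module_axioms V.module_axioms chain_map_hom[OF assms(3)]
        K submodule_cyc[OF assms(1)] submodule_bdry[OF assms(2)] I BI _ _ _ KZ])
    fix x assume x: "x \<in> cyc U n"
    have "f n x = f n x \<oplus>\<^bsub>cobj V n\<^esub> \<zero>\<^bsub>cobj V n\<^esub>" using x inU f by simp
    then show "f n x \<in> I n" unfolding I_def using x submodule_zeroD[OF submodule_bdry[OF assms(2)]] by blast
    show "f n x \<in> bdry V n \<longleftrightarrow> x \<in> K n" using x unfolding K_def by blast
  qed (auto simp: I_def)
  have co: "pfin R P (cobj V n) (I n) (cyc V n) \<longleftrightarrow> pfin R P (cobj ?C n) (bdry ?C n) (J n)"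
    "plen R P (cobj V n) (I n) (cyc V n) = plen R P (cobj ?C n) (bdry ?C n) (J n)" for n
  proof -
    have hom: "(\<lambda>y. (\<zero>\<^bsub>cobj U (n - 1)\<^esub>, y)) \<in> mod_hom R (cobj V n) (cobj ?C n)"
      by (rule mod_homI) auto
    have im: "(\<zero>\<^bsub>cobj U (n - 1)\<^esub>, y) \<in> J n" if "y \<in> cyc V n" for y
      using that submodule_zeroD[OF submodule_bdry[OF assms(1)]] submodule_zeroD[OF submodule_cyc[OF assms(1)]]
      unfolding J_def by (auto simp: cyc_cone[OF assms(1-3)] f0) (auto simp: cyc_def V.a_inv_zero)
    have surj: "\<exists>y\<in>cyc V n. \<exists>b\<in>bdry ?C n. z = (\<zero>\<^bsub>cobj U (n - 1)\<^esub>, y) \<oplus>\<^bsub>cobj ?C n\<^esub> b" if z: "z \<in> J n" for z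
    proof -
      from z obtain x y where xy: "z = (x, y)" "y \<in> carrier (cobj V n)" "x \<in> cyc U (n - 1)"
        "f (n - 1) x = \<ominus>\<^bsub>cobj V (n - 1)\<^esub> cdiff V n y" "x \<in> bdry U (n - 1)"
        unfolding J_def by (cases z) (auto simp: cyc_cone[OF assms(1-3)])
      \<comment> \<open>In the cone, \<open>(- w, 0)\<close> has boundary
        \<open>(x, - f n w)\<close>. Removing it from \<open>z\<close> leaves
        \<open>(0, y + f n w)\<close>, which comes from \<open>V\<close>.\<close>
      from xy(5) obtain w where w: "w \<in> carrier (cobj U n)" "x = cdiff U n w" unfolding bdry_pred by auto
      have "cdiff V n (y \<oplus>\<^bsub>cobj V n\<^esub> f n w) = cdiff V n y \<oplus>\<^bsub>cobj V (n - 1)\<^esub> f (n - 1) x"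
        using xy(2) w f(1) by (simp add: dV chain_map_comm[OF assms(3)])
      also have "\<dots> = \<zero>\<^bsub>cobj V (n - 1)\<^esub>" unfolding xy(4) using dV(1)[OF xy(2)] by (simp add: V.r_neg)
      finally have 1: "y \<oplus>\<^bsub>cobj V n\<^esub> f n w \<in> cyc V n" using xy(2) w f(1) by (simp add: cyc_def)
      have "(x, \<ominus>\<^bsub>cobj V n\<^esub> f n w) =
        (\<ominus>\<^bsub>cobj U (n - 1)\<^esub> cdiff U n (\<ominus>\<^bsub>cobj U n\<^esub> w), f n (\<ominus>\<^bsub>cobj U n\<^esub> w) \<oplus>\<^bsub>cobj V n\<^esub> cdiff V (n + 1) \<zero>\<^bsub>cobj V (n + 1)\<^esub>)"
        using w f(1) dU(1) by (simp add: dUm fm dV0')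
      then have 2: "(x, \<ominus>\<^bsub>cobj V n\<^esub> f n w) \<in> bdry ?C n"
        unfolding bdry_cone using w by blast
      have "z = (\<zero>\<^bsub>cobj U (n - 1)\<^esub>, y \<oplus>\<^bsub>cobj V n\<^esub> f n w) \<oplus>\<^bsub>cobj ?C n\<^esub> (x, \<ominus>\<^bsub>cobj V n\<^esub> f n w)"
        unfolding xy(1) using xy(2) w f(1) dU(1) by (simp add: V.ag_simps)
      then show ?thesis using 1 2 by blast
    qed
    have ker: "(\<zero>\<^bsub>cobj U (n - 1)\<^esub>, y) \<in> bdry ?C n \<longleftrightarrow> y \<in> I n" if "y \<in> cyc V n" for y
    proof
      assume "(\<zero>\<^bsub>cobj U (n - 1)\<^esub>, y) \<in> bdry ?C n"
      then obtain x w where xw: "x \<in> carrier (cobj U n)" "w \<in> carrier (cobj V (n + 1))"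
        "\<ominus>\<^bsub>cobj U (n - 1)\<^esub> cdiff U n x = \<zero>\<^bsub>cobj U (n - 1)\<^esub>" "y = f n x \<oplus>\<^bsub>cobj V n\<^esub> cdiff V (n + 1) w"
        unfolding bdry_cone by auto
      then have "x \<in> cyc U n" unfolding cyc_def using dU(1) U.minus_eq_zero_iff by auto
      then show "y \<in> I n" unfolding I_def bdry_def using xw by blast
    next
      assume "y \<in> I n"
      then obtain x w where xw: "x \<in> cyc U n" "w \<in> carrier (cobj V (n + 1))"
        "y = f n x \<oplus>\<^bsub>cobj V n\<^esub> cdiff V (n + 1) w"
        unfolding I_def bdry_def by auto
      then have "\<ominus>\<^bsub>cobj U (n - 1)\<^esub> cdiff U n x = \<zero>\<^bsub>cobj U (n - 1)\<^esub>" "x \<in> carrier (cobj U n)"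
        by (auto simp: cyc_def)
      then show "(\<zero>\<^bsub>cobj U (n - 1)\<^esub>, y) \<in> bdry ?C n" unfolding bdry_cone using xw by force
    qed
    note t = plen_transfer[OF V.module_axioms C.module_axioms hom I submodule_cyc[OF assms(2)]
        submodule_bdry[OF cx] J BJ im surj ker IZ]
    show "pfin R P (cobj V n) (I n) (cyc V n) \<longleftrightarrow> pfin R P (cobj ?C n) (bdry ?C n) (J n)"
      "plen R P (cobj V n) (I n) (cyc V n) = plen R P (cobj ?C n) (bdry ?C n) (J n)"
      using t by auto
  qed
  have ke: "pfin R P (cobj ?C n) (J n) (cyc ?C n) \<longleftrightarrow> pfin R P (cobj U (n - 1)) (bdry U (n - 1)) (K (n - 1))"
    "plen R P (cobj ?C n) (J n) (cyc ?C n) = plen R P (cobj U (n - 1)) (bdry U (n - 1)) (K (n - 1))" for n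
  proof -
    have im: "fst z \<in> K (n - 1)" if z: "z \<in> cyc ?C n" for z
    proof -
      from z obtain x y where xy: "z = (x, y)" "y \<in> carrier (cobj V n)" "x \<in> cyc U (n - 1)"
        "f (n - 1) x = \<ominus>\<^bsub>cobj V (n - 1)\<^esub> cdiff V n y"
        by (cases z) (auto simp: cyc_cone[OF assms(1-3)])
      then have "f (n - 1) x = cdiff V n (\<ominus>\<^bsub>cobj V n\<^esub> y)" by (simp add: dVm)
      then show ?thesis using xy unfolding K_def bdry_pred by auto
    qed
    have surj: "\<exists>z\<in>cyc ?C n. \<exists>b\<in>bdry U (n - 1). x = fst z \<oplus>\<^bsub>cobj U (n - 1)\<^esub> b" if x: "x \<in> K (n - 1)" for x
    proof -
      from x obtain y where y: "y \<in> carrier (cobj V n)" "f (n - 1) x = cdiff V n y" and xc: "x \<in> cyc U (n - 1)"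
        unfolding K_def bdry_pred by auto
      then have "(x, \<ominus>\<^bsub>cobj V n\<^esub> y) \<in> cyc ?C n" using dV(1) by (simp add: cyc_cone[OF assms(1-3)] dVm)
      then show ?thesis using submodule_zeroD[OF submodule_bdry[OF assms(1)], of "n - 1"] inU[OF xc]
        by (intro bexI[of _ "(x, \<ominus>\<^bsub>cobj V n\<^esub> y)"] bexI[of _ "\<zero>\<^bsub>cobj U (n - 1)\<^esub>"]) auto
    qed
    have ker: "fst z \<in> bdry U (n - 1) \<longleftrightarrow> z \<in> J n" if "z \<in> cyc ?C n" for z
      using that unfolding J_def by blast
    note t = plen_transfer[OF C.module_axioms U.module_axioms fst J submodule_cyc[OF cx]
        submodule_bdry[OF assms(1)] K BK im surj ker JZ]
    show "pfin R P (cobj ?C n) (J n) (cyc ?C n) \<longleftrightarrow> pfin R P (cobj U (n - 1)) (bdry U (n - 1)) (K (n - 1))"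
      "plen R P (cobj ?C n) (J n) (cyc ?C n) = plen R P (cobj U (n - 1)) (bdry U (n - 1)) (K (n - 1))"
      using t by auto
  qed
  have finC: "hfin R P ?C n" for n
    using assms(5,6) iU(1) iV(1) iC(1) co(1) ke(1) unfolding hfin_def by blast
  show ?thesis
  proof (rule that)
    show "hlen R P U n = plen R P (cobj U n) (bdry U n) (K n) + plen R P (cobj U n) (K n) (cyc U n)" for n
      unfolding hlen_def using iU(2) assms(5) unfolding hfin_def by blast
    show "hlen R P V n = plen R P (cobj U n) (K n) (cyc U n) + plen R P (cobj V n) (I n) (cyc V n)" for n
      unfolding hlen_def im using iV(2) assms(6) unfolding hfin_def by blast
    show "hlen R P ?C n = plen R P (cobj V n) (I n) (cyc V n)
      + plen R P (cobj U (n - 1)) (bdry U (n - 1)) (K (n - 1))" for n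
      unfolding hlen_def using iC(2) finC ke(2) co(2) unfolding hfin_def by simp
  qed
qed

section \<open>Euler characteristics at a prime\<close>

definition euler :: "('a, 'r) ring_scheme \<Rightarrow> 'a set \<Rightarrow> ('a, 'm) cplx \<Rightarrow> int" where
  "euler R P U = (\<Sum>n | hlen R P U n \<noteq> 0. (if even n then 1 else -1) * int (hlen R P U n))"

definition hbounded :: "('a, 'r) ring_scheme \<Rightarrow> 'a set \<Rightarrow> ('a, 'm) cplx \<Rightarrow> int \<Rightarrow> bool" where
  "hbounded R P U N \<longleftrightarrow> (\<forall>n. N < \<bar>n\<bar> \<longrightarrow> hlen R P U n = 0)"

text \<open>\<open>euler\<close> sums over the degrees of nonzero length, a set that need not be
  finite in general; under \<open>hbounded\<close> it becomes a sum over an interval, which can be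
  reindexed and compared.\<close>

lemma euler_eq_sum:
  assumes "hbounded R P U N"
  shows "euler R P U = (\<Sum>n\<in>{-N..N}. (if even n then 1 else -1) * int (hlen R P U n))"
proof -
  have "{n. hlen R P U n \<noteq> 0} \<subseteq> {-N..N}"
  proof
    fix n assume "n \<in> {n. hlen R P U n \<noteq> 0}"
    then have "\<not> N < \<bar>n\<bar>" using assms unfolding hbounded_def by auto
    then show "n \<in> {-N..N}" by auto
  qed
  then show ?thesis unfolding euler_def by (intro sum.mono_neutral_left) auto
qed

text \<open>In the alternating sums the image lengths of \<open>U\<close> and \<open>V\<close>
  cancel, and the shifted kernel lengths \<open>k (n - 1)\<close> contribute with the sign opposite
  to that of \<open>k n\<close>.\<close>

lemma euler_cone:
  assumes "is_complex R U" "is_complex R V" "chain_map R U V f" "primeideal P R"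
    and "\<And>n. hfin R P U n" "\<And>n. hfin R P V n" "hbounded R P U N" "hbounded R P V N'"
  shows "euler R P (mapping_cone U V f) = euler R P V - euler R P U"
proof -
  obtain k i c where h: "\<And>n. hlen R P U n = k n + i n" "\<And>n. hlen R P V n = i n + c n"
    "\<And>n. hlen R P (mapping_cone U V f) n = c n + k (n - 1)"
    using hlen_cone[OF assms(1-6)] by metis
  \<comment> \<open>One more than both bounds, because the term \<open>k (n - 1)\<close> of the cone
    reaches one degree further.\<close>
  define M where "M = max \<bar>N\<bar> \<bar>N'\<bar> + 1"
  let ?e = "\<lambda>n::int. (if even n then 1 else -1) :: int"
  have MU: "k n = 0" "i n = 0" if "M - 1 < \<bar>n\<bar>" for n
  proof -
    have "N < \<bar>n\<bar>" using that by (auto simp: M_def)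
    then show "k n = 0" "i n = 0" using assms(7) h(1)[of n] unfolding hbounded_def by auto
  qed
  have MV: "c n = 0" if "M - 1 < \<bar>n\<bar>" for n
  proof -
    have "N' < \<bar>n\<bar>" using that by (auto simp: M_def)
    then show "c n = 0" using assms(8) h(2)[of n] unfolding hbounded_def by auto
  qed
  have bC: "hbounded R P (mapping_cone U V f) M" unfolding hbounded_def
    using MU MV by (auto simp: h)
  have bU: "hbounded R P U M" "hbounded R P V M" unfolding hbounded_def
    using MU MV by (auto simp: h)
  have "(\<Sum>n\<in>{-M..M}. ?e n * int (k (n - 1))) = (\<Sum>n\<in>{-M - 1..M - 1}. ?e (n + 1) * int (k n))"
    by (rule sum.reindex_bij_witness[of _ "\<lambda>n. n + 1" "\<lambda>n. n - 1"]) auto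
  also have "\<dots> = (\<Sum>n\<in>{-M - 1..M}. ?e (n + 1) * int (k n))"
    by (rule sum.mono_neutral_left) (auto intro!: MU)
  also have "\<dots> = (\<Sum>n\<in>{-M..M}. ?e (n + 1) * int (k n))"
    by (rule sum.mono_neutral_right) (auto intro!: MU)
  also have "\<dots> = - (\<Sum>n\<in>{-M..M}. ?e n * int (k n))"
    unfolding sum_negf[symmetric] by (rule sum.cong) auto
  finally have 1: "(\<Sum>n\<in>{-M..M}. ?e n * int (k (n - 1))) = - (\<Sum>n\<in>{-M..M}. ?e n * int (k n))" .
  show ?thesis
    unfolding euler_eq_sum[OF bC] euler_eq_sum[OF bU(1)] euler_eq_sum[OF bU(2)]
    using 1 by (simp add: h distrib_left sum.distrib)
qed

lemma euler_homotopy_isomorphic: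
  assumes "homotopy_isomorphic R U V" "is_complex R U" "is_complex R V"
  shows "euler R P U = euler R P V" "hbounded R P U N \<longleftrightarrow> hbounded R P V N"
  unfolding euler_def hbounded_def hlen_eq[OF assms] by auto

lemma hlen_zero_object:
  assumes "is_complex R U" "primeideal P R" "carrier (cobj U n) = {\<zero>\<^bsub>cobj U n\<^esub>}"
  shows "hfin R P U n" "hlen R P U n = 0"
proof -
  have "cyc U n = {\<zero>\<^bsub>cobj U n\<^esub>}" "bdry U n = {\<zero>\<^bsub>cobj U n\<^esub>}"
    using submodule_zeroD[OF submodule_cyc[OF assms(1)], of n] submodule_zeroD[OF submodule_bdry[OF assms(1)], of n]
      cyc_subset[of U n] bdry_subset_cyc[OF assms(1), of n] assms(3) by auto
  then show "hfin R P U n" "hlen R P U n = 0"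
    unfolding hfin_def hlen_def using plen_refl[OF submodule_zero[OF cx_module[OF assms(1)]] assms(2)] by auto
qed

lemma hbounded_perfect:
  assumes "perfect_cplx R U" "primeideal P R"
  shows "\<exists>N. hbounded R P U N"
  using assms hlen_zero_object(2) unfolding perfect_cplx_def hbounded_def by metis

section \<open>Residue fields\<close>

context domain
begin

lemma frac_rel_iff:
  "((a, b), (c, d)) \<in> frac_rel R \<longleftrightarrow> a \<in> carrier R \<and> b \<in> carrier R - {\<zero>} \<and> c \<in> carrier R \<and>
     d \<in> carrier R - {\<zero>} \<and> a \<otimes> d = c \<otimes> b"
  unfolding frac_rel_def by auto

lemma equiv_frac_rel: "equiv (carrier R \<times> (carrier R - {\<zero>})) (frac_rel R)"
proof (rule equivI)
  show "frac_rel R \<subseteq> (carrier R \<times> (carrier R - {\<zero>})) \<times> (carrier R \<times> (carrier R - {\<zero>}))"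
    unfolding frac_rel_def by auto
  show "refl_on (carrier R \<times> (carrier R - {\<zero>})) (frac_rel R)"
    by (rule refl_onI) (auto simp: frac_rel_iff)
  show "sym (frac_rel R)" by (rule symI) (auto simp: frac_rel_iff)
  show "trans (frac_rel R)"
  proof (rule transI)
    fix x y z assume xy: "(x, y) \<in> frac_rel R" "(y, z) \<in> frac_rel R"
    obtain a b where x: "x = (a, b)" by (cases x)
    obtain c d where y: "y = (c, d)" by (cases y)
    obtain e f where z: "z = (e, f)" by (cases z)
    have 1: "a \<in> carrier R" "b \<in> carrier R" "b \<noteq> \<zero>" "c \<in> carrier R" "d \<in> carrier R" "d \<noteq> \<zero>"
      "e \<in> carrier R" "f \<in> carrier R" "f \<noteq> \<zero>" "a \<otimes> d = c \<otimes> b" "c \<otimes> f = e \<otimes> d"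
      using xy unfolding x y z frac_rel_iff by auto
    have "d \<otimes> (a \<otimes> f) = (a \<otimes> d) \<otimes> f" using 1(1-9) by (simp add: m_ac)
    also have "\<dots> = (c \<otimes> f) \<otimes> b" unfolding 1(10) using 1(1-9) by (simp add: m_ac)
    also have "\<dots> = d \<otimes> (e \<otimes> b)" unfolding 1(11) using 1(1-9) by (simp add: m_ac)
    finally have "a \<otimes> f = e \<otimes> b" using 1(1-9) m_lcancel by auto
    then show "(x, z) \<in> frac_rel R" unfolding x z frac_rel_iff using 1 by auto
  qed
qed

lemma mk_frac_eq_iff:
  assumes "a \<in> carrier R" "b \<in> carrier R - {\<zero>}" "c \<in> carrier R" "d \<in> carrier R - {\<zero>}"
  shows "mk_frac R a b = mk_frac R c d \<longleftrightarrow> a \<otimes> d = c \<otimes> b"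
  unfolding mk_frac_def using eq_equiv_class_iff[OF equiv_frac_rel, of "(a, b)" "(c, d)"] assms
  by (auto simp: frac_rel_iff)

lemma mk_frac_self: "a \<in> carrier R \<Longrightarrow> b \<in> carrier R - {\<zero>} \<Longrightarrow> (a, b) \<in> mk_frac R a b"
  unfolding mk_frac_def by (auto simp: frac_rel_iff)

lemma mk_frac_memD:
  assumes "(c, d) \<in> mk_frac R a b"
  shows "c \<in> carrier R" "d \<in> carrier R" "d \<noteq> \<zero>" "a \<otimes> d = c \<otimes> b"
  using assms unfolding mk_frac_def by (auto simp: frac_rel_iff)

lemma mk_frac_closed: "a \<in> carrier R \<Longrightarrow> b \<in> carrier R - {\<zero>} \<Longrightarrow> mk_frac R a b \<in> carrier (fraction_field R)"
  unfolding fraction_field_def mk_frac_def by (auto intro!: quotientI)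

lemma fraction_fieldE:
  assumes "x \<in> carrier (fraction_field R)"
  obtains a b where "a \<in> carrier R" "b \<in> carrier R" "b \<noteq> \<zero>" "x = mk_frac R a b"
  using assms unfolding fraction_field_def mk_frac_def by (auto elim!: quotientE)

text \<open>The product in \<open>fraction_field\<close> is a union over all pairs of
  representatives. By \<open>eq\<close> the united classes all coincide, so the union is any one of
  them.\<close>

lemma mk_frac_mult:
  assumes "a \<in> carrier R" "b \<in> carrier R" "b \<noteq> \<zero>" "c \<in> carrier R" "d \<in> carrier R" "d \<noteq> \<zero>"
  shows "mk_frac R a b \<otimes>\<^bsub>fraction_field R\<^esub> mk_frac R c d = mk_frac R (a \<otimes> c) (b \<otimes> d)"
proof -
  have eq: "mk_frac R (a' \<otimes> c') (b' \<otimes> d') = mk_frac R (a \<otimes> c) (b \<otimes> d)"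
    if "(a', b') \<in> mk_frac R a b" "(c', d') \<in> mk_frac R c d" for a' b' c' d'
  proof -
    note 1 = mk_frac_memD[OF that(1)] and 2 = mk_frac_memD[OF that(2)]
    have "(a' \<otimes> c') \<otimes> (b \<otimes> d) = (a' \<otimes> b) \<otimes> (c' \<otimes> d)" using 1(1-3) 2(1-3) assms by (simp add: m_ac)
    also have "\<dots> = (a \<otimes> c) \<otimes> (b' \<otimes> d')"
      unfolding 1(4)[symmetric] 2(4)[symmetric] using 1(1-3) 2(1-3) assms by (simp add: m_ac)
    finally show ?thesis using 1(1-3) 2(1-3) assms by (subst mk_frac_eq_iff) (auto simp: integral_iff)
  qed
  have ne: "(a, b) \<in> mk_frac R a b" "(c, d) \<in> mk_frac R c d" using assms by (auto intro: mk_frac_self)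
  have "(\<Union>(c', d')\<in>mk_frac R c d. mk_frac R (a' \<otimes> c') (b' \<otimes> d')) = mk_frac R (a \<otimes> c) (b \<otimes> d)"
    if "(a', b') \<in> mk_frac R a b" for a' b'
    by (rule UN_constant_eq[OF ne(2)]) (use eq[OF that] in auto)
  then have "(\<Union>(a', b')\<in>mk_frac R a b. \<Union>(c', d')\<in>mk_frac R c d. mk_frac R (a' \<otimes> c') (b' \<otimes> d'))
      = mk_frac R (a \<otimes> c) (b \<otimes> d)"
    by (intro UN_constant_eq[OF ne(1)]) auto
  then show ?thesis by (simp add: fraction_field_def)
qed

lemma mk_frac_add:
  assumes "a \<in> carrier R" "b \<in> carrier R" "b \<noteq> \<zero>" "c \<in> carrier R" "d \<in> carrier R" "d \<noteq> \<zero>"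
  shows "mk_frac R a b \<oplus>\<^bsub>fraction_field R\<^esub> mk_frac R c d = mk_frac R (a \<otimes> d \<oplus> c \<otimes> b) (b \<otimes> d)"
proof -
  have eq: "mk_frac R (a' \<otimes> d' \<oplus> c' \<otimes> b') (b' \<otimes> d') = mk_frac R (a \<otimes> d \<oplus> c \<otimes> b) (b \<otimes> d)"
    if "(a', b') \<in> mk_frac R a b" "(c', d') \<in> mk_frac R c d" for a' b' c' d'
  proof -
    note 1 = mk_frac_memD[OF that(1)] and 2 = mk_frac_memD[OF that(2)]
    have "(a' \<otimes> d' \<oplus> c' \<otimes> b') \<otimes> (b \<otimes> d) = (a' \<otimes> b) \<otimes> (d \<otimes> d') \<oplus> (c' \<otimes> d) \<otimes> (b \<otimes> b')"
      using 1(1-3) 2(1-3) assms by (simp add: m_ac a_ac l_distr r_distr)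
    also have "\<dots> = (a \<otimes> d \<oplus> c \<otimes> b) \<otimes> (b' \<otimes> d')"
      unfolding 1(4)[symmetric] 2(4)[symmetric] using 1(1-3) 2(1-3) assms by (simp add: m_ac a_ac l_distr r_distr)
    finally show ?thesis using 1(1-3) 2(1-3) assms by (subst mk_frac_eq_iff) (auto simp: integral_iff)
  qed
  have ne: "(a, b) \<in> mk_frac R a b" "(c, d) \<in> mk_frac R c d" using assms by (auto intro: mk_frac_self)
  have "(\<Union>(c', d')\<in>mk_frac R c d. mk_frac R (a' \<otimes> d' \<oplus> c' \<otimes> b') (b' \<otimes> d')) = mk_frac R (a \<otimes> d \<oplus> c \<otimes> b) (b \<otimes> d)"
    if "(a', b') \<in> mk_frac R a b" for a' b'
    by (rule UN_constant_eq[OF ne(2)]) (use eq[OF that] in auto)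
  then have "(\<Union>(a', b')\<in>mk_frac R a b. \<Union>(c', d')\<in>mk_frac R c d. mk_frac R (a' \<otimes> d' \<oplus> c' \<otimes> b') (b' \<otimes> d'))
      = mk_frac R (a \<otimes> d \<oplus> c \<otimes> b) (b \<otimes> d)"
    by (intro UN_constant_eq[OF ne(1)]) auto
  then show ?thesis by (simp add: fraction_field_def)
qed

lemma fraction_field_zero: "\<zero>\<^bsub>fraction_field R\<^esub> = mk_frac R \<zero> \<one>"
  by (simp add: fraction_field_def)

lemma abelian_group_fraction_field: "abelian_group (fraction_field R)"
proof (rule abelian_groupI)
  let ?K = "fraction_field R"
  show "\<zero>\<^bsub>?K\<^esub> \<in> carrier ?K" unfolding fraction_field_zero by (intro mk_frac_closed) auto
  fix x assume "x \<in> carrier ?K"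
  then obtain a b where x: "a \<in> carrier R" "b \<in> carrier R" "b \<noteq> \<zero>" "x = mk_frac R a b"
    by (rule fraction_fieldE)
  show "\<zero>\<^bsub>?K\<^esub> \<oplus>\<^bsub>?K\<^esub> x = x" unfolding fraction_field_zero x(4) using x by (simp add: mk_frac_add)
  have "mk_frac R (\<ominus> a) b \<oplus>\<^bsub>?K\<^esub> x = \<zero>\<^bsub>?K\<^esub>"
    unfolding fraction_field_zero x(4) using x
    by (simp add: mk_frac_add mk_frac_eq_iff integral_iff l_minus l_neg)
  then show "\<exists>y\<in>carrier ?K. y \<oplus>\<^bsub>?K\<^esub> x = \<zero>\<^bsub>?K\<^esub>" using x mk_frac_closed[of "\<ominus> a" b] by auto
  fix y assume "y \<in> carrier ?K"
  then obtain c d where y: "c \<in> carrier R" "d \<in> carrier R" "d \<noteq> \<zero>" "y = mk_frac R c d"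
    by (rule fraction_fieldE)
  show "x \<oplus>\<^bsub>?K\<^esub> y \<in> carrier ?K"
    unfolding x(4) y(4) using x y by (simp add: mk_frac_add mk_frac_closed integral_iff)
  show "x \<oplus>\<^bsub>?K\<^esub> y = y \<oplus>\<^bsub>?K\<^esub> x"
    unfolding x(4) y(4) using x y by (simp add: mk_frac_add a_ac m_ac)
  fix z assume "z \<in> carrier ?K"
  then obtain e f where z: "e \<in> carrier R" "f \<in> carrier R" "f \<noteq> \<zero>" "z = mk_frac R e f"
    by (rule fraction_fieldE)
  show "x \<oplus>\<^bsub>?K\<^esub> y \<oplus>\<^bsub>?K\<^esub> z = x \<oplus>\<^bsub>?K\<^esub> (y \<oplus>\<^bsub>?K\<^esub> z)"
    unfolding x(4) y(4) z(4) using x(1-3) y(1-3) z(1-3)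
    by (simp add: mk_frac_add integral_iff a_ac m_ac l_distr r_distr)
qed

end

lemma residue_field_mod_simps:
  "carrier (residue_field_mod R P) = carrier (fraction_field (R Quot P))"
  "ring.add (residue_field_mod R P) = ring.add (fraction_field (R Quot P))"
  "ring.zero (residue_field_mod R P) = ring.zero (fraction_field (R Quot P))"
  "smult (residue_field_mod R P) =
     (\<lambda>r x. mk_frac (R Quot P) (P +>\<^bsub>R\<^esub> r) \<one>\<^bsub>R Quot P\<^esub> \<otimes>\<^bsub>fraction_field (R Quot P)\<^esub> x)"
  by (simp_all add: residue_field_mod_def Let_def)

text \<open>What the computation of supports uses about \<open>K(P)\<close>: it is a nonzero module,
  \<open>P\<close> kills it, and every element outside \<open>P\<close> acts bijectively.\<close>

lemma residue_field_mod:
  fixes R (structure)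
  assumes "cring R" "primeideal P R"
  shows module_residue_field: "module R (residue_field_mod R P)"
    and residue_field_nonzero: "\<exists>y\<in>carrier (residue_field_mod R P). y \<noteq> \<zero>\<^bsub>residue_field_mod R P\<^esub>"
    and residue_field_kill: "\<And>r y. r \<in> P \<Longrightarrow> y \<in> carrier (residue_field_mod R P) \<Longrightarrow>
      r \<odot>\<^bsub>residue_field_mod R P\<^esub> y = \<zero>\<^bsub>residue_field_mod R P\<^esub>"
    and residue_field_inj: "\<And>r y. r \<in> carrier R - P \<Longrightarrow> y \<in> carrier (residue_field_mod R P) \<Longrightarrow>
      r \<odot>\<^bsub>residue_field_mod R P\<^esub> y = \<zero>\<^bsub>residue_field_mod R P\<^esub> \<Longrightarrow> y = \<zero>\<^bsub>residue_field_mod R P\<^esub>"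
    and residue_field_surj: "\<And>r y. r \<in> carrier R - P \<Longrightarrow> y \<in> carrier (residue_field_mod R P) \<Longrightarrow>
      \<exists>z\<in>carrier (residue_field_mod R P). y = r \<odot>\<^bsub>residue_field_mod R P\<^esub> z"
proof -
  interpret cring R by fact
  interpret P: primeideal P R by fact
  define D where "D = R Quot P"
  interpret D: domain D unfolding D_def by (rule P.quotient_is_domain)
  define q where "q r = P +> r" for r
  have hom: "q \<in> ring_hom R D" unfolding q_def D_def using P.rcos_ring_hom by (simp add: eta_contract_eq)
  note q = ring_hom_closed[OF hom] ring_hom_mult[OF hom] ring_hom_add[OF hom] ring_hom_one[OF hom]
  define N where "N = residue_field_mod R P"
  let ?K = "fraction_field D"
  have N [simp]: "carrier N = carrier ?K" "ring.add N = ring.add ?K" "ring.zero N = ring.zero ?K"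
    unfolding N_def D_def by (simp_all add: residue_field_mod_simps)
  have sm: "r \<odot>\<^bsub>N\<^esub> mk_frac D a b = mk_frac D (q r \<otimes>\<^bsub>D\<^esub> a) b"
    if "r \<in> carrier R" "a \<in> carrier D" "b \<in> carrier D" "b \<noteq> \<zero>\<^bsub>D\<^esub>" for r a b
  proof -
    have "r \<odot>\<^bsub>N\<^esub> mk_frac D a b = mk_frac D (q r) \<one>\<^bsub>D\<^esub> \<otimes>\<^bsub>?K\<^esub> mk_frac D a b"
      unfolding N_def D_def q_def by (simp add: residue_field_mod_simps)
    then show ?thesis using that q(1) by (simp add: D.mk_frac_mult)
  qed
  interpret K: abelian_group ?K by (rule D.abelian_group_fraction_field)
  show "module R (residue_field_mod R P)" unfolding N_def[symmetric]
  proof (rule moduleI)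
    show "cring R" by (rule is_cring)
    show "abelian_group N"
      by (rule abelian_groupI) (auto simp: K.a_ac intro: bexI[of _ "\<ominus>\<^bsub>?K\<^esub> _"] K.l_neg)
    fix x assume "x \<in> carrier N"
    then obtain a b where x: "a \<in> carrier D" "b \<in> carrier D" "b \<noteq> \<zero>\<^bsub>D\<^esub>" "x = mk_frac D a b"
      using D.fraction_fieldE by (metis N(1))
    show "\<one> \<odot>\<^bsub>N\<^esub> x = x" unfolding x(4) using x(1-3) by (simp add: sm q)
    fix r assume r: "r \<in> carrier R"
    show "r \<odot>\<^bsub>N\<^esub> x \<in> carrier N" unfolding x(4) using x(1-3) r q(1) by (simp add: sm D.mk_frac_closed)
    fix s assume s: "s \<in> carrier R"
    show "(r \<otimes> s) \<odot>\<^bsub>N\<^esub> x = r \<odot>\<^bsub>N\<^esub> (s \<odot>\<^bsub>N\<^esub> x)" unfolding x(4) using x(1-3) r s q(1) by (simp add: sm q(2) D.m_ac)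
    show "(r \<oplus> s) \<odot>\<^bsub>N\<^esub> x = r \<odot>\<^bsub>N\<^esub> x \<oplus>\<^bsub>N\<^esub> s \<odot>\<^bsub>N\<^esub> x" unfolding x(4) using x(1-3) r s q(1)
      by (simp add: sm q(3) D.mk_frac_add D.mk_frac_eq_iff D.integral_iff D.l_distr D.r_distr D.m_ac)
  next
    fix r x y assume r: "r \<in> carrier R" and "x \<in> carrier N" "y \<in> carrier N"
    then obtain a b where x: "a \<in> carrier D" "b \<in> carrier D" "b \<noteq> \<zero>\<^bsub>D\<^esub>" "x = mk_frac D a b"
      using D.fraction_fieldE by (metis N(1))
    obtain c d where y: "c \<in> carrier D" "d \<in> carrier D" "d \<noteq> \<zero>\<^bsub>D\<^esub>" "y = mk_frac D c d"
      using \<open>y \<in> carrier N\<close> D.fraction_fieldE by (metis N(1))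
    show "r \<odot>\<^bsub>N\<^esub> (x \<oplus>\<^bsub>N\<^esub> y) = r \<odot>\<^bsub>N\<^esub> x \<oplus>\<^bsub>N\<^esub> r \<odot>\<^bsub>N\<^esub> y" unfolding x(4) y(4) using x(1-3) y(1-3) r q(1)
      by (simp add: sm D.mk_frac_add D.integral_iff D.l_distr D.r_distr D.m_ac)
  qed
  have z: "mk_frac D a b = \<zero>\<^bsub>N\<^esub> \<longleftrightarrow> a = \<zero>\<^bsub>D\<^esub>" if "a \<in> carrier D" "b \<in> carrier D" "b \<noteq> \<zero>\<^bsub>D\<^esub>" for a b
    using that by (simp add: D.fraction_field_zero D.mk_frac_eq_iff)
  have qz: "q r = \<zero>\<^bsub>D\<^esub> \<longleftrightarrow> r \<in> P" if "r \<in> carrier R" for r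
    using that P.a_rcos_const P.rcos_const_imp_mem unfolding q_def D_def FactRing_def by auto
  show "\<exists>y\<in>carrier (residue_field_mod R P). y \<noteq> \<zero>\<^bsub>residue_field_mod R P\<^esub>" unfolding N_def[symmetric]
    by (rule bexI[of _ "mk_frac D \<one>\<^bsub>D\<^esub> \<one>\<^bsub>D\<^esub>"]) (simp_all add: z[simplified] D.mk_frac_closed)
  fix r y assume y: "y \<in> carrier (residue_field_mod R P)"
  then obtain a b where x: "a \<in> carrier D" "b \<in> carrier D" "b \<noteq> \<zero>\<^bsub>D\<^esub>" "y = mk_frac D a b"
    using D.fraction_fieldE unfolding N_def[symmetric] by (metis N(1))
  {
    assume r: "r \<in> P"
    then have "q r = \<zero>\<^bsub>D\<^esub>" "r \<in> carrier R" using qz P.Icarr by auto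
    then show "r \<odot>\<^bsub>residue_field_mod R P\<^esub> y = \<zero>\<^bsub>residue_field_mod R P\<^esub>"
      unfolding N_def[symmetric] x(4) using x(1-3) by (simp add: sm z[simplified])
  next
    assume r: "r \<in> carrier R - P" and 0: "r \<odot>\<^bsub>residue_field_mod R P\<^esub> y = \<zero>\<^bsub>residue_field_mod R P\<^esub>"
    then show "y = \<zero>\<^bsub>residue_field_mod R P\<^esub>"
      unfolding N_def[symmetric] x(4) using x(1-3) qz[of r] q(1)[of r]
      by (simp add: sm z[simplified] D.integral_iff)
  next
    assume r: "r \<in> carrier R - P"
    \<comment> \<open>Division by \<open>r\<close> multiplies the denominator by the class of
      \<open>r\<close>, which is nonzero in \<open>R / P\<close>.\<close>
    then have "y = r \<odot>\<^bsub>N\<^esub> mk_frac D a (q r \<otimes>\<^bsub>D\<^esub> b)"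
      unfolding x(4) using x(1-3) qz[of r] q(1)[of r]
      by (simp add: sm D.mk_frac_eq_iff D.integral_iff D.m_ac)
    moreover have "mk_frac D a (q r \<otimes>\<^bsub>D\<^esub> b) \<in> carrier N"
      using r x(1-3) qz[of r] q(1)[of r] by (simp add: D.mk_frac_closed D.integral_iff)
    ultimately show "\<exists>z\<in>carrier (residue_field_mod R P). y = r \<odot>\<^bsub>residue_field_mod R P\<^esub> z"
      unfolding N_def by blast
  }
qed

section \<open>Cosets in free abelian groups\<close>

lemmas free_induct = free_Abelian_group_induct[consumes 1, case_names zero diff of]

lemma subgroup_freeD:
  assumes "subgroup H (free_Abelian_group S)"
  shows subgroup_free_keys: "x \<in> H \<Longrightarrow> Poly_Mapping.keys x \<subseteq> S"
    and subgroup_free_zero: "0 \<in> H"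
    and subgroup_free_add: "x \<in> H \<Longrightarrow> y \<in> H \<Longrightarrow> x + y \<in> H"
    and subgroup_free_minus: "x \<in> H \<Longrightarrow> - x \<in> H"
    and subgroup_free_diff: "x \<in> H \<Longrightarrow> y \<in> H \<Longrightarrow> x - y \<in> H"
proof -
  show k: "x \<in> H \<Longrightarrow> Poly_Mapping.keys x \<subseteq> S" for x using subsetD[OF subgroup.subset[OF assms], of x] by simp
  show "0 \<in> H" using subgroup.one_closed[OF assms] by simp
  show a: "x \<in> H \<Longrightarrow> y \<in> H \<Longrightarrow> x + y \<in> H" for x y using subgroup.m_closed[OF assms, of x y] by simp
  show m: "x \<in> H \<Longrightarrow> - x \<in> H" for x using subgroup.m_inv_closed[OF assms, of x] k[of x] by simp
  show "x \<in> H \<Longrightarrow> y \<in> H \<Longrightarrow> x - y \<in> H" using a[of x "- y"] m[of y] by simp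
qed

lemma coset_free: "H #>\<^bsub>free_Abelian_group S\<^esub> a = (\<lambda>h. h + a) ` H"
  by (auto simp: r_coset_def)

lemma coset_free_eq_iff:
  assumes "subgroup H (free_Abelian_group S)"
  shows "H #>\<^bsub>free_Abelian_group S\<^esub> a = H #>\<^bsub>free_Abelian_group S\<^esub> b \<longleftrightarrow> a - b \<in> H"
proof
  assume "H #>\<^bsub>free_Abelian_group S\<^esub> a = H #>\<^bsub>free_Abelian_group S\<^esub> b"
  moreover have "a \<in> (\<lambda>h. h + a) ` H" using subgroup_free_zero[OF assms] by (force intro: image_eqI[of _ _ 0])
  ultimately show "a - b \<in> H" unfolding coset_free by auto
next
  assume ab: "a - b \<in> H"
  show "H #>\<^bsub>free_Abelian_group S\<^esub> a = H #>\<^bsub>free_Abelian_group S\<^esub> b"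
    unfolding coset_free
  proof (intro equalityI subsetI)
    fix x assume "x \<in> (\<lambda>h. h + a) ` H"
    then obtain h where "h \<in> H" "x = (h + (a - b)) + b" by auto
    then show "x \<in> (\<lambda>h. h + b) ` H" using subgroup_free_add[OF assms _ ab] by blast
  next
    fix x assume "x \<in> (\<lambda>h. h + b) ` H"
    then obtain h where "h \<in> H" "x = (h - (a - b)) + a" by auto
    then show "x \<in> (\<lambda>h. h + a) ` H" using subgroup_free_diff[OF assms _ ab] by blast
  qed
qed

lemma coset_free_eq_self_iff:
  assumes "subgroup H (free_Abelian_group S)"
  shows "H #>\<^bsub>free_Abelian_group S\<^esub> a = H \<longleftrightarrow> a \<in> H"
  using coset_free_eq_iff[OF assms, of a 0] by (simp add: coset_free)

lemma set_mult_coset_free: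
  assumes "subgroup H (free_Abelian_group S)"
  shows "(H #>\<^bsub>free_Abelian_group S\<^esub> a) <#>\<^bsub>free_Abelian_group S\<^esub> (H #>\<^bsub>free_Abelian_group S\<^esub> b)
    = H #>\<^bsub>free_Abelian_group S\<^esub> (a + b)"
proof (intro equalityI subsetI)
  fix x assume "x \<in> (H #>\<^bsub>free_Abelian_group S\<^esub> a) <#>\<^bsub>free_Abelian_group S\<^esub> (H #>\<^bsub>free_Abelian_group S\<^esub> b)"
  then obtain h k where "h \<in> H" "k \<in> H" "x = (h + a) + (k + b)" by (auto simp: set_mult_def coset_free)
  then have "x = (h + k) + (a + b)" "h + k \<in> H" using subgroup_free_add[OF assms] by auto
  then show "x \<in> H #>\<^bsub>free_Abelian_group S\<^esub> (a + b)" unfolding coset_free by blast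
next
  fix x assume "x \<in> H #>\<^bsub>free_Abelian_group S\<^esub> (a + b)"
  then obtain h where "h \<in> H" "x = (h + a) + (0 + b)" by (auto simp: coset_free add.assoc)
  then show "x \<in> (H #>\<^bsub>free_Abelian_group S\<^esub> a) <#>\<^bsub>free_Abelian_group S\<^esub> (H #>\<^bsub>free_Abelian_group S\<^esub> b)"
    using subgroup_free_zero[OF assms] unfolding set_mult_def coset_free by force
qed

text \<open>Inverses in the free abelian group are negatives on its carrier only, whence the
  condition on \<open>A\<close>. The rule allows a purely additive treatment of generated
  subgroups.\<close>

lemma generate_free_induct:
  assumes "x \<in> generate (free_Abelian_group S) A" "A \<subseteq> carrier (free_Abelian_group S)"
    and "P 0" "\<And>a. a \<in> A \<Longrightarrow> P a" "\<And>x. P x \<Longrightarrow> P (- x)" "\<And>x y. P x \<Longrightarrow> P y \<Longrightarrow> P (x + y)"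
  shows "P x"
  using assms(1)
proof (induction rule: generate.induct)
  case (inv h)
  then have "inv\<^bsub>free_Abelian_group S\<^esub> h = - h" using assms(2) by auto
  then show ?case using assms(4,5) inv by simp
qed (use assms(3-6) in simp_all)

lemma subgroup_generate_free:
  assumes "A \<subseteq> carrier (free_Abelian_group S)"
  shows "subgroup (generate (free_Abelian_group S) A) (free_Abelian_group S)"
  by (rule group.generate_is_subgroup[OF group_free_Abelian_group assms])


section \<open>Tensor products\<close>

lemma keys_diff_subset: "Poly_Mapping.keys a \<subseteq> S \<Longrightarrow> Poly_Mapping.keys b \<subseteq> S \<Longrightarrow> Poly_Mapping.keys (a - b) \<subseteq> S"
  by (meson keys_diff Un_least order_trans)

lemma keys_plus_subset: "Poly_Mapping.keys a \<subseteq> S \<Longrightarrow> Poly_Mapping.keys b \<subseteq> S \<Longrightarrow> Poly_Mapping.keys (a + b) \<subseteq> S"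
  by (meson Poly_Mapping.keys_add Un_least order_trans)

definition tensor_gens ::
  "('a, 'r) ring_scheme \<Rightarrow> ('a, 'm) module \<Rightarrow> ('a, 'n) module \<Rightarrow> ('m \<times> 'n \<Rightarrow>\<^sub>0 int) set" where
  "tensor_gens R M N = {frag_of (x \<oplus>\<^bsub>M\<^esub> x', y) - frag_of (x, y) - frag_of (x', y) | x x' y.
         x \<in> carrier M \<and> x' \<in> carrier M \<and> y \<in> carrier N} \<union>
      {frag_of (x, y \<oplus>\<^bsub>N\<^esub> y') - frag_of (x, y) - frag_of (x, y') | x y y'.
         x \<in> carrier M \<and> y \<in> carrier N \<and> y' \<in> carrier N} \<union>
      {frag_of (r \<odot>\<^bsub>M\<^esub> x, y) - frag_of (x, r \<odot>\<^bsub>N\<^esub> y) | r x y.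
         r \<in> carrier R \<and> x \<in> carrier M \<and> y \<in> carrier N}"

lemma tensor_rels_eq:
  "tensor_rels R M N = generate (free_Abelian_group (carrier M \<times> carrier N)) (tensor_gens R M N)"
  unfolding tensor_rels_def tensor_gens_def ..

lemma tensor_gens_carrier:
  assumes "module R M" "module R N"
  shows "tensor_gens R M N \<subseteq> carrier (free_Abelian_group (carrier M \<times> carrier N))"
proof -
  interpret M: module R M by fact
  interpret N: module R N by fact
  show ?thesis unfolding tensor_gens_def
    by (intro subsetI, elim UnE CollectE exE conjE) (simp_all add: keys_diff_subset keys_frag_of)
qed

lemma tensor_gens_relsI: "c \<in> tensor_gens R M N \<Longrightarrow> c \<in> tensor_rels R M N"
  unfolding tensor_rels_eq by (rule generate.incl)

lemma subgroup_tensor_rels: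
  assumes "module R M" "module R N"
  shows "subgroup (tensor_rels R M N) (free_Abelian_group (carrier M \<times> carrier N))"
  unfolding tensor_rels_eq by (rule subgroup_generate_free[OF tensor_gens_carrier[OF assms]])

definition tcls ::
  "('a, 'r) ring_scheme \<Rightarrow> ('a, 'm) module \<Rightarrow> ('a, 'n) module \<Rightarrow> ('m \<times> 'n \<Rightarrow>\<^sub>0 int) \<Rightarrow>
    ('m \<times> 'n \<Rightarrow>\<^sub>0 int) set" where
  "tcls R M N c = tensor_rels R M N #>\<^bsub>free_Abelian_group (carrier M \<times> carrier N)\<^esub> c"

lemma tcls_0: "tcls R M N 0 = tensor_rels R M N"
  by (simp add: tcls_def coset_free)

lemma tcls_eq_iff:
  assumes "module R M" "module R N"
  shows "tcls R M N a = tcls R M N b \<longleftrightarrow> a - b \<in> tensor_rels R M N"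
  unfolding tcls_def by (rule coset_free_eq_iff[OF subgroup_tensor_rels[OF assms]])

lemma tcls_eq_rels_iff:
  assumes "module R M" "module R N"
  shows "tcls R M N a = tensor_rels R M N \<longleftrightarrow> a \<in> tensor_rels R M N"
  unfolding tcls_def by (rule coset_free_eq_self_iff[OF subgroup_tensor_rels[OF assms]])

lemma carrier_tensor_mod:
  "carrier (tensor_mod R M N) = tcls R M N ` {c. Poly_Mapping.keys c \<subseteq> carrier M \<times> carrier N}"
  by (auto simp: tensor_mod_def Let_def FactGroup_def RCOSETS_def tcls_def)

lemma zero_tensor_mod: "\<zero>\<^bsub>tensor_mod R M N\<^esub> = tensor_rels R M N"
  by (simp add: tensor_mod_def Let_def FactGroup_def)

text \<open>The lift of \<open>f \<otimes> N\<close> to formal sums, before passing to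
  cosets.\<close>

definition push :: "('l \<Rightarrow> 'm) \<Rightarrow> ('l \<times> 'n \<Rightarrow>\<^sub>0 int) \<Rightarrow> ('m \<times> 'n \<Rightarrow>\<^sub>0 int)" where
  "push f = frag_extend (\<lambda>(x, y). frag_of (f x, y))"

lemma push_simps [simp]:
  "push f 0 = 0" "push f (frag_of (x, y)) = frag_of (f x, y)" "push f (a + b) = push f a + push f b"
  "push f (- a) = - push f a" "push f (a - b) = push f a - push f b"
  by (simp_all add: push_def frag_extend_add frag_extend_minus frag_extend_diff)

lemma push_keys:
  assumes "\<And>x. x \<in> A \<Longrightarrow> f x \<in> B" "Poly_Mapping.keys c \<subseteq> A \<times> C"
  shows "Poly_Mapping.keys (push f c) \<subseteq> B \<times> C"
  using assms(2)
proof (induction c rule: free_induct)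
  case (diff x y)
  then show ?case by (simp add: keys_diff_subset)
next
  case (of a)
  then show ?case using assms(1) by (cases a) auto
qed auto

lemma push_cong:
  assumes "Poly_Mapping.keys c \<subseteq> A \<times> C" "\<And>x. x \<in> A \<Longrightarrow> f x = g x"
  shows "push f c = push g c"
  using assms(1)
  by (induction c rule: free_induct) (use assms(2) in auto)

lemma push_comp:
  "push g (push f c) = push (\<lambda>x. g (f x)) c"
proof -
  have "Poly_Mapping.keys c \<subseteq> UNIV \<times> UNIV" by simp
  then show ?thesis by (induction c rule: free_induct) auto
qed

lemma push_ident: "push (\<lambda>x. x) c = c"
proof -
  have "Poly_Mapping.keys c \<subseteq> UNIV \<times> UNIV" by simp
  then show ?thesis by (induction c rule: free_induct) auto
qed

lemma push_rels:
  assumes "module R M" "module R M'" "module R N" "f \<in> mod_hom R M M'" "c \<in> tensor_rels R M N"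
  shows "push f c \<in> tensor_rels R M' N"
proof -
  note S = subgroup_freeD[OF subgroup_tensor_rels[OF assms(2,3)]]
  have "push f c \<in> tensor_rels R M' N" if c: "c \<in> tensor_gens R M N" for c
  proof (rule tensor_gens_relsI)
    show "push f c \<in> tensor_gens R M' N"
      using c mod_hom_closed[OF assms(4)] unfolding tensor_gens_def
      by (auto simp: mod_hom_add[OF assms(4)] mod_hom_smult[OF assms(4)]) blast+
  qed
  then show ?thesis
    using assms(5) unfolding tensor_rels_eq[of R M N]
    by (elim generate_free_induct[OF _ tensor_gens_carrier[OF assms(1,3)]]) (auto intro: S)
qed

text \<open>\<open>tensor_map\<close> adds the target relations to the image of a coset. As
  \<open>push f\<close> carries relations to relations, the outcome is exactly one coset.\<close>

lemma tensor_map_tcls: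
  assumes "module R M" "module R M'" "module R N" "f \<in> mod_hom R M M'"
  shows "tensor_map R M' N f (tcls R M N c) = tcls R M' N (push f c)"
proof -
  note S = subgroup_freeD[OF subgroup_tensor_rels[OF assms(2,3)]]
  have eq: "tensor_map R M' N f (tcls R M N c) =
    {h + (push f k + push f c) |h k. h \<in> tensor_rels R M' N \<and> k \<in> tensor_rels R M N}"
    unfolding tensor_map_def tcls_def coset_free set_mult_def push_def[symmetric] by auto
  show ?thesis unfolding eq unfolding tcls_def coset_free
  proof (intro equalityI subsetI)
    fix x assume "x \<in> {h + (push f k + push f c) |h k. h \<in> tensor_rels R M' N \<and> k \<in> tensor_rels R M N}"
    then obtain h k where hk: "h \<in> tensor_rels R M' N" "k \<in> tensor_rels R M N" "x = (h + push f k) + push f c"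
      by (auto simp: add.assoc)
    then have "h + push f k \<in> tensor_rels R M' N" using S(3) push_rels[OF assms hk(2)] by blast
    then show "x \<in> (\<lambda>h. h + push f c) ` tensor_rels R M' N" using hk by blast
  next
    fix x assume "x \<in> (\<lambda>h. h + push f c) ` tensor_rels R M' N"
    then obtain h where h: "h \<in> tensor_rels R M' N" "x = h + (push f 0 + push f c)" by auto
    then show "x \<in> {h + (push f k + push f c) |h k. h \<in> tensor_rels R M' N \<and> k \<in> tensor_rels R M N}"
      using subgroup_free_zero[OF subgroup_tensor_rels[OF assms(1,3)]] by blast
  qed
qed

lemma tensor_map_zero:
  assumes "module R M" "module R M'" "module R N" "f \<in> mod_hom R M M'"
  shows "tensor_map R M' N f (tensor_rels R M N) = tensor_rels R M' N"
  using tensor_map_tcls[OF assms, of 0] by (simp add: tcls_0)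

lemma tensor_map_closed:
  assumes "module R M" "module R M'" "module R N" "f \<in> mod_hom R M M'" "z \<in> carrier (tensor_mod R M N)"
  shows "tensor_map R M' N f z \<in> carrier (tensor_mod R M' N)"
proof -
  obtain c where c: "Poly_Mapping.keys c \<subseteq> carrier M \<times> carrier N" "z = tcls R M N c"
    using assms(5) by (auto simp: carrier_tensor_mod)
  have "Poly_Mapping.keys (push f c) \<subseteq> carrier M' \<times> carrier N"
    by (rule push_keys[OF _ c(1)]) (rule mod_hom_closed[OF assms(4)])
  then show ?thesis unfolding c(2) tensor_map_tcls[OF assms(1-4)] carrier_tensor_mod by blast
qed

text \<open>Functoriality of the tensor product for commutative squares, the form in which chain
  maps have to be moved past differentials.\<close>

lemma tensor_map_comm:
  assumes "module R M" "module R M1" "module R M2" "module R L" "module R N"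
    and "f \<in> mod_hom R M M1" "g \<in> mod_hom R M1 L" "f' \<in> mod_hom R M M2" "g' \<in> mod_hom R M2 L"
    and "\<And>x. x \<in> carrier M \<Longrightarrow> g (f x) = g' (f' x)" "z \<in> carrier (tensor_mod R M N)"
  shows "tensor_map R L N g (tensor_map R M1 N f z) = tensor_map R L N g' (tensor_map R M2 N f' z)"
proof -
  obtain c where c: "Poly_Mapping.keys c \<subseteq> carrier M \<times> carrier N" "z = tcls R M N c"
    using assms(11) by (auto simp: carrier_tensor_mod)
  have "push (\<lambda>x. g (f x)) c = push (\<lambda>x. g' (f' x)) c" by (rule push_cong[OF c(1) assms(10)])
  then show ?thesis unfolding c(2)
    by (simp add: tensor_map_tcls[OF assms(1,2,5,6)] tensor_map_tcls[OF assms(2,4,5,7)]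
        tensor_map_tcls[OF assms(1,3,5,8)] tensor_map_tcls[OF assms(3,4,5,9)] push_comp)
qed

lemma tensor_map_inverse:
  assumes "module R M" "module R M1" "module R N"
    and "f \<in> mod_hom R M M1" "g \<in> mod_hom R M1 M"
    and "\<And>x. x \<in> carrier M \<Longrightarrow> g (f x) = x" "z \<in> carrier (tensor_mod R M N)"
  shows "tensor_map R M N g (tensor_map R M1 N f z) = z"
proof -
  obtain c where c: "Poly_Mapping.keys c \<subseteq> carrier M \<times> carrier N" "z = tcls R M N c"
    using assms(7) by (auto simp: carrier_tensor_mod)
  have "push (\<lambda>x. g (f x)) c = push (\<lambda>x. x) c" by (rule push_cong[OF c(1)]) (use assms(6) in auto)
  then show ?thesis unfolding c(2)
    by (simp add: tensor_map_tcls[OF assms(1,2,3,4)] tensor_map_tcls[OF assms(2,1,3,5)] push_comp push_ident)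
qed


section \<open>Supports\<close>

text \<open>A retract on the nose, not up to homotopy: the summands split off below are literal, and
  this form passes to termwise tensor products at once.\<close>

definition cx_retract ::
  "('a, 'r) ring_scheme \<Rightarrow> ('a, 'm) cplx \<Rightarrow> ('a, 'n) cplx \<Rightarrow> bool" where
  "cx_retract R A Y \<longleftrightarrow> (\<exists>i r. chain_map R A Y i \<and> chain_map R Y A r \<and>
     (\<forall>n. \<forall>x\<in>carrier (cobj A n). r n (i n x) = x))"

lemma tensor_cplx_simps [simp]:
  "cobj (tensor_cplx R U N) n = tensor_mod R (cobj U n) N"
  "cdiff (tensor_cplx R U N) n = tensor_map R (cobj U (n - 1)) N (cdiff U n)"
  by (simp_all add: tensor_cplx_def)

text \<open>A cycle \<open>z\<close> of \<open>A \<otimes> N\<close> becomes a cycle in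
  \<open>Y \<otimes> N\<close>, bounds there, and the retraction carries the bounding element
  back.\<close>

lemma acyclic_retract:
  assumes "cx_retract R A Y" "is_complex R A" "is_complex R Y" "module R N"
    and "acyclic_cplx (tensor_cplx R Y N)"
  shows "acyclic_cplx (tensor_cplx R A N)"
  unfolding acyclic_cplx_def
proof
  fix n
  obtain i r where ir: "chain_map R A Y i" "chain_map R Y A r"
    "\<And>n x. x \<in> carrier (cobj A n) \<Longrightarrow> r n (i n x) = x"
    using assms(1) unfolding cx_retract_def by blast
  note A = cx_module[OF assms(2)] and Y = cx_module[OF assms(3)]
  note dA = cx_diff[OF assms(2)] and dX = cx_diff[OF assms(3)]
  note i = chain_map_hom[OF ir(1)] and r = chain_map_hom[OF ir(2)]
  define I where "I n = tensor_map R (cobj Y n) N (i n)" for n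
  define Q where "Q n = tensor_map R (cobj A n) N (r n)" for n
  define DA where "DA n = tensor_map R (cobj A (n - 1)) N (cdiff A n)" for n
  define DX where "DX n = tensor_map R (cobj Y (n - 1)) N (cdiff Y n)" for n
  let ?TA = "\<lambda>n. carrier (tensor_mod R (cobj A n) N)" and ?TX = "\<lambda>n. carrier (tensor_mod R (cobj Y n) N)"
  have I: "I n z \<in> ?TX n" if "z \<in> ?TA n" for n z
    unfolding I_def by (rule tensor_map_closed[OF A Y assms(4) i that])
  have Q: "Q n z \<in> ?TA n" if "z \<in> ?TX n" for n z
    unfolding Q_def by (rule tensor_map_closed[OF Y A assms(4) r that])
  have QI: "Q n (I n z) = z" if "z \<in> ?TA n" for n z
    unfolding Q_def I_def by (rule tensor_map_inverse[OF A Y assms(4) i r ir(3) that])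
  have DI: "DX n (I n z) = I (n - 1) (DA n z)" if "z \<in> ?TA n" for n z
    unfolding DX_def I_def DA_def
    by (rule tensor_map_comm[OF A Y A Y assms(4) i dX dA i chain_map_comm[OF ir(1)] that])
  have DQ: "DA n (Q n z) = Q (n - 1) (DX n z)" if "z \<in> ?TX n" for n z
    unfolding DX_def Q_def DA_def
    by (rule tensor_map_comm[OF Y A Y A assms(4) r dA dX r chain_map_comm[OF ir(2)] that])
  have I0: "I n (tensor_rels R (cobj A n) N) = tensor_rels R (cobj Y n) N" for n
    unfolding I_def by (rule tensor_map_zero[OF A Y assms(4) i])
  have Q0: "Q n (tensor_rels R (cobj Y n) N) = tensor_rels R (cobj A n) N" for n
    unfolding Q_def by (rule tensor_map_zero[OF Y A assms(4) r])
  have ac: "{z \<in> ?TX n. DX n z = tensor_rels R (cobj Y (n - 1)) N} = DX (n + 1) ` ?TX (n + 1)"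
    using assms(5) unfolding acyclic_cplx_def DX_def by (simp add: zero_tensor_mod)
  have "{z \<in> ?TA n. DA n z = tensor_rels R (cobj A (n - 1)) N} = DA (n + 1) ` ?TA (n + 1)"
  proof (intro equalityI subsetI)
    fix z assume z: "z \<in> {z \<in> ?TA n. DA n z = tensor_rels R (cobj A (n - 1)) N}"
    then have "DX n (I n z) = tensor_rels R (cobj Y (n - 1)) N" using DI I0 by auto
    then have "I n z \<in> DX (n + 1) ` ?TX (n + 1)" using ac I z by blast
    then obtain w where w: "w \<in> ?TX (n + 1)" "I n z = DX (n + 1) w" by blast
    have "z = Q n (DX (n + 1) w)" using QI[of z n] w(2) z by simp
    also have "\<dots> = DA (n + 1) (Q (n + 1) w)" using DQ[OF w(1)] by simp
    finally show "z \<in> DA (n + 1) ` ?TA (n + 1)" using Q[OF w(1)] by blast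
  next
    fix z assume "z \<in> DA (n + 1) ` ?TA (n + 1)"
    then obtain w where w: "w \<in> ?TA (n + 1)" "z = DA (n + 1) w" by blast
    have zA: "z \<in> ?TA n" unfolding w(2) DA_def
      using tensor_map_closed[OF A A assms(4) dA w(1)] by simp
    \<comment> \<open>That boundaries of \<open>A \<otimes> N\<close> are cycles is also read off
      from \<open>Y\<close>, since the equation expressing acyclicity contains it.\<close>
    have "I n z = DX (n + 1) (I (n + 1) w)" using DI[OF w(1)] w(2) by simp
    then have "I n z \<in> DX (n + 1) ` ?TX (n + 1)" using I[OF w(1)] by blast
    then have "DX n (I n z) = tensor_rels R (cobj Y (n - 1)) N" using ac by blast
    then have "DA n z = tensor_rels R (cobj A (n - 1)) N"
      using DQ[OF I[OF zA]] QI[OF zA] Q0 by simp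
    then show "z \<in> {z \<in> ?TA n. DA n z = tensor_rels R (cobj A (n - 1)) N}" using zA by blast
  qed
  then show "{x \<in> carrier (cobj (tensor_cplx R A N) n). cdiff (tensor_cplx R A N) n x =
        \<zero>\<^bsub>cobj (tensor_cplx R A N) (n - 1)\<^esub>} =
      cdiff (tensor_cplx R A N) (n + 1) ` carrier (cobj (tensor_cplx R A N) (n + 1))"
    unfolding DA_def by (simp add: zero_tensor_mod)
qed

lemma Supp_retract:
  assumes "cx_retract R A Y" "is_complex R A" "is_complex R Y" "cring R"
  shows "Supp R A \<subseteq> Supp R Y"
  using acyclic_retract[OF assms(1-3)] module_residue_field[OF assms(4)] unfolding Supp_def Spec_def by blast


section \<open>Two-term complexes, stalks and their supports\<close>

definition two_term :: "('a, 'm) module \<Rightarrow> int \<Rightarrow> 'a \<Rightarrow> ('a, 'm) cplx" where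
  "two_term F n a = \<lparr>cobj = (\<lambda>k. if k = n \<or> k = n - 1 then F else zero_submod F),
     cdiff = (\<lambda>k x. if k = n then a \<odot>\<^bsub>F\<^esub> x else \<zero>\<^bsub>F\<^esub>)\<rparr>"

definition stalk_at :: "('a, 'm) module \<Rightarrow> int \<Rightarrow> ('a, 'm) cplx" where
  "stalk_at F n = \<lparr>cobj = (\<lambda>k. if k = n then F else zero_submod F), cdiff = (\<lambda>k x. \<zero>\<^bsub>F\<^esub>)\<rparr>"

lemma zero_submod_simps [simp]:
  "carrier (zero_submod M) = {\<zero>\<^bsub>M\<^esub>}" "ring.zero (zero_submod M) = \<zero>\<^bsub>M\<^esub>"
  "ring.add (zero_submod M) = ring.add M" "smult (zero_submod M) = smult M"
  by (simp_all add: zero_submod_def)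

lemma module_zero_submod:
  assumes "module R M" shows "module R (zero_submod M)"
  unfolding zero_submod_def by (rule submodule.submodule_is_module[OF submodule_zero[OF assms] assms])

lemma two_term_simps [simp]:
  "cobj (two_term F n a) k = (if k = n \<or> k = n - 1 then F else zero_submod F)"
  "cdiff (two_term F n a) k x = (if k = n then a \<odot>\<^bsub>F\<^esub> x else \<zero>\<^bsub>F\<^esub>)"
  by (simp_all add: two_term_def)

lemma stalk_at_simps [simp]:
  "cobj (stalk_at F n) k = (if k = n then F else zero_submod F)"
  "cdiff (stalk_at F n) k x = \<zero>\<^bsub>F\<^esub>"
  by (simp_all add: stalk_at_def)

lemma is_complex_two_term:
  assumes "module R F" "a \<in> carrier R"
  shows "is_complex R (two_term F n a)"
proof -
  interpret F: module R F by fact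
  show ?thesis unfolding is_complex_def
  proof (intro allI conjI ballI)
    fix k
    show "module R (cobj (two_term F n a) k)" using assms module_zero_submod by auto
    show "cdiff (two_term F n a) k \<in> mod_hom R (cobj (two_term F n a) k) (cobj (two_term F n a) (k - 1))"
      by (rule mod_homI)
        (use assms(2) in \<open>auto simp: F.smult_r_distr F.smult_assoc1[symmetric] F.R.m_comm split: if_splits\<close>)
  qed (use assms(2) in \<open>auto split: if_splits\<close>)
qed

lemma is_complex_stalk_at:
  assumes "module R F"
  shows "is_complex R (stalk_at F n)"
proof -
  interpret F: module R F by fact
  show ?thesis unfolding is_complex_def
  proof (intro allI conjI ballI)
    fix k
    show "module R (cobj (stalk_at F n) k)" using assms module_zero_submod by auto
    show "cdiff (stalk_at F n) k \<in> mod_hom R (cobj (stalk_at F n) k) (cobj (stalk_at F n) (k - 1))"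
      by (rule mod_homI) (auto split: if_splits)
  qed (auto split: if_splits)
qed

lemma regular_mod_simps [simp]:
  "carrier (regular_mod R) = carrier R" "ring.zero (regular_mod R) = ring.zero R"
  "ring.add (regular_mod R) = ring.add R" "smult (regular_mod R) = monoid.mult R"
  by (simp_all add: regular_mod_def)

lemma module_regular:
  assumes "cring R" shows "module R (regular_mod R)"
proof -
  interpret cring R by fact
  show ?thesis
  proof (rule moduleI)
    show "abelian_group (regular_mod R)"
      by (rule abelian_groupI) (auto simp: a_ac intro: bexI[of _ "\<ominus>\<^bsub>R\<^esub> _"] l_neg)
  qed (auto simp: is_cring l_distr r_distr m_assoc)
qed

text \<open>Together the three facts identify \<open>R \<otimes> N\<close> with \<open>N\<close> by
  \<open>y \<mapsto> 1 \<otimes> y\<close>. Moving scalars to the right factor gives surjectivity;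
  injectivity is detected by the map that scalar multiplication induces on formal sums.\<close>

lemma regular_tensor:
  fixes R (structure)
  assumes "cring R" "module R N"
  shows regular_tensor_carrier: "carrier (tensor_mod R (regular_mod R) N) =
      (\<lambda>y. tcls R (regular_mod R) N (frag_of (\<one>, y))) ` carrier N"
    and regular_tensor_zero: "\<And>y. y \<in> carrier N \<Longrightarrow>
      tcls R (regular_mod R) N (frag_of (\<one>, y)) = tensor_rels R (regular_mod R) N \<longleftrightarrow> y = \<zero>\<^bsub>N\<^esub>"
    and regular_tensor_scale: "\<And>a y. a \<in> carrier R \<Longrightarrow> y \<in> carrier N \<Longrightarrow>
      tcls R (regular_mod R) N (frag_of (a, y)) = tcls R (regular_mod R) N (frag_of (\<one>, a \<odot>\<^bsub>N\<^esub> y))"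
proof -
  interpret cring R by fact
  interpret N: module R N by fact
  let ?F = "regular_mod R"
  let ?H = "tensor_rels R ?F N"
  let ?S = "carrier ?F \<times> carrier N"
  have F: "module R ?F" by (rule module_regular[OF assms(1)])
  note sg = subgroup_tensor_rels[OF F assms(2)]
  note S = subgroup_freeD[OF sg]
  have g2: "frag_of (x, y \<oplus>\<^bsub>N\<^esub> y') - frag_of (x, y) - frag_of (x, y') \<in> ?H"
    if "x \<in> carrier R" "y \<in> carrier N" "y' \<in> carrier N" for x y y'
    by (rule tensor_gens_relsI) (use that in \<open>auto simp: tensor_gens_def\<close>)
  have g3: "frag_of (r, y) - frag_of (\<one>, r \<odot>\<^bsub>N\<^esub> y) \<in> ?H" if "r \<in> carrier R" "y \<in> carrier N" for r y
  proof (rule tensor_gens_relsI)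
    have "frag_of (r, y) - frag_of (\<one>, r \<odot>\<^bsub>N\<^esub> y) = frag_of (r \<odot>\<^bsub>?F\<^esub> \<one>, y) - frag_of (\<one>, r \<odot>\<^bsub>N\<^esub> y)"
      using that by simp
    moreover have "frag_of (r \<odot>\<^bsub>?F\<^esub> \<one>, y) - frag_of (\<one>, r \<odot>\<^bsub>N\<^esub> y) \<in> tensor_gens R ?F N"
      unfolding tensor_gens_def
      by (rule UnI2, intro CollectI exI[of _ r] exI[of _ \<one>] exI[of _ y]) (use that in simp)
    ultimately show "frag_of (r, y) - frag_of (\<one>, r \<odot>\<^bsub>N\<^esub> y) \<in> tensor_gens R ?F N" by simp
  qed
  show "tcls R ?F N (frag_of (a, y)) = tcls R ?F N (frag_of (\<one>, a \<odot>\<^bsub>N\<^esub> y))"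
    if "a \<in> carrier R" "y \<in> carrier N" for a y
    unfolding tcls_eq_iff[OF F assms(2)] by (rule g3[OF that])
  \<comment> \<open>Every formal sum is congruent to a single tensor with left factor 1.\<close>
  have ex: "\<exists>y\<in>carrier N. c - frag_of (\<one>, y) \<in> ?H" if "Poly_Mapping.keys c \<subseteq> ?S" for c
    using that
  proof (induction c rule: free_induct)
    case zero
    have "frag_of (\<one>, \<zero>\<^bsub>N\<^esub>) - frag_of (\<one>, \<zero>\<^bsub>N\<^esub>) - frag_of (\<one>, \<zero>\<^bsub>N\<^esub>) \<in> ?H"
      using g2[of \<one> "\<zero>\<^bsub>N\<^esub>" "\<zero>\<^bsub>N\<^esub>"] by simp
    then show ?case by (intro bexI[of _ "\<zero>\<^bsub>N\<^esub>"]) auto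
  next
    case (diff a b)
    then obtain y z where yz: "y \<in> carrier N" "a - frag_of (\<one>, y) \<in> ?H" "z \<in> carrier N" "b - frag_of (\<one>, z) \<in> ?H"
      by auto
    have "y \<ominus>\<^bsub>N\<^esub> z \<oplus>\<^bsub>N\<^esub> z = y" using yz by (simp add: N.ag_simps)
    then have "frag_of (\<one>, y) - frag_of (\<one>, y \<ominus>\<^bsub>N\<^esub> z) - frag_of (\<one>, z) \<in> ?H"
      using g2[of \<one> "y \<ominus>\<^bsub>N\<^esub> z" z] yz by simp
    then have "(a - frag_of (\<one>, y)) - (b - frag_of (\<one>, z)) +
      (frag_of (\<one>, y) - frag_of (\<one>, y \<ominus>\<^bsub>N\<^esub> z) - frag_of (\<one>, z)) \<in> ?H"
      by (rule S(3)[OF S(5)[OF yz(2) yz(4)]])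
    then have "a - b - frag_of (\<one>, y \<ominus>\<^bsub>N\<^esub> z) \<in> ?H" by (simp add: algebra_simps)
    then show ?case using yz N.minus_closed by blast
  next
    case (of p)
    then show ?case using g3 by (cases p) auto
  qed
  show "carrier (tensor_mod R ?F N) = (\<lambda>y. tcls R ?F N (frag_of (\<one>, y))) ` carrier N"
    unfolding carrier_tensor_mod
  proof (intro equalityI subsetI)
    fix z assume "z \<in> tcls R ?F N ` {c. Poly_Mapping.keys c \<subseteq> ?S}"
    then obtain c where c: "Poly_Mapping.keys c \<subseteq> ?S" "z = tcls R ?F N c" by auto
    then obtain y where "y \<in> carrier N" "c - frag_of (\<one>, y) \<in> ?H" using ex by blast
    then show "z \<in> (\<lambda>y. tcls R ?F N (frag_of (\<one>, y))) ` carrier N"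
      using tcls_eq_iff[OF F assms(2), of c] c(2) by blast
  next
    fix z assume "z \<in> (\<lambda>y. tcls R ?F N (frag_of (\<one>, y))) ` carrier N"
    then show "z \<in> tcls R ?F N ` {c. Poly_Mapping.keys c \<subseteq> ?S}"
      by (auto simp: keys_frag_of intro!: imageI)
  qed
  \<comment> \<open>The universal property extends \<open>(x, y) \<mapsto> x y\<close> to
    \<open>h\<close>; it remains to see that \<open>h\<close> kills the three kinds of
    relations.\<close>
  have img: "(\<lambda>p. fst p \<odot>\<^bsub>N\<^esub> snd p) ` ?S \<subseteq> carrier (add_monoid N)" by auto
  obtain h where h: "h \<in> hom (free_Abelian_group ?S) (add_monoid N)"
    "\<And>p. p \<in> ?S \<Longrightarrow> h (frag_of p) = fst p \<odot>\<^bsub>N\<^esub> snd p"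
    using comm_group.free_Abelian_group_universal[OF N.a_comm_group img] by blast
  interpret h: group_hom "free_Abelian_group ?S" "add_monoid N" h
    using h(1) N.a_group by (simp add: group_hom_def group_hom_axioms_def)
  have hadd: "h (a + b) = h a \<oplus>\<^bsub>N\<^esub> h b" if "Poly_Mapping.keys a \<subseteq> ?S" "Poly_Mapping.keys b \<subseteq> ?S" for a b
    using h.hom_mult[of a b] that by simp
  have hneg: "h (- a) = \<ominus>\<^bsub>N\<^esub> h a" if "Poly_Mapping.keys a \<subseteq> ?S" for a
    using h.hom_inv[of a] that by (simp add: a_inv_def)
  have hdiff: "h (a - b) = h a \<ominus>\<^bsub>N\<^esub> h b" if "Poly_Mapping.keys a \<subseteq> ?S" "Poly_Mapping.keys b \<subseteq> ?S" for a b
    using hadd[of a "- b"] hneg[of b] that by (simp add: a_minus_def)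
  have hgen: "h c = \<zero>\<^bsub>N\<^esub>" if c: "c \<in> tensor_gens R ?F N" for c
  proof -
    have sw: "r \<odot>\<^bsub>N\<^esub> (x \<odot>\<^bsub>N\<^esub> y) = x \<odot>\<^bsub>N\<^esub> (r \<odot>\<^bsub>N\<^esub> y)"
      if "r \<in> carrier R" "x \<in> carrier R" "y \<in> carrier N" for r x y
      using that by (simp add: N.smult_assoc1[symmetric] m_comm)
    from c show ?thesis unfolding tensor_gens_def
      by (elim UnE CollectE exE conjE)
        (simp_all add: hdiff keys_diff_subset keys_frag_of h(2) N.smult_l_distr N.smult_r_distr N.smult_assoc1
          N.ag_simps sw)
  qed
  have hrels: "h c = \<zero>\<^bsub>N\<^esub>" if "c \<in> ?H" for c
  proof -
    have "Poly_Mapping.keys c \<subseteq> ?S \<and> h c = \<zero>\<^bsub>N\<^esub>"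
      using that unfolding tensor_rels_eq
    proof (elim generate_free_induct[OF _ tensor_gens_carrier[OF F assms(2)]])
      show "Poly_Mapping.keys 0 \<subseteq> ?S \<and> h 0 = \<zero>\<^bsub>N\<^esub>" using h.hom_one by simp
      show "Poly_Mapping.keys a \<subseteq> ?S \<and> h a = \<zero>\<^bsub>N\<^esub>" if "a \<in> tensor_gens R ?F N" for a
        using hgen[OF that] subsetD[OF tensor_gens_carrier[OF F assms(2)] that] by simp
    qed (auto simp: hneg hadd N.a_inv_zero keys_plus_subset)
    then show ?thesis by blast
  qed
  show "tcls R ?F N (frag_of (\<one>, y)) = ?H \<longleftrightarrow> y = \<zero>\<^bsub>N\<^esub>" if y: "y \<in> carrier N" for y
    unfolding tcls_eq_rels_iff[OF F assms(2)]
  proof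
    assume "frag_of (\<one>, y) \<in> ?H"
    then have "h (frag_of (\<one>, y)) = \<zero>\<^bsub>N\<^esub>" by (rule hrels)
    then show "y = \<zero>\<^bsub>N\<^esub>" using h(2)[of "(\<one>, y)"] y by simp
  next
    assume "y = \<zero>\<^bsub>N\<^esub>"
    then have "- frag_of (\<one>, y) \<in> ?H"
      using g2[of \<one> "\<zero>\<^bsub>N\<^esub>" "\<zero>\<^bsub>N\<^esub>"] by simp
    from S(4)[OF this] show "frag_of (\<one>, y) \<in> ?H" by simp
  qed
qed

lemma zero_submod_tensor_carrier:
  assumes "module R M" "module R N"
  shows "carrier (tensor_mod R (zero_submod M) N) = {tensor_rels R (zero_submod M) N}"
proof -
  interpret M: module R M by fact
  let ?F = "zero_submod M" and ?H = "tensor_rels R (zero_submod M) N"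
  have F: "module R ?F" by (rule module_zero_submod[OF assms(1)])
  note sg = subgroup_tensor_rels[OF F assms(2)]
  note S = subgroup_freeD[OF sg]
  have 0: "frag_of (\<zero>\<^bsub>M\<^esub>, y) \<in> ?H" if y: "y \<in> carrier N" for y
  proof -
    have "frag_of (\<zero>\<^bsub>M\<^esub> \<oplus>\<^bsub>?F\<^esub> \<zero>\<^bsub>M\<^esub>, y) - frag_of (\<zero>\<^bsub>M\<^esub>, y) - frag_of (\<zero>\<^bsub>M\<^esub>, y) \<in> ?H"
      by (rule tensor_gens_relsI) (use y in \<open>auto simp: tensor_gens_def\<close>)
    then have "- frag_of (\<zero>\<^bsub>M\<^esub>, y) \<in> ?H" by simp
    then show ?thesis using S(4) by fastforce
  qed
  have "c \<in> ?H" if "Poly_Mapping.keys c \<subseteq> carrier ?F \<times> carrier N" for c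
    using that by (induction c rule: free_induct) (auto intro: 0 S)
  then have "tcls R ?F N c = ?H" if "Poly_Mapping.keys c \<subseteq> carrier ?F \<times> carrier N" for c
    using tcls_eq_rels_iff[OF F assms(2)] that by blast
  then show ?thesis unfolding carrier_tensor_mod using tcls_0[of R ?F N] by force
qed

text \<open>Tensoring with \<open>K(P)\<close> leaves multiplication by \<open>a\<close> on a
  nonzero module, which is zero for \<open>a \<in> P\<close> and bijective otherwise.\<close>

lemma Supp_two_term:
  fixes R (structure)
  assumes "cring R" "a \<in> carrier R"
  shows "Supp R (two_term (regular_mod R) n a) = {P \<in> Spec R. a \<in> P}"
proof -
  interpret cring R by fact
  let ?F = "regular_mod R"
  let ?E = "two_term ?F n a"
  have F: "module R ?F" by (rule module_regular[OF assms(1)])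
  have "acyclic_cplx (tensor_cplx R ?E (residue_field_mod R P)) \<longleftrightarrow> a \<notin> P" if P: "P \<in> Spec R" for P
  proof -
    let ?N = "residue_field_mod R P"
    have prime: "primeideal P R" using P by (simp add: Spec_def)
    have Nm: "module R ?N" by (rule module_residue_field[OF assms(1) prime])
    interpret N: module R ?N by fact
    note F' = module_zero_submod[OF F]
    note rt = regular_tensor_carrier[OF assms(1) Nm] regular_tensor_zero[OF assms(1) Nm] regular_tensor_scale[OF assms(1) Nm]
    let ?t = "\<lambda>y. tcls R ?F ?N (frag_of (\<one>, y))"
    have d: "tensor_map R ?F ?N (cdiff ?E n) (?t y) = ?t (a \<odot>\<^bsub>?N\<^esub> y)" if "y \<in> carrier ?N" for y
    proof -
      have "cdiff ?E n \<in> mod_hom R ?F ?F" using cx_diff[OF is_complex_two_term[OF F assms(2)], of n n] by simp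
      then have "tensor_map R ?F ?N (cdiff ?E n) (?t y) = tcls R ?F ?N (frag_of (a, y))"
        using assms(2) by (simp add: tensor_map_tcls[OF F F Nm])
      then show ?thesis using rt(3)[OF assms(2) that] by (rule trans)
    qed
    have z1: "tensor_map R ?F ?N f (tensor_rels R (zero_submod ?F) ?N) = tensor_rels R ?F ?N"
      if "f \<in> mod_hom R (zero_submod ?F) ?F" for f by (rule tensor_map_zero[OF F' F Nm that])
    have z2: "tensor_map R (zero_submod ?F) ?N f z = tensor_rels R (zero_submod ?F) ?N"
      if "f \<in> mod_hom R M (zero_submod ?F)" "z \<in> carrier (tensor_mod R M ?N)" "module R M" for f z and M :: "('a, 'a) module"
      using tensor_map_closed[OF that(3) F' Nm that(1,2)] zero_submod_tensor_carrier[OF F Nm] by auto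
    note cd = cx_diff[OF is_complex_two_term[OF F assms(2), of n]]
    show ?thesis
    proof
      assume "acyclic_cplx (tensor_cplx R ?E ?N)"
      note ac = this[unfolded acyclic_cplx_def, rule_format, of n]
      have "{x \<in> carrier (tensor_mod R ?F ?N). tensor_map R ?F ?N (cdiff ?E n) x = tensor_rels R ?F ?N} =
        tensor_map R ?F ?N (cdiff ?E (n + 1)) ` carrier (tensor_mod R (zero_submod ?F) ?N)"
        using ac by (simp add: zero_tensor_mod)
      also have "\<dots> = {tensor_rels R ?F ?N}"
        using z1 cd[of "n + 1"] by (simp add: zero_submod_tensor_carrier[OF F Nm])
      finally have ker: "\<And>x. x \<in> carrier (tensor_mod R ?F ?N) \<Longrightarrow>
        tensor_map R ?F ?N (cdiff ?E n) x = tensor_rels R ?F ?N \<Longrightarrow> x = tensor_rels R ?F ?N" by blast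
      obtain y where y: "y \<in> carrier ?N" "y \<noteq> \<zero>\<^bsub>?N\<^esub>" using residue_field_nonzero[OF assms(1) prime] by blast
      show "a \<notin> P"
      proof
        assume "a \<in> P"
        then have "a \<odot>\<^bsub>?N\<^esub> y = \<zero>\<^bsub>?N\<^esub>" by (rule residue_field_kill[OF assms(1) prime _ y(1)])
        then have "?t y = tensor_rels R ?F ?N"
          using ker[of "?t y"] d[OF y(1)] rt(2)[OF N.zero_closed] y(1) unfolding rt(1) by auto
        then show False using rt(2) y by blast
      qed
    next
      assume "a \<notin> P"
      then have aP: "a \<in> carrier R - P" using assms(2) by auto
      show "acyclic_cplx (tensor_cplx R ?E ?N)"
        unfolding acyclic_cplx_def
      proof
        fix k
        \<comment> \<open>Degree \<open>n\<close> asks for injectivity of \<open>a\<close> on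
          \<open>K(P)\<close> and degree \<open>n - 1\<close> for surjectivity; in the remaining
          degrees the term itself is zero.\<close>
        consider "k = n" | "k = n - 1" | "k \<noteq> n" "k \<noteq> n - 1" by blast
        then show "{x \<in> carrier (cobj (tensor_cplx R ?E ?N) k). cdiff (tensor_cplx R ?E ?N) k x =
            \<zero>\<^bsub>cobj (tensor_cplx R ?E ?N) (k - 1)\<^esub>} =
          cdiff (tensor_cplx R ?E ?N) (k + 1) ` carrier (cobj (tensor_cplx R ?E ?N) (k + 1))"
        proof cases
          case 1
          have "{x \<in> carrier (tensor_mod R ?F ?N). tensor_map R ?F ?N (cdiff ?E n) x = tensor_rels R ?F ?N}
            = {tensor_rels R ?F ?N}"
          proof (intro equalityI subsetI)
            fix x assume "x \<in> {x \<in> carrier (tensor_mod R ?F ?N). tensor_map R ?F ?N (cdiff ?E n) x = tensor_rels R ?F ?N}"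
            then obtain y where y: "y \<in> carrier ?N" "x = ?t y" "?t (a \<odot>\<^bsub>?N\<^esub> y) = tensor_rels R ?F ?N"
              unfolding rt(1) using d by auto
            then have "a \<odot>\<^bsub>?N\<^esub> y = \<zero>\<^bsub>?N\<^esub>" using rt(2) assms(2) by blast
            then have "y = \<zero>\<^bsub>?N\<^esub>" by (rule residue_field_inj[OF assms(1) prime aP y(1)])
            then show "x \<in> {tensor_rels R ?F ?N}" using y rt(2) by blast
          next
            fix x assume "x \<in> {tensor_rels R ?F ?N}"
            then have "x = ?t \<zero>\<^bsub>?N\<^esub>" "?t (a \<odot>\<^bsub>?N\<^esub> \<zero>\<^bsub>?N\<^esub>) = tensor_rels R ?F ?N" using rt(2) assms(2) by auto
            then show "x \<in> {x \<in> carrier (tensor_mod R ?F ?N). tensor_map R ?F ?N (cdiff ?E n) x = tensor_rels R ?F ?N}"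
              unfolding rt(1) using d[OF N.zero_closed] by auto
          qed
          also have "\<dots> = tensor_map R ?F ?N (cdiff ?E (n + 1)) ` carrier (tensor_mod R (zero_submod ?F) ?N)"
            using z1 cd[of "n + 1"] by (simp add: zero_submod_tensor_carrier[OF F Nm])
          finally show ?thesis using 1 by (simp add: zero_tensor_mod)
        next
          case 2
          have "carrier (tensor_mod R ?F ?N) \<subseteq> tensor_map R ?F ?N (cdiff ?E n) ` carrier (tensor_mod R ?F ?N)"
          proof
            fix x assume "x \<in> carrier (tensor_mod R ?F ?N)"
            then obtain y where y: "y \<in> carrier ?N" "x = ?t y" unfolding rt(1) by auto
            then obtain z where z: "z \<in> carrier ?N" "y = a \<odot>\<^bsub>?N\<^esub> z"
              using residue_field_surj[OF assms(1) prime aP] by blast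
            then have "x = tensor_map R ?F ?N (cdiff ?E n) (?t z)" using d y by simp
            then show "x \<in> tensor_map R ?F ?N (cdiff ?E n) ` carrier (tensor_mod R ?F ?N)"
              unfolding rt(1) using z(1) by blast
          qed
          moreover have "tensor_map R ?F ?N (cdiff ?E n) ` carrier (tensor_mod R ?F ?N) \<subseteq> carrier (tensor_mod R ?F ?N)"
            using tensor_map_closed[OF F F Nm] cd[of n] by auto
          moreover have "tensor_map R (zero_submod ?F) ?N (cdiff ?E (n - 1)) x = tensor_rels R (zero_submod ?F) ?N"
            if "x \<in> carrier (tensor_mod R ?F ?N)" for x
            using z2[OF _ that F] cd[of "n - 1"] by simp
          ultimately show ?thesis using 2 by (auto simp: zero_tensor_mod)
        next
          case 3
          let ?Z = "zero_submod ?F"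
          note E = is_complex_two_term[OF F assms(2), of n]
          have e1: "cobj ?E k = ?Z" using 3 by simp
          have e2: "tensor_map R (cobj ?E (k - 1)) ?N (cdiff ?E k) (tensor_rels R (cobj ?E k) ?N) =
            tensor_rels R (cobj ?E (k - 1)) ?N"
            by (rule tensor_map_zero[OF cx_module[OF E] cx_module[OF E] Nm cd])
          have e3: "tensor_map R ?Z ?N (cdiff ?E (k + 1)) x = tensor_rels R ?Z ?N"
            if "x \<in> carrier (tensor_mod R (cobj ?E (k + 1)) ?N)" for x
            by (rule z2[OF _ that cx_module[OF E]]) (use cx_diff_Suc[OF E, of k] e1 in simp)
          have e4: "tensor_rels R (cobj ?E (k + 1)) ?N \<in> carrier (tensor_mod R (cobj ?E (k + 1)) ?N)"
            unfolding carrier_tensor_mod by (rule image_eqI[of _ _ 0]) (auto simp: tcls_0)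
          have "{x \<in> carrier (tensor_mod R (cobj ?E k) ?N). tensor_map R (cobj ?E (k - 1)) ?N (cdiff ?E k) x =
            tensor_rels R (cobj ?E (k - 1)) ?N} = {tensor_rels R ?Z ?N}"
            using e2 unfolding e1 zero_submod_tensor_carrier[OF F Nm] by blast
          moreover have "tensor_map R (cobj ?E k) ?N (cdiff ?E (k + 1)) ` carrier (tensor_mod R (cobj ?E (k + 1)) ?N) =
            {tensor_rels R ?Z ?N}"
            using e3 e4 unfolding e1 by blast
          ultimately show ?thesis
            by (simp only: tensor_cplx_simps zero_tensor_mod add_diff_cancel_right')
        qed
      qed
    qed
  qed
  then show ?thesis unfolding Supp_def by blast
qed

text \<open>In degree \<open>n\<close> the homology after tensoring is \<open>K(P)\<close> itself,
  which never vanishes.\<close>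

lemma Supp_stalk_at:
  fixes R (structure)
  assumes "cring R"
  shows "Supp R (stalk_at (regular_mod R) n) = Spec R"
proof -
  interpret cring R by fact
  let ?F = "regular_mod R"
  let ?E = "stalk_at ?F n"
  have F: "module R ?F" by (rule module_regular[OF assms(1)])
  have "\<not> acyclic_cplx (tensor_cplx R ?E (residue_field_mod R P))" if P: "P \<in> Spec R" for P
  proof
    let ?N = "residue_field_mod R P"
    have prime: "primeideal P R" using P by (simp add: Spec_def)
    have Nm: "module R ?N" by (rule module_residue_field[OF assms(1) prime])
    interpret N: module R ?N by fact
    note F' = module_zero_submod[OF F]
    note rt = regular_tensor_carrier[OF assms(1) Nm] regular_tensor_zero[OF assms(1) Nm]
    let ?t = "\<lambda>y. tcls R ?F ?N (frag_of (\<one>, y))"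
    note cd = cx_diff[OF is_complex_stalk_at[OF F, of n]]
    assume "acyclic_cplx (tensor_cplx R ?E ?N)"
    note ac = this[unfolded acyclic_cplx_def, rule_format, of n]
    have "{x \<in> carrier (tensor_mod R ?F ?N). tensor_map R (zero_submod ?F) ?N (cdiff ?E n) x = tensor_rels R (zero_submod ?F) ?N} =
        tensor_map R ?F ?N (cdiff ?E (n + 1)) ` carrier (tensor_mod R (zero_submod ?F) ?N)"
      using ac by (simp add: zero_tensor_mod)
    also have "\<dots> = {tensor_rels R ?F ?N}"
      using tensor_map_zero[OF F' F Nm] cd[of "n + 1"] by (simp add: zero_submod_tensor_carrier[OF F Nm])
    finally have ker: "\<And>x. x \<in> carrier (tensor_mod R ?F ?N) \<Longrightarrow>
        tensor_map R (zero_submod ?F) ?N (cdiff ?E n) x = tensor_rels R (zero_submod ?F) ?N \<Longrightarrow> x = tensor_rels R ?F ?N" by blast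
    obtain y where y: "y \<in> carrier ?N" "y \<noteq> \<zero>\<^bsub>?N\<^esub>" using residue_field_nonzero[OF assms(1) prime] by blast
    have ty: "?t y \<in> carrier (tensor_mod R ?F ?N)" unfolding rt(1) using y(1) by blast
    have "tensor_map R (zero_submod ?F) ?N (cdiff ?E n) (?t y) = tensor_rels R (zero_submod ?F) ?N"
      using tensor_map_closed[OF F F' Nm _ ty] cd[of n] zero_submod_tensor_carrier[OF F Nm] by auto
    then show False using ker[OF ty] rt(2)[OF y(1)] y(2) by blast
  qed
  then show ?thesis unfolding Supp_def by blast
qed

section \<open>Finitely generated projective modules\<close>

lemma fg_projectiveD:
  assumes "fg_projective R M"
  shows "module R M" "fin_gen_mod R M"
  using assms unfolding fg_projective_def by auto

lemma fg_projective_lift: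
  fixes N L :: "('a, nat \<Rightarrow> 'a) module"
  assumes "fg_projective R M" "module R N" "module R L" "e \<in> mod_hom R N L" "f \<in> mod_hom R M L"
    and "e ` carrier N = carrier L"
  shows "\<exists>g\<in>mod_hom R M N. \<forall>x\<in>carrier M. e (g x) = f x"
  using assms unfolding fg_projective_def by blast

lemma fg_projective_retract:
  assumes "fg_projective R M" "module R M'" "i \<in> mod_hom R M' M" "r \<in> mod_hom R M M'"
    and ri: "\<And>x. x \<in> carrier M' \<Longrightarrow> r (i x) = x"
  shows "fg_projective R M'"
  unfolding fg_projective_def
proof (intro conjI allI ballI impI)
  note M = fg_projectiveD[OF assms(1)]
  interpret M: module R M by fact
  interpret M': module R M' by fact
  show "module R M'" by fact
  obtain A where A: "finite A" "A \<subseteq> carrier M" "\<And>N. submodule N R M \<Longrightarrow> A \<subseteq> N \<Longrightarrow> N = carrier M"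
    using M(2) unfolding fin_gen_mod_def by blast
  show "fin_gen_mod R M'" unfolding fin_gen_mod_def
  proof (intro exI[of _ "r ` A"] conjI allI impI)
    show "finite (r ` A)" "r ` A \<subseteq> carrier M'" using A mod_hom_closed[OF assms(4)] by auto
    fix N assume N: "submodule N R M' \<and> r ` A \<subseteq> N"
    have "{x \<in> carrier M. r x \<in> N} = carrier M"
      by (rule A(3)[OF submodule_vimage[OF M(1) assms(2) assms(4) M.carrier_is_submodule]]) (use N A(2) in auto)
    then have "r x \<in> N" if "x \<in> carrier M" for x using that by blast
    then have "x \<in> N" if "x \<in> carrier M'" for x using that ri mod_hom_closed[OF assms(3)] by metis
    then show "N = carrier M'" using M'.submoduleE(1) N by blast
  qed
  fix N L :: "('a, nat \<Rightarrow> 'a) module" and e f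
  assume e: "e \<in> mod_hom R N L" and f: "f \<in> mod_hom R M' L"
    and a: "module R N \<and> module R L \<and> e ` carrier N = carrier L"
  obtain g where g: "g \<in> mod_hom R M N" "\<And>x. x \<in> carrier M \<Longrightarrow> e (g x) = f (r x)"
    using fg_projective_lift[OF assms(1) _ _ e mod_hom_comp[OF assms(4) f]] a by blast
  show "\<exists>g\<in>mod_hom R M' N. \<forall>x\<in>carrier M'. e (g x) = f x"
    by (rule bexI[OF _ mod_hom_comp[OF assms(3) g(1)]]) (use g(2) ri mod_hom_closed[OF assms(3)] in auto)
qed

lemma fg_projective_zero_submod:
  assumes "fg_projective R M" shows "fg_projective R (zero_submod M)"
proof -
  interpret M: module R M by (rule fg_projectiveD(1)[OF assms])
  show ?thesis
    by (rule fg_projective_retract[OF assms module_zero_submod[OF M.module_axioms], of "\<lambda>x. x" "\<lambda>x. \<zero>\<^bsub>M\<^esub>"])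
      (auto intro!: mod_homI)
qed

text \<open>A copy of \<open>R\<close>, realised by constant functions, among the modules allowed in \<^const>\<open>Dperf\<close>.\<close>

definition rfun :: "('a, 'r) ring_scheme \<Rightarrow> ('a, nat \<Rightarrow> 'a) module" where
  "rfun R = \<lparr>carrier = (\<lambda>x _. x) ` carrier R, monoid.mult = undefined, one = undefined,
     ring.zero = (\<lambda>_. \<zero>\<^bsub>R\<^esub>), ring.add = (\<lambda>f g _. f 0 \<oplus>\<^bsub>R\<^esub> g 0), smult = (\<lambda>r f _. r \<otimes>\<^bsub>R\<^esub> f 0)\<rparr>"

text \<open>The free module of rank \<open>m\<close>, placed on the type that the lifting test in
  \<open>fg_projective\<close> admits.\<close>

definition fmod :: "('a, 'r) ring_scheme \<Rightarrow> nat \<Rightarrow> ('a, nat \<Rightarrow> 'a) module" where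
  "fmod R m = \<lparr>carrier = {f. \<forall>i. f i \<in> carrier R \<and> (m \<le> i \<longrightarrow> f i = \<zero>\<^bsub>R\<^esub>)}, monoid.mult = undefined, one = undefined,
     ring.zero = (\<lambda>_. \<zero>\<^bsub>R\<^esub>), ring.add = (\<lambda>f g i. f i \<oplus>\<^bsub>R\<^esub> g i), smult = (\<lambda>r f i. r \<otimes>\<^bsub>R\<^esub> f i)\<rparr>"

lemma rfun_simps [simp]:
  "carrier (rfun R) = (\<lambda>x _. x) ` carrier R" "ring.zero (rfun R) = (\<lambda>_. \<zero>\<^bsub>R\<^esub>)"
  "ring.add (rfun R) = (\<lambda>f g _. f 0 \<oplus>\<^bsub>R\<^esub> g 0)" "smult (rfun R) = (\<lambda>r f _. r \<otimes>\<^bsub>R\<^esub> f 0)"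
  by (simp_all add: rfun_def)

lemma fmod_simps [simp]:
  "carrier (fmod R m) = {f. \<forall>i. f i \<in> carrier R \<and> (m \<le> i \<longrightarrow> f i = \<zero>\<^bsub>R\<^esub>)}" "ring.zero (fmod R m) = (\<lambda>_. \<zero>\<^bsub>R\<^esub>)"
  "ring.add (fmod R m) = (\<lambda>f g i. f i \<oplus>\<^bsub>R\<^esub> g i)" "smult (fmod R m) = (\<lambda>r f i. r \<otimes>\<^bsub>R\<^esub> f i)"
  by (simp_all add: fmod_def)

section \<open>Embedding projective modules into free modules\<close>

primrec lincomb :: "('a, 'm) module \<Rightarrow> (nat \<Rightarrow> 'm) \<Rightarrow> nat \<Rightarrow> (nat \<Rightarrow> 'a) \<Rightarrow> 'm" where
  "lincomb M v 0 f = \<zero>\<^bsub>M\<^esub>"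
| "lincomb M v (Suc k) f = lincomb M v k f \<oplus>\<^bsub>M\<^esub> f k \<odot>\<^bsub>M\<^esub> v k"

context cring
begin

lemma module_rfun: "module R (rfun R)"
proof (rule moduleI)
  show "abelian_group (rfun R)"
  proof (rule abelian_groupI)
    fix x assume "x \<in> carrier (rfun R)"
    then obtain y where "y \<in> carrier R" "x = (\<lambda>_. y)" by auto
    then show "\<exists>y\<in>carrier (rfun R). y \<oplus>\<^bsub>rfun R\<^esub> x = \<zero>\<^bsub>rfun R\<^esub>"
      by (intro bexI[of _ "\<lambda>_. \<ominus> y"]) (auto simp: l_neg)
  qed (auto simp: a_ac)
qed (auto simp: is_cring l_distr r_distr m_assoc)

lemma mod_hom_const: "(\<lambda>x _. x) \<in> mod_hom R (regular_mod R) (rfun R)"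
  by (rule mod_homI) auto

lemma mod_hom_eval: "(\<lambda>f. f 0) \<in> mod_hom R (rfun R) (regular_mod R)"
  by (rule mod_homI) auto

lemma module_fmod: "module R (fmod R m)"
proof (rule moduleI)
  show "abelian_group (fmod R m)"
  proof (rule abelian_groupI)
    fix x assume "x \<in> carrier (fmod R m)"
    then show "\<exists>y\<in>carrier (fmod R m). y \<oplus>\<^bsub>fmod R m\<^esub> x = \<zero>\<^bsub>fmod R m\<^esub>"
      by (intro bexI[of _ "\<lambda>i. \<ominus> x i"]) (auto simp: l_neg a_inv_zero)
  qed (auto simp: a_ac)
qed (auto simp: is_cring l_distr r_distr m_assoc)

lemma fg_projective_regular: "fg_projective R (regular_mod R)"
  unfolding fg_projective_def
proof (intro conjI allI ballI impI)
  show F: "module R (regular_mod R)" by (rule module_regular[OF is_cring])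
  interpret F: module R "regular_mod R" by (rule F)
  show "fin_gen_mod R (regular_mod R)" unfolding fin_gen_mod_def
  proof (intro exI[of _ "{\<one>}"] conjI allI impI)
    fix N assume N: "submodule N R (regular_mod R) \<and> {\<one>} \<subseteq> N"
    have "x \<in> N" if "x \<in> carrier R" for x
      using F.submoduleE(4)[of N x \<one>] N that by auto
    then show "N = carrier (regular_mod R)" using F.submoduleE(1) N by auto
  qed auto
  fix N L :: "('a, nat \<Rightarrow> 'a) module" and e f
  assume e: "e \<in> mod_hom R N L" and f: "f \<in> mod_hom R (regular_mod R) L"
    and a: "module R N \<and> module R L \<and> e ` carrier N = carrier L"
  interpret N: module R N using a by blast
  have "f \<one> \<in> carrier L" using mod_hom_closed[OF f] by simp
  then have "f \<one> \<in> e ` carrier N" using a by simp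
  then obtain n where n: "n \<in> carrier N" "e n = f \<one>" by auto
  show "\<exists>g\<in>mod_hom R (regular_mod R) N. \<forall>x\<in>carrier (regular_mod R). e (g x) = f x"
  proof (rule bexI[of _ "\<lambda>r. r \<odot>\<^bsub>N\<^esub> n"])
    show "\<forall>x\<in>carrier (regular_mod R). e (x \<odot>\<^bsub>N\<^esub> n) = f x"
    proof
      fix x assume x: "x \<in> carrier (regular_mod R)"
      have "f x = f (x \<otimes> \<one>)" using x by simp
      also have "\<dots> = x \<odot>\<^bsub>L\<^esub> f \<one>" using mod_hom_smult[OF f, of x \<one>] x by simp
      finally show "e (x \<odot>\<^bsub>N\<^esub> n) = f x" using mod_hom_smult[OF e _ n(1), of x] x n(2) by simp
    qed
  qed (rule mod_homI, use n in \<open>auto simp: N.smult_l_distr N.smult_assoc1\<close>)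
qed

lemma fg_projective_rfun: "fg_projective R (rfun R)"
  by (rule fg_projective_retract[OF fg_projective_regular module_rfun mod_hom_eval mod_hom_const]) auto

context
  fixes M :: "('a, 'm) module" and v :: "nat \<Rightarrow> 'm" and m :: nat
  assumes M: "module R M" and v: "\<And>i. i < m \<Longrightarrow> v i \<in> carrier M"
begin

interpretation M: module R M by (rule M)

lemma lincomb_closed: "f \<in> carrier (fmod R m) \<Longrightarrow> k \<le> m \<Longrightarrow> lincomb M v k f \<in> carrier M"
  by (induction k) (use v in auto)

lemma lincomb_hom: "k \<le> m \<Longrightarrow> lincomb M v k \<in> mod_hom R (fmod R m) M"
proof (rule mod_homI)
  assume k: "k \<le> m"
  show "lincomb M v k f \<in> carrier M" if "f \<in> carrier (fmod R m)" for f using lincomb_closed[OF that k] .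
  show "lincomb M v k (f \<oplus>\<^bsub>fmod R m\<^esub> g) = lincomb M v k f \<oplus>\<^bsub>M\<^esub> lincomb M v k g"
    if fg: "f \<in> carrier (fmod R m)" "g \<in> carrier (fmod R m)" for f g
    using k
  proof (induction k)
    case (Suc k)
    then show ?case using fg v[of k] lincomb_closed[OF fg(1), of k] lincomb_closed[OF fg(2), of k]
      by (simp add: M.smult_l_distr M.a_ac)
  qed simp
  show "lincomb M v k (r \<odot>\<^bsub>fmod R m\<^esub> f) = r \<odot>\<^bsub>M\<^esub> lincomb M v k f"
    if rf: "r \<in> carrier R" "f \<in> carrier (fmod R m)" for r f
    using k
  proof (induction k)
    case (Suc k)
    then show ?case using rf v[of k] lincomb_closed[OF rf(2), of k]
      by (simp add: M.smult_r_distr M.smult_assoc1)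
  qed (use rf in simp)
qed

lemma lincomb_unit:
  "j < m \<Longrightarrow> k \<le> m \<Longrightarrow> lincomb M v k (\<lambda>i. if i = j then \<one> else \<zero>) = (if j < k then v j else \<zero>\<^bsub>M\<^esub>)"
  by (induction k) (use v in \<open>auto simp: less_Suc_eq\<close>)

lemma lincomb_cong: "(\<And>i. i < k \<Longrightarrow> f i = g i) \<Longrightarrow> lincomb M v k f = lincomb M v k g"
  by (induction k) auto

end

lemma fin_gen_lincomb:
  assumes "module R M" "fin_gen_mod R M"
  obtains m v where "\<And>i. i < m \<Longrightarrow> v i \<in> carrier M" "lincomb M v m ` carrier (fmod R m) = carrier M"
proof -
  interpret M: module R M by fact
  obtain A where A: "finite A" "A \<subseteq> carrier M" "\<And>N. submodule N R M \<Longrightarrow> A \<subseteq> N \<Longrightarrow> N = carrier M"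
    using assms(2) unfolding fin_gen_mod_def by blast
  obtain m :: nat and v where v: "A = v ` {i. i < m}"
    using A(1) unfolding finite_conv_nat_seg_image by blast
  have vM: "v i \<in> carrier M" if "i < m" for i using v A(2) that by auto
  interpret F: module R "fmod R m" by (rule module_fmod)
  have "submodule (lincomb M v m ` carrier (fmod R m)) R M"
    by (rule submodule_image[OF module_fmod assms(1) lincomb_hom[OF assms(1) vM order_refl] F.carrier_is_submodule])
  moreover have "v j \<in> lincomb M v m ` carrier (fmod R m)" if "j < m" for j
    using lincomb_unit[OF assms(1) vM that order_refl] that
    by (intro image_eqI[of _ _ "\<lambda>i. if i = j then \<one> else \<zero>"]) auto
  ultimately have "lincomb M v m ` carrier (fmod R m) = carrier M" using A(3) v by blast
  then show ?thesis using that vM by blast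
qed

text \<open>Lifting the identity of \<open>M\<close> against a surjection from the free module
  splits it. \<open>M\<close> plays the part of the target \<open>L\<close> in the test, hence its
  restricted type.\<close>

lemma fg_projective_embed:
  fixes M :: "('a, nat \<Rightarrow> 'a) module"
  assumes "fg_projective R M"
  obtains m g e where "g \<in> mod_hom R M (fmod R m)" "e \<in> mod_hom R (fmod R m) M"
    "\<And>x. x \<in> carrier M \<Longrightarrow> e (g x) = x"
proof -
  note M = fg_projectiveD[OF assms]
  obtain m v where v: "\<And>i. i < m \<Longrightarrow> v i \<in> carrier M" "lincomb M v m ` carrier (fmod R m) = carrier M"
    using fin_gen_lincomb[OF M] by blast
  have e: "lincomb M v m \<in> mod_hom R (fmod R m) M" by (rule lincomb_hom[OF M(1) v(1) order_refl])
  obtain g where "g \<in> mod_hom R M (fmod R m)" "\<And>x. x \<in> carrier M \<Longrightarrow> lincomb M v m (g x) = x"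
    using fg_projective_lift[OF assms module_fmod M(1) e mod_hom_id v(2)] by blast
  then show ?thesis using that e by blast
qed

lemma coordinate_hom:
  assumes "g \<in> mod_hom R M (fmod R m)"
  shows "(\<lambda>x. g x i) \<in> mod_hom R M (regular_mod R)"
  by (rule mod_homI) (use mod_homD[OF assms] in auto)

text \<open>The coordinates of an embedding into a free module are functionals, and together they
  separate points.\<close>

lemma fg_projective_dual_nonzero:
  fixes M :: "('a, nat \<Rightarrow> 'a) module"
  assumes "fg_projective R M" "z \<in> carrier M" "z \<noteq> \<zero>\<^bsub>M\<^esub>"
  shows "\<exists>\<phi>\<in>mod_hom R M (regular_mod R). \<phi> z \<noteq> \<zero>"
proof (rule ccontr)
  note M = fg_projectiveD(1)[OF assms(1)]
  assume a: "\<not> ?thesis"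
  obtain m g e where ge: "g \<in> mod_hom R M (fmod R m)" "e \<in> mod_hom R (fmod R m) M"
    "\<And>x. x \<in> carrier M \<Longrightarrow> e (g x) = x"
    by (rule fg_projective_embed[OF assms(1)]) (rule that)
  have nz: "\<phi> z = \<zero>" if "\<phi> \<in> mod_hom R M (regular_mod R)" for \<phi> using a that by blast
  have "g z i = \<zero>" for i using nz[OF coordinate_hom[OF ge(1), of i]] .
  then have "g z = (\<lambda>_. \<zero>)" by (rule ext)
  then have "z = e \<zero>\<^bsub>fmod R m\<^esub>" using ge(3)[OF assms(2)] by simp
  then show False using mod_hom_zero[OF module_fmod M ge(2)] assms(3) by simp
qed

text \<open>Divide the coordinates of \<open>z\<close> by \<open>a\<close> inside the free module
  and map the quotient back to \<open>M\<close> by the retraction \<open>e\<close>.\<close>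

lemma fg_projective_dual_divides:
  fixes M :: "('a, nat \<Rightarrow> 'a) module"
  assumes "fg_projective R M" "z \<in> carrier M" "a \<in> carrier R"
    and "\<And>\<phi>. \<phi> \<in> mod_hom R M (regular_mod R) \<Longrightarrow> \<exists>c\<in>carrier R. \<phi> z = a \<otimes> c"
  shows "\<exists>w\<in>carrier M. z = a \<odot>\<^bsub>M\<^esub> w"
proof -
  obtain m g e where ge: "g \<in> mod_hom R M (fmod R m)" "e \<in> mod_hom R (fmod R m) M"
    "\<And>x. x \<in> carrier M \<Longrightarrow> e (g x) = x"
    by (rule fg_projective_embed[OF assms(1)]) (rule that)
  have "\<forall>i. \<exists>c. c \<in> carrier R \<and> g z i = a \<otimes> c"
  proof
    fix i show "\<exists>c. c \<in> carrier R \<and> g z i = a \<otimes> c"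
      using assms(4)[OF coordinate_hom[OF ge(1), of i]] by blast
  qed
  from choice[OF this] obtain c where c: "\<And>i. c i \<in> carrier R" "\<And>i. g z i = a \<otimes> c i" by blast
  \<comment> \<open>Beyond \<open>m\<close> the coordinates of \<open>g z\<close> vanish, but the
    chosen quotients \<open>c i\<close> are arbitrary there; truncation puts \<open>w\<close> into
    the free module.\<close>
  define w where "w i = (if i < m then c i else \<zero>)" for i
  have w: "w \<in> carrier (fmod R m)" unfolding w_def using c by auto
  have gz: "g z i = \<zero>" if "m \<le> i" for i using mod_hom_closed[OF ge(1) assms(2)] that by auto
  have "g z = a \<odot>\<^bsub>fmod R m\<^esub> w"
  proof
    fix i show "g z i = (a \<odot>\<^bsub>fmod R m\<^esub> w) i"
      using c(2)[of i] gz[of i] assms(3) by (auto simp: w_def)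
  qed
  then have "z = a \<odot>\<^bsub>M\<^esub> e w"
    using ge(3)[OF assms(2)] mod_hom_smult[OF ge(2) assms(3) w] by simp
  then show ?thesis using mod_hom_closed[OF ge(2) w] by blast
qed

end

context domain
begin

lemma fg_projective_torsionfree:
  fixes M :: "('a, nat \<Rightarrow> 'a) module"
  assumes "fg_projective R M" "z \<in> carrier M" "a \<in> carrier R" "a \<noteq> \<zero>" "a \<odot>\<^bsub>M\<^esub> z = \<zero>\<^bsub>M\<^esub>"
  shows "z = \<zero>\<^bsub>M\<^esub>"
proof (rule ccontr)
  assume "z \<noteq> \<zero>\<^bsub>M\<^esub>"
  then obtain \<phi> where \<phi>: "\<phi> \<in> mod_hom R M (regular_mod R)" "\<phi> z \<noteq> \<zero>"
    using fg_projective_dual_nonzero[OF assms(1,2)] by blast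
  have "a \<otimes> \<phi> z = \<phi> \<zero>\<^bsub>M\<^esub>" using mod_hom_smult[OF \<phi>(1) assms(3,2)] assms(5) by simp
  also have "\<dots> = \<zero>"
    using mod_hom_zero[OF fg_projectiveD(1)[OF assms(1)] module_regular[OF is_cring] \<phi>(1)] by simp
  finally show False using \<phi>(2) assms(3,4) mod_hom_closed[OF \<phi>(1) assms(2)] by (simp add: integral_iff)
qed

end

section \<open>Smith normal form over a principal ideal domain\<close>

context principal_domain
begin

text \<open>Proper division on nonzero elements is well-founded. In terms of ideals,
  \<open>(a)\<close> is maximal among the ideals \<open>(c)\<close> with
  \<open>c \<in> D\<close>.\<close>

lemma divisor_minimal:
  assumes "D \<subseteq> carrier R - {\<zero>}" "D \<noteq> {}"
  obtains a where "a \<in> D" "\<And>c s. c \<in> D \<Longrightarrow> s \<in> carrier R \<Longrightarrow> a = c \<otimes> s \<Longrightarrow> \<exists>t\<in>carrier R. c = a \<otimes> t"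
proof -
  let ?r = "{(x, y). x \<in> carrier (mult_of R) \<and> y \<in> carrier (mult_of R) \<and> properfactor (mult_of R) x y}"
  have w: "wf ?r" by (rule mult_of.division_wellfounded)
  obtain d where d: "d \<in> D" using assms(2) by blast
  obtain a where a: "a \<in> D" "\<And>y. (y, a) \<in> ?r \<Longrightarrow> y \<notin> D"
    by (rule wfE_min[OF w d]) (rule that, assumption, blast)
  show ?thesis
  proof (rule that[OF a(1)])
    fix c s assume c: "c \<in> D" "s \<in> carrier R" "a = c \<otimes> s"
    have "c \<in> carrier R" "a \<in> carrier R - {\<zero>}" using c(1) a(1) assms(1) by auto
    then have "s \<noteq> \<zero>" using c(3) by auto
    then have "c divides\<^bsub>mult_of R\<^esub> a" using c by (auto simp: factor_def)
    moreover have "(c, a) \<notin> ?r" using a(2) c(1) by blast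
    ultimately have "a divides\<^bsub>mult_of R\<^esub> c"
      using a(1) c(1) assms(1) by (auto simp: properfactor_def)
    then show "\<exists>t\<in>carrier R. c = a \<otimes> t" by (auto simp: factor_def)
  qed
qed

lemma gcd_combination:
  assumes "a \<in> carrier R" "b \<in> carrier R"
  obtains u v c s t where "u \<in> carrier R" "v \<in> carrier R" "s \<in> carrier R" "t \<in> carrier R" "c \<in> carrier R"
    "c = u \<otimes> a \<oplus> v \<otimes> b" "a = c \<otimes> s" "b = c \<otimes> t"
proof -
  let ?I = "PIdl a <+>\<^bsub>R\<^esub> PIdl b"
  have "ideal ?I R" by (intro add_ideals cgenideal_ideal assms)
  then obtain c where c: "c \<in> carrier R" "?I = PIdl c" using exists_gen by blast
  have mem: "x \<in> ?I \<longleftrightarrow> (\<exists>u\<in>carrier R. \<exists>v\<in>carrier R. x = u \<otimes> a \<oplus> v \<otimes> b)" for x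
    by (auto simp: set_add_def' cgenideal_def)
  have "c \<in> ?I" unfolding c(2) using c(1) by (rule cgenideal_self)
  then obtain u v where uv: "u \<in> carrier R" "v \<in> carrier R" "c = u \<otimes> a \<oplus> v \<otimes> b" using mem by blast
  have "a = \<one> \<otimes> a \<oplus> \<zero> \<otimes> b" "b = \<zero> \<otimes> a \<oplus> \<one> \<otimes> b" using assms by auto
  then have "a \<in> ?I" "b \<in> ?I" using mem by blast+
  then obtain s t where "s \<in> carrier R" "t \<in> carrier R" "a = s \<otimes> c" "b = t \<otimes> c"
    unfolding c(2) by (auto simp: cgenideal_def)
  then show ?thesis using that[OF uv(1,2)] uv c(1) by (metis m_comm)
qed

text \<open>Smith normal form without bases: choose \<open>\<phi>\<close> and \<open>x\<close> such that \<open>\<phi> (d x)\<close> generates a maximal ideal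
  of this kind; the corresponding entry then splits off.\<close>

lemma split_entry:
  fixes M N :: "('a, nat \<Rightarrow> 'a) module"
  assumes "fg_projective R M" "fg_projective R N" "d \<in> mod_hom R M N"
    and "x0 \<in> carrier M" "d x0 \<noteq> \<zero>\<^bsub>N\<^esub>"
  obtains a x y \<phi> \<psi> where "a \<in> carrier R" "a \<noteq> \<zero>" "x \<in> carrier M" "y \<in> carrier N"
    "\<phi> \<in> mod_hom R N (regular_mod R)" "\<psi> \<in> mod_hom R M (regular_mod R)"
    "d x = a \<odot>\<^bsub>N\<^esub> y" "\<phi> y = \<one>" "\<psi> x = \<one>" "\<And>z. z \<in> carrier M \<Longrightarrow> \<phi> (d z) = a \<otimes> \<psi> z"
proof -
  note M = fg_projectiveD(1)[OF assms(1)] and N = fg_projectiveD(1)[OF assms(2)]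
  interpret M: module R M by fact
  interpret N: module R N by fact
  have F: "module R (regular_mod R)" by (rule module_regular[OF is_cring])
  note d = mod_homD[OF assms(3)]
  define D where "D = {\<phi> (d x) |\<phi> x. \<phi> \<in> mod_hom R N (regular_mod R) \<and> x \<in> carrier M} - {\<zero>}"
  have DI: "\<chi> (d z) \<in> D"
    if "\<chi> \<in> mod_hom R N (regular_mod R)" "z \<in> carrier M" "\<chi> (d z) \<noteq> \<zero>" for \<chi> z
    unfolding D_def using that by blast
  have "D \<subseteq> carrier R - {\<zero>}" unfolding D_def using mod_hom_closed d by fastforce
  moreover obtain \<phi>0 where "\<phi>0 \<in> mod_hom R N (regular_mod R)" "\<phi>0 (d x0) \<noteq> \<zero>"
    using fg_projective_dual_nonzero[OF assms(2) _ assms(5)] d(1)[OF assms(4)] by blast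
  then have "\<phi>0 (d x0) \<in> D" unfolding D_def using assms(4) by blast
  then have "D \<noteq> {}" by blast
  ultimately obtain a where a: "a \<in> D" "\<And>c s. c \<in> D \<Longrightarrow> s \<in> carrier R \<Longrightarrow> a = c \<otimes> s \<Longrightarrow> \<exists>t\<in>carrier R. c = a \<otimes> t"
    using divisor_minimal by metis
  then obtain \<phi> x where \<phi>: "\<phi> \<in> mod_hom R N (regular_mod R)" "x \<in> carrier M" "a = \<phi> (d x)"
    unfolding D_def by blast
  have aR: "a \<in> carrier R" "a \<noteq> \<zero>" using a(1) \<open>D \<subseteq> carrier R - {\<zero>}\<close> by auto
  note \<phi>c = mod_homD[OF \<phi>(1)]
  have div1: "\<exists>c\<in>carrier R. \<phi>' (d x) = a \<otimes> c" if \<phi>': "\<phi>' \<in> mod_hom R N (regular_mod R)" for \<phi>'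
  proof -
    note p = mod_homD[OF \<phi>']
    have bR: "\<phi>' (d x) \<in> carrier R" using p(1) d(1)[OF \<phi>(2)] by simp
    obtain u v c s t where
      g: "u \<in> carrier R" "v \<in> carrier R" "s \<in> carrier R" "t \<in> carrier R" "c \<in> carrier R"
      "c = u \<otimes> a \<oplus> v \<otimes> \<phi>' (d x)" "a = c \<otimes> s" "\<phi>' (d x) = c \<otimes> t"
      by (rule gcd_combination[OF aR(1) bR]) (rule that)
    \<comment> \<open>The gcd \<open>c\<close> of \<open>a\<close> and \<open>\<phi>' (d x)\<close>
      is again a value at \<open>d x\<close>, namely of this combined functional. Minimality makes
      \<open>a\<close> divide \<open>c\<close>, hence \<open>\<phi>' (d x)\<close>.\<close>
    let ?\<chi> = "\<lambda>z. u \<odot>\<^bsub>regular_mod R\<^esub> \<phi> z \<oplus>\<^bsub>regular_mod R\<^esub> v \<odot>\<^bsub>regular_mod R\<^esub> \<phi>' z"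
    have "?\<chi> \<in> mod_hom R N (regular_mod R)"
      by (intro mod_hom_plus[OF N F] mod_hom_comp[OF \<phi>(1)] mod_hom_comp[OF \<phi>'] mod_hom_scale[OF F] g)
    moreover have "c = ?\<chi> (d x)" using g(6) \<phi>(3) by simp
    moreover have "c \<noteq> \<zero>" using g(3,5,7) aR by auto
    ultimately have "c \<in> D" using DI[of ?\<chi> x, OF _ \<phi>(2)] by metis
    then obtain t' where "t' \<in> carrier R" "c = a \<otimes> t'" using a(2) g(3,7) by blast
    then show ?thesis using g(4,8) aR(1) by (intro bexI[of _ "t' \<otimes> t"]) (auto simp: m_assoc)
  qed
  have div2: "\<exists>c\<in>carrier R. \<phi> (d z) = a \<otimes> c" if z: "z \<in> carrier M" for z
  proof -
    have bR: "\<phi> (d z) \<in> carrier R" using \<phi>c(1) d(1)[OF z] by simp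
    obtain u v c s t where
      g: "u \<in> carrier R" "v \<in> carrier R" "s \<in> carrier R" "t \<in> carrier R" "c \<in> carrier R"
      "c = u \<otimes> a \<oplus> v \<otimes> \<phi> (d z)" "a = c \<otimes> s" "\<phi> (d z) = c \<otimes> t"
      by (rule gcd_combination[OF aR(1) bR]) (rule that)
    \<comment> \<open>Dually, for the fixed \<open>\<phi>\<close> the gcd is attained at a
      combination of the vectors \<open>x\<close> and \<open>z\<close>.\<close>
    have "\<phi> (d (u \<odot>\<^bsub>M\<^esub> x \<oplus>\<^bsub>M\<^esub> v \<odot>\<^bsub>M\<^esub> z)) = c"
      using g(1,2,6) \<phi>(2,3) z d \<phi>c by simp
    moreover have "c \<noteq> \<zero>" using g(3,5,7) aR by auto
    moreover have "u \<odot>\<^bsub>M\<^esub> x \<oplus>\<^bsub>M\<^esub> v \<odot>\<^bsub>M\<^esub> z \<in> carrier M" using g(1,2) \<phi>(2) z by simp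
    ultimately have "c \<in> D" using DI[OF \<phi>(1)] by metis
    then obtain t' where "t' \<in> carrier R" "c = a \<otimes> t'" using a(2) g(3,7) by blast
    then show ?thesis using g(4,8) aR(1) by (intro bexI[of _ "t' \<otimes> t"]) (auto simp: m_assoc)
  qed
  \<comment> \<open>By \<open>div1\<close> all functionals take values divisible by \<open>a\<close>
    at \<open>d x\<close>, so \<open>d x\<close> itself is divisible by \<open>a\<close>.\<close>
  have "\<exists>y\<in>carrier N. d x = a \<odot>\<^bsub>N\<^esub> y"
    by (rule fg_projective_dual_divides[OF assms(2) d(1)[OF \<phi>(2)] aR(1)]) (rule div1)
  then obtain y where y: "y \<in> carrier N" "d x = a \<odot>\<^bsub>N\<^esub> y" by blast
  have "\<forall>z\<in>carrier M. \<exists>c\<in>carrier R. \<phi> (d z) = a \<otimes> c" using div2 by blast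
  \<comment> \<open>\<open>\<psi>\<close> is \<open>\<phi> \<circ> d\<close> divided by
    \<open>a\<close>. The quotient is unique in a domain, which makes \<open>\<psi>\<close>
    linear.\<close>
  then obtain \<psi> where \<psi>: "\<And>z. z \<in> carrier M \<Longrightarrow> \<psi> z \<in> carrier R" "\<And>z. z \<in> carrier M \<Longrightarrow> \<phi> (d z) = a \<otimes> \<psi> z"
    by metis
  have cancel: "b = c" if "a \<otimes> b = a \<otimes> c" "b \<in> carrier R" "c \<in> carrier R" for b c
    using that aR m_lcancel by blast
  have "\<psi> \<in> mod_hom R M (regular_mod R)"
  proof (rule mod_homI)
    show "\<psi> z \<in> carrier (regular_mod R)" if "z \<in> carrier M" for z using \<psi>(1)[OF that] by simp
    show "\<psi> (z \<oplus>\<^bsub>M\<^esub> w) = \<psi> z \<oplus>\<^bsub>regular_mod R\<^esub> \<psi> w" if zw: "z \<in> carrier M" "w \<in> carrier M" for z w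
    proof (rule cancel)
      have "a \<otimes> \<psi> (z \<oplus>\<^bsub>M\<^esub> w) = \<phi> (d (z \<oplus>\<^bsub>M\<^esub> w))" using \<psi>(2) zw by simp
      also have "\<dots> = a \<otimes> \<psi> z \<oplus> a \<otimes> \<psi> w" using zw d \<phi>c \<psi>(2) by simp
      finally show "a \<otimes> \<psi> (z \<oplus>\<^bsub>M\<^esub> w) = a \<otimes> (\<psi> z \<oplus>\<^bsub>regular_mod R\<^esub> \<psi> w)" using zw \<psi>(1) aR by (simp add: r_distr)
    qed (use zw \<psi>(1) in auto)
    show "\<psi> (r \<odot>\<^bsub>M\<^esub> z) = r \<odot>\<^bsub>regular_mod R\<^esub> \<psi> z" if rz: "r \<in> carrier R" "z \<in> carrier M" for r z
    proof (rule cancel)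
      have "a \<otimes> \<psi> (r \<odot>\<^bsub>M\<^esub> z) = \<phi> (d (r \<odot>\<^bsub>M\<^esub> z))" using \<psi>(2) rz by simp
      also have "\<dots> = r \<otimes> (a \<otimes> \<psi> z)" using rz d \<phi>c \<psi>(2) by simp
      finally show "a \<otimes> \<psi> (r \<odot>\<^bsub>M\<^esub> z) = a \<otimes> (r \<odot>\<^bsub>regular_mod R\<^esub> \<psi> z)" using rz \<psi>(1) aR by (simp add: m_lcomm)
    qed (use rz \<psi>(1) in auto)
  qed
  moreover have "\<psi> x = \<one>"
    by (rule cancel) (use \<psi>[OF \<phi>(2)] \<phi>(3) aR in auto)
  moreover have "\<phi> y = \<one>"
  proof (rule cancel)
    have "a = a \<otimes> \<phi> y" using \<phi>(3) y \<phi>c(3)[OF aR(1) y(1)] by simp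
    then show "a \<otimes> \<phi> y = a \<otimes> \<one>" using aR by simp
  qed (use \<phi>c(1)[OF y(1)] in auto)
  ultimately show ?thesis using that[OF aR \<phi>(2) y(1) \<phi>(1)] y(2) \<psi>(2) by blast
qed

end

section \<open>Splitting off elementary complexes\<close>

text \<open>The complementary summand, realised as the kernel of the retraction inside
  \<open>W\<close> rather than as a quotient; it therefore keeps the type of
  \<open>W\<close>.\<close>

definition compl_cplx ::
  "('a, 'm) cplx \<Rightarrow> ('a, 'n) cplx \<Rightarrow> (int \<Rightarrow> 'n \<Rightarrow> 'm) \<Rightarrow> ('a, 'n) cplx" where
  "compl_cplx E W r = \<lparr>cobj = (\<lambda>n. (cobj W n)\<lparr>carrier := {x \<in> carrier (cobj W n). r n x = \<zero>\<^bsub>cobj E n\<^esub>}\<rparr>),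
     cdiff = cdiff W\<rparr>"

lemma compl_cplx_simps [simp]:
  "carrier (cobj (compl_cplx E W r) n) = {x \<in> carrier (cobj W n). r n x = \<zero>\<^bsub>cobj E n\<^esub>}"
  "ring.zero (cobj (compl_cplx E W r) n) = ring.zero (cobj W n)"
  "ring.add (cobj (compl_cplx E W r) n) = ring.add (cobj W n)"
  "smult (cobj (compl_cplx E W r) n) = smult (cobj W n)"
  "cdiff (compl_cplx E W r) n = cdiff W n"
  by (simp_all add: compl_cplx_def)

locale cplx_split =
  fixes R :: "('a, 'r) ring_scheme" and E :: "('a, 'm) cplx" and W :: "('a, 'n) cplx" and i r
  assumes E: "is_complex R E" and W: "is_complex R W"
    and i: "chain_map R E W i" and r: "chain_map R W E r"
    and ri: "\<And>n x. x \<in> carrier (cobj E n) \<Longrightarrow> r n (i n x) = x"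
begin

abbreviation "C \<equiv> compl_cplx E W r"

sublocale E: module R "cobj E m" for m by (rule cx_module[OF E])
sublocale W: module R "cobj W m" for m by (rule cx_module[OF W])

lemmas i_simps = mod_homD[OF chain_map_hom[OF i]] mod_hom_zero[OF E.module_axioms W.module_axioms chain_map_hom[OF i]]
  mod_hom_minus[OF E.module_axioms W.module_axioms chain_map_hom[OF i]]
lemmas r_simps = mod_homD[OF chain_map_hom[OF r]] mod_hom_zero[OF W.module_axioms E.module_axioms chain_map_hom[OF r]]
  mod_hom_minus[OF W.module_axioms E.module_axioms chain_map_hom[OF r]]
lemmas dE_simps = mod_homD[OF cx_diff[OF E]] mod_hom_zero[OF E.module_axioms E.module_axioms cx_diff[OF E]]
  mod_hom_minus[OF E.module_axioms E.module_axioms cx_diff[OF E]]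
lemmas dW_simps = mod_homD[OF cx_diff[OF W]] mod_hom_zero[OF W.module_axioms W.module_axioms cx_diff[OF W]]
  mod_hom_minus[OF W.module_axioms W.module_axioms cx_diff[OF W]]

lemma submodule_compl: "submodule {x \<in> carrier (cobj W n). r n x = \<zero>\<^bsub>cobj E n\<^esub>} R (cobj W n)"
  using submodule_vimage[OF W.module_axioms E.module_axioms chain_map_hom[OF r] W.carrier_is_submodule
      submodule_zero[OF E.module_axioms]] by simp

lemma module_compl: "module R (cobj C n)"
  using submodule.submodule_is_module[OF submodule_compl W.module_axioms] by (simp add: compl_cplx_def)

lemma is_complex_compl: "is_complex R C"
  unfolding is_complex_def
proof (intro allI conjI ballI)
  fix n
  show "module R (cobj C n)" by (rule module_compl)
  show "cdiff C n \<in> mod_hom R (cobj C n) (cobj C (n - 1))"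
    by (rule mod_homI) (auto simp: dW_simps chain_map_comm[OF r, symmetric] dE_simps)
  show "cdiff C (n - 1) (cdiff C n x) = \<zero>\<^bsub>cobj C (n - 2)\<^esub>" if "x \<in> carrier (cobj C n)" for x
    using that cx_dd[OF W] by simp
qed

lemma incl_compl: "chain_map R C W (\<lambda>n x. x)"
  by (rule chain_mapI) (auto intro!: mod_homI)

definition proj where "proj n x = x \<ominus>\<^bsub>cobj W n\<^esub> i n (r n x)"

lemma proj_closed: "x \<in> carrier (cobj W n) \<Longrightarrow> proj n x \<in> carrier (cobj C n)"
  unfolding proj_def by (simp add: r_simps i_simps ri a_minus_def E.r_neg)

lemma proj_hom: "proj n \<in> mod_hom R (cobj W n) (cobj C n)"
proof -
  have "(\<lambda>x. x \<ominus>\<^bsub>cobj W n\<^esub> i n (r n x)) \<in> mod_hom R (cobj W n) (cobj W n)"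
    by (intro mod_hom_minus_fun W.module_axioms mod_hom_id mod_hom_comp[OF chain_map_hom[OF r] chain_map_hom[OF i]])
  then have "proj n \<in> mod_hom R (cobj W n) (cobj W n)" by (simp add: proj_def[abs_def])
  from mod_homD[OF this] proj_closed show ?thesis by (intro mod_homI) auto
qed

lemma proj_chain_map: "chain_map R W C proj"
proof (rule chain_mapI)
  fix n x assume x: "x \<in> carrier (cobj W n)"
  have "cdiff W n (i n (r n x)) = i (n - 1) (r (n - 1) (cdiff W n x))"
    using x by (simp add: chain_map_comm[OF i] chain_map_comm[OF r] r_simps)
  then show "cdiff C n (proj n x) = proj (n - 1) (cdiff W n x)"
    unfolding proj_def using x by (simp add: dW_simps i_simps r_simps a_minus_def)
qed (rule proj_hom)

lemma proj_ident: "x \<in> carrier (cobj C n) \<Longrightarrow> proj n x = x"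
  unfolding proj_def by (simp add: i_simps a_minus_def W.a_inv_zero)

lemma retract_compl: "cx_retract R C W"
  unfolding cx_retract_def using incl_compl proj_chain_map proj_ident by blast

lemma retract_E: "cx_retract R E W"
  unfolding cx_retract_def using i r ri by blast

lemma perfect_compl:
  assumes "perfect_cplx R W"
  shows "perfect_cplx R C"
  unfolding perfect_cplx_def
proof (intro conjI allI)
  show "is_complex R C" by (rule is_complex_compl)
  show "fg_projective R (cobj C n)" for n
    by (rule fg_projective_retract[OF _ module_compl chain_map_hom[OF incl_compl] proj_hom proj_ident])
      (use assms in \<open>auto simp: perfect_cplx_def\<close>)
  obtain N where N: "\<And>n. N < \<bar>n\<bar> \<Longrightarrow> carrier (cobj W n) = {\<zero>\<^bsub>cobj W n\<^esub>}"
    using assms unfolding perfect_cplx_def by blast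
  show "\<exists>N. \<forall>n. N < \<bar>n\<bar> \<longrightarrow> carrier (cobj C n) = {\<zero>\<^bsub>cobj C n\<^esub>}"
    by (rule exI[of _ N]) (use N in \<open>auto simp: r_simps\<close>)
qed

text \<open>The cone of a split inclusion is its complement: the homotopy
  \<open>(e, w) \<mapsto> (- r w, 0)\<close> contracts \<open>E\<close> against its copy in
  \<open>W\<close>. This turns a direct sum into a triangle, and so into a relation in the
  Grothendieck group.\<close>

lemma cone_compl: "homotopy_isomorphic R C (mapping_cone E W i)"
proof -
  let ?K = "mapping_cone E W i"
  have K: "is_complex R ?K" by (rule is_complex_cone[OF E W i])
  let ?c = "\<lambda>n x. (\<zero>\<^bsub>cobj E (n - 1)\<^esub>, x)" and ?g = "\<lambda>n z. proj n (snd z)"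
  have c: "chain_map R C ?K ?c"
    by (rule chain_mapI) (auto intro!: mod_homI simp: dE_simps i_simps dW_simps E.a_inv_zero)
  have "cdiff W n (proj n x) = proj (n - 1) (cdiff W n x)" if "x \<in> carrier (cobj W n)" for n x
    using chain_map_comm[OF proj_chain_map that] by simp
  moreover have "proj (n - 1) (i (n - 1) e \<oplus>\<^bsub>cobj W (n - 1)\<^esub> w) = proj (n - 1) w"
    if "e \<in> carrier (cobj E (n - 1))" "w \<in> carrier (cobj W (n - 1))" for n e w
    unfolding proj_def using that by (simp add: r_simps i_simps ri W.ag_simps)
  ultimately have g: "chain_map R ?K C ?g"
    by (intro chain_mapI)
      (auto intro!: mod_homI simp: mod_homD[OF proj_hom, simplified] dW_simps)
  have cg: "chain_homotopic R ?K ?K (\<lambda>n z. ?c n (?g n z)) (\<lambda>n z. z)"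
  proof (rule chain_homotopicI[OF K K, where s = "\<lambda>n z. (\<ominus>\<^bsub>cobj E n\<^esub> r n (snd z), \<zero>\<^bsub>cobj W (n + 1)\<^esub>)"])
    fix n
    show "(\<lambda>z. (\<ominus>\<^bsub>cobj E n\<^esub> r n (snd z), \<zero>\<^bsub>cobj W (n + 1)\<^esub>)) \<in> mod_hom R (cobj ?K n) (cobj ?K (n + 1))"
      by (rule mod_homI) (auto simp: r_simps E.minus_add E.a_ac E.smult_r_minus)
    fix z assume "z \<in> carrier (cobj ?K n)"
    then obtain e w where z: "z = (e, w)" "e \<in> carrier (cobj E (n - 1))" "w \<in> carrier (cobj W n)" by auto
    show "?c n (?g n z) \<in> carrier (cobj ?K n)" "z \<in> carrier (cobj ?K n)"
      using z proj_closed[OF z(3)] by auto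
    have dr: "cdiff E n (r n w) = r (n - 1) (cdiff W n w)" by (rule chain_map_comm[OF r z(3)])
    have cl: "r n w \<in> carrier (cobj E n)" "r (n - 1) (cdiff W n w) \<in> carrier (cobj E (n - 1))"
      "cdiff W n w \<in> carrier (cobj W (n - 1))" "i n (r n w) \<in> carrier (cobj W n)"
      "i (n - 1) e \<in> carrier (cobj W (n - 1))"
      using z r_simps(1) dW_simps(1) i_simps(1) by auto
    have d1: "cdiff W (n + 1) \<zero>\<^bsub>cobj W (n + 1)\<^esub> = \<zero>\<^bsub>cobj W n\<^esub>" using dW_simps(4)[of "n + 1"] by simp
    show "?c n (?g n z) = cdiff ?K (n + 1) (\<ominus>\<^bsub>cobj E n\<^esub> r n (snd z), \<zero>\<^bsub>cobj W (n + 1)\<^esub>) \<oplus>\<^bsub>cobj ?K n\<^esub>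
      (\<ominus>\<^bsub>cobj E (n - 1)\<^esub> r (n - 1) (snd (cdiff ?K n z)), \<zero>\<^bsub>cobj W (n - 1 + 1)\<^esub>) \<oplus>\<^bsub>cobj ?K n\<^esub> z"
      unfolding z(1) proj_def using z(2,3) cl
      by (simp add: dE_simps(5) i_simps(5) d1 dr r_simps(2) ri E.ag_simps W.ag_simps)
  qed
  have gc: "chain_homotopic R C C (\<lambda>n x. ?g n (?c n x)) (\<lambda>n x. x)"
    by (rule chain_homotopic_cong[OF is_complex_compl is_complex_compl]) (use proj_ident in auto)
  show ?thesis
    unfolding homotopy_isomorphic_def homotopy_equiv_def using c g cg gc by blast
qed

text \<open>\<open>J\<close> consists of the cycles whose image in \<open>E\<close> bounds. The
  layer above \<open>J\<close> is the homology of \<open>E\<close>, the one below it that of the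
  complement.\<close>

lemma hfin_split:
  assumes "primeideal P R" "hfin R P E n" "hfin R P C n"
  shows "hfin R P W n"
proof -
  define J where "J = {z \<in> cyc W n. r n z \<in> bdry E n}"
  have J: "submodule J R (cobj W n)"
    unfolding J_def by (rule submodule_vimage[OF W.module_axioms E.module_axioms chain_map_hom[OF r]
          submodule_cyc[OF W] submodule_bdry[OF E]])
  have BJ: "bdry W n \<subseteq> J" unfolding J_def using bdry_subset_cyc[OF W, of n] chain_map_bdry[OF r] by blast
  have JZ: "J \<subseteq> cyc W n" unfolding J_def by blast
  have "pfin R P (cobj W n) J (cyc W n) \<longleftrightarrow> pfin R P (cobj E n) (bdry E n) (cyc E n)"
  proof (rule plen_transfer(1)[OF W.module_axioms E.module_axioms chain_map_hom[OF r] J submodule_cyc[OF W]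
        submodule_bdry[OF E] submodule_cyc[OF E] bdry_subset_cyc[OF E] _ _ _ JZ])
    show "r n x \<in> cyc E n" if "x \<in> cyc W n" for x by (rule chain_map_cyc[OF W E r that])
    show "r n x \<in> bdry E n \<longleftrightarrow> x \<in> J" if "x \<in> cyc W n" for x using that unfolding J_def by blast
    show "\<exists>x\<in>cyc W n. \<exists>a\<in>bdry E n. y = r n x \<oplus>\<^bsub>cobj E n\<^esub> a" if "y \<in> cyc E n" for y
      using chain_map_cyc[OF E W i that] submodule_zeroD[OF submodule_bdry[OF E]] that cyc_subset[of E n] ri
      by (intro bexI[of _ "i n y"] bexI[of _ "\<zero>\<^bsub>cobj E n\<^esub>"]) auto
  qed
  moreover have "pfin R P (cobj C n) (bdry C n) (cyc C n) \<longleftrightarrow> pfin R P (cobj W n) (bdry W n) J"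
  proof (rule plen_transfer(1)[OF module_compl W.module_axioms chain_map_hom[OF incl_compl]
        submodule_bdry[OF is_complex_compl] submodule_cyc[OF is_complex_compl] submodule_bdry[OF W] J BJ _ _ _
        bdry_subset_cyc[OF is_complex_compl]])
    show "x \<in> J" if "x \<in> cyc C n" for x
      using that submodule_zeroD[OF submodule_bdry[OF E]] unfolding J_def by (auto simp: cyc_def)
    show "x \<in> bdry W n \<longleftrightarrow> x \<in> bdry C n" if x: "x \<in> cyc C n" for x
    proof
      assume "x \<in> bdry W n"
      then have "proj n x \<in> bdry C n" by (rule chain_map_bdry[OF proj_chain_map])
      then show "x \<in> bdry C n" using proj_ident[of x n] x cyc_subset by force
    qed (use chain_map_bdry[OF incl_compl] in blast)
    show "\<exists>x\<in>cyc C n. \<exists>a\<in>bdry W n. y = x \<oplus>\<^bsub>cobj W n\<^esub> a" if y: "y \<in> J" for y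
    proof (intro bexI)
      have yW: "y \<in> cyc W n" "y \<in> carrier (cobj W n)" using y cyc_subset[of W n] unfolding J_def by auto
      show "y = proj n y \<oplus>\<^bsub>cobj W n\<^esub> i n (r n y)"
        unfolding proj_def using yW by (simp add: r_simps i_simps W.ag_simps)
      show "i n (r n y) \<in> bdry W n" using y chain_map_bdry[OF i] unfolding J_def by blast
      show "proj n y \<in> cyc C n" by (rule chain_map_cyc[OF W is_complex_compl proj_chain_map yW(1)])
    qed
  qed
  ultimately show ?thesis
    using assms pfin_add_iff[OF W.module_axioms assms(1) submodule_bdry[OF W] J submodule_cyc[OF W] BJ JZ]
    unfolding hfin_def by blast
qed

text \<open>The kernel of \<open>r n\<close> is the term of the complement, and \<open>W\<close>
  modulo this kernel is the term of \<open>E\<close>.\<close>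

lemma rank_split:
  assumes "primeideal P R" "pfin R P (cobj W n) {\<zero>\<^bsub>cobj W n\<^esub>} (carrier (cobj W n))"
  shows "plen R P (cobj W n) {\<zero>\<^bsub>cobj W n\<^esub>} (carrier (cobj W n)) =
    plen R P (cobj C n) {\<zero>\<^bsub>cobj C n\<^esub>} (carrier (cobj C n)) +
    plen R P (cobj E n) {\<zero>\<^bsub>cobj E n\<^esub>} (carrier (cobj E n))"
proof -
  let ?D = "{x \<in> carrier (cobj W n). r n x = \<zero>\<^bsub>cobj E n\<^esub>}"
  interpret C: module R "cobj C n" by (rule module_compl)
  have z: "submodule {\<zero>\<^bsub>cobj W n\<^esub>} R (cobj W n)" by (rule submodule_zero[OF W.module_axioms])
  have 0: "{\<zero>\<^bsub>cobj W n\<^esub>} \<subseteq> ?D" by (auto simp: r_simps)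
  have 1: "plen R P (cobj W n) ?D (carrier (cobj W n)) = plen R P (cobj E n) {\<zero>\<^bsub>cobj E n\<^esub>} (carrier (cobj E n))"
  proof (rule plen_transfer(2)[OF W.module_axioms E.module_axioms chain_map_hom[OF r] submodule_compl
        W.carrier_is_submodule submodule_zero[OF E.module_axioms] E.carrier_is_submodule])
    show "\<exists>x\<in>carrier (cobj W n). \<exists>a\<in>{\<zero>\<^bsub>cobj E n\<^esub>}. y = r n x \<oplus>\<^bsub>cobj E n\<^esub> a" if "y \<in> carrier (cobj E n)" for y
      using that i_simps(1) ri by (intro bexI[of _ "i n y"]) auto
  qed (auto simp: r_simps)
  have 2: "plen R P (cobj C n) {\<zero>\<^bsub>cobj C n\<^esub>} (carrier (cobj C n)) = plen R P (cobj W n) {\<zero>\<^bsub>cobj W n\<^esub>} ?D"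
    by (rule plen_transfer(2)[OF module_compl W.module_axioms chain_map_hom[OF incl_compl]
          submodule_zero[OF module_compl] C.carrier_is_submodule z submodule_compl])
      (auto simp: r_simps)
  show ?thesis
    using plen_add[OF W.module_axioms assms(1) z submodule_compl W.carrier_is_submodule 0 _ assms(2)] 1 2 by auto
qed

end


section \<open>Length of the residue field and finiteness of ranks\<close>

lemma (in cring) submodule_regular_ideal:
  assumes "ideal J R" shows "submodule J R (regular_mod R)"
proof -
  interpret J: ideal J R by fact
  interpret F: module R "regular_mod R" by (rule module_regular[OF is_cring])
  show ?thesis
  proof (rule F.submoduleI)
    fix a assume a: "a \<in> J"
    have "\<ominus>\<^bsub>regular_mod R\<^esub> a = \<ominus> a"
      by (rule F.minus_equality) (use a J.Icarr in \<open>auto simp: l_neg\<close>)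
    then show "\<ominus>\<^bsub>regular_mod R\<^esub> a \<in> J" using J.a_inv_closed[OF a] by simp
  qed (auto simp: J.Icarr J.I_l_closed)
qed

text \<open>\<open>R / P\<close> localised at \<open>P\<close> is a field. For the upper bound, the
  witness \<open>y\<close> of the lower of two steps lies outside \<open>P\<close>, yet with the
  witness \<open>x\<close> of the upper step \<open>y x \<in> N\<close> forces
  \<open>y \<in> P\<close>.\<close>

lemma plen_regular_prime:
  fixes R (structure)
  assumes "cring R" "primeideal P R"
  shows "pfin R P (regular_mod R) P (carrier R)" "plen R P (regular_mod R) P (carrier R) = 1"
proof -
  interpret cring R by fact
  interpret P: primeideal P R by fact
  have F: "module R (regular_mod R)" by (rule module_regular[OF assms(1)])
  interpret F: module R "regular_mod R" by fact
  have nP: "\<one> \<notin> P" using P.I_notcarr P.one_imp_carrier by blast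
  have subP: "submodule P R (regular_mod R)" by (rule submodule_regular_ideal[OF P.is_ideal])
  have 1: "pchain R P (regular_mod R) 1 P (carrier R)"
    using subP nP P.Icarr
    by (auto simp: pstrict_def intro!: exI[of _ P] bexI[of _ \<one>])
  have 2: "\<not> pchain R P (regular_mod R) (Suc 1) P (carrier R)"
  proof
    assume "pchain R P (regular_mod R) (Suc 1) P (carrier R)"
    then obtain N N' where N: "P \<subseteq> N'" "submodule N R (regular_mod R)"
      "pstrict R P (regular_mod R) N' N" "pstrict R P (regular_mod R) N (carrier R)"
      by auto
    then obtain y where y: "y \<in> N" "\<And>r. r \<in> carrier R \<Longrightarrow> r \<otimes> y \<in> N' \<Longrightarrow> r \<in> P" unfolding pstrict_def by auto
    have yR: "y \<in> carrier R" using y(1) F.submoduleE(1)[OF N(2)] by auto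
    have "y \<notin> P" using y(2)[of \<one>] N(1) nP yR by auto
    obtain x where x: "x \<in> carrier R" "\<And>r. r \<in> carrier R \<Longrightarrow> r \<otimes> x \<in> N \<Longrightarrow> r \<in> P"
      using N(4) unfolding pstrict_def by auto
    have "x \<otimes> y \<in> N" using F.submoduleE(4)[OF N(2) x(1) y(1)] by simp
    then have "y \<in> P" using x yR by (simp add: m_comm)
    then show False using \<open>y \<notin> P\<close> by simp
  qed
  show "pfin R P (regular_mod R) P (carrier R)" "plen R P (regular_mod R) P (carrier R) = 1"
    using plen_eqI2[OF 1 2] by auto
qed

context domain
begin

lemma plen_zero_regular:
  "pfin R {\<zero>} (regular_mod R) {\<zero>} (carrier R)" "plen R {\<zero>} (regular_mod R) {\<zero>} (carrier R) = 1"
  using plen_regular_prime[OF is_cring zeroprimeideal] by auto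

text \<open>Two kinds of ideals occur: \<open>J = 0\<close> for ranks and stalks, and
  \<open>J = PIdl a\<close> for the homology of two-term complexes.\<close>

lemma plen_rfun_regular:
  assumes "ideal J R"
  shows "pfin R P (regular_mod R) J (carrier R) \<longleftrightarrow> pfin R P (rfun R) ((\<lambda>x _. x) ` J) (carrier (rfun R))"
    and "plen R P (regular_mod R) J (carrier R) = plen R P (rfun R) ((\<lambda>x _. x) ` J) (carrier (rfun R))"
proof -
  interpret J: ideal J R by fact
  have F: "module R (regular_mod R)" by (rule module_regular[OF is_cring])
  interpret F: module R "regular_mod R" by fact
  interpret G: module R "rfun R" by (rule module_rfun)
  have JR: "J \<subseteq> carrier R" using J.Icarr by blast
  note t = plen_transfer[OF F module_rfun mod_hom_const submodule_regular_ideal[OF assms] F.carrier_is_submodule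
      submodule_image[OF F module_rfun mod_hom_const submodule_regular_ideal[OF assms]] G.carrier_is_submodule]
  have inj: "(\<lambda>_::nat. x) \<in> (\<lambda>x _. x) ` J \<longleftrightarrow> x \<in> J" for x
  proof
    assume "(\<lambda>_::nat. x) \<in> (\<lambda>x _. x) ` J"
    then obtain y where "y \<in> J" "(\<lambda>_::nat. x) = (\<lambda>_. y)" by auto
    then show "x \<in> J" by (metis)
  qed auto
  have ex: "\<exists>x\<in>carrier (regular_mod R). \<exists>a\<in>(\<lambda>x _. x) ` J. y = (\<lambda>_. x) \<oplus>\<^bsub>rfun R\<^esub> a" if y: "y \<in> carrier (rfun R)" for y
  proof -
    obtain x where "x \<in> carrier R" "y = (\<lambda>_. x)" using y by auto
    then show ?thesis using J.zero_closed by (intro bexI[of _ x] bexI[of _ "\<lambda>_. \<zero>"]) auto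
  qed
  show "pfin R P (regular_mod R) J (carrier R) \<longleftrightarrow> pfin R P (rfun R) ((\<lambda>x _. x) ` J) (carrier (rfun R))"
    using t(1) inj ex JR by (simp add: image_mono)
  show "plen R P (regular_mod R) J (carrier R) = plen R P (rfun R) ((\<lambda>x _. x) ` J) (carrier (rfun R))"
    using t(2) inj ex JR by (simp add: image_mono)
qed

lemma plen_zero_rfun: "plen R {\<zero>} (rfun R) {\<zero>\<^bsub>rfun R\<^esub>} (carrier (rfun R)) = 1"
  using plen_zero_regular(2) plen_rfun_regular(2)[OF primeideal.axioms(1)[OF zeroprimeideal], of "{\<zero>}"] by simp

text \<open>Filter \<open>M\<close> by the spans of the first \<open>k\<close> generators. Each
  layer is cyclic, a quotient of \<open>R\<close>, and \<open>R\<close> has rank 1.\<close>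

lemma fin_gen_rank_finite:
  assumes "module R M" "fin_gen_mod R M"
  shows "pfin R {\<zero>} M {\<zero>\<^bsub>M\<^esub>} (carrier M)"
proof -
  interpret M: module R M by fact
  have F: "module R (regular_mod R)" by (rule module_regular[OF is_cring])
  interpret F: module R "regular_mod R" by fact
  interpret G: module R "fmod R m" for m by (rule module_fmod)
  obtain m v where v: "\<And>i. i < m \<Longrightarrow> v i \<in> carrier M" "lincomb M v m ` carrier (fmod R m) = carrier M"
    by (rule fin_gen_lincomb[OF assms]) (rule that)
  let ?S = "\<lambda>k. lincomb M v k ` carrier (fmod R m)"
  have hom: "lincomb M v k \<in> mod_hom R (fmod R m) M" if "k \<le> m" for k by (rule lincomb_hom[OF assms(1) v(1) that])
  have S: "submodule (?S k) R M" if "k \<le> m" for k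
    by (rule submodule_image[OF module_fmod assms(1) hom[OF that] G.carrier_is_submodule])
  \<comment> \<open>\<open>lincomb M v k\<close> ignores coordinate \<open>k\<close>, so overwriting
    it changes only the summand added in the next step.\<close>
  have upd: "lincomb M v k f \<oplus>\<^bsub>M\<^esub> c \<odot>\<^bsub>M\<^esub> v k \<in> ?S (Suc k)"
    if "Suc k \<le> m" "f \<in> carrier (fmod R m)" "c \<in> carrier R" for k f c
  proof (rule image_eqI[of _ _ "f(k := c)"])
    have "lincomb M v k (f(k := c)) = lincomb M v k f"
      by (rule lincomb_cong[OF assms(1) v(1)]) auto
    then show "lincomb M v k f \<oplus>\<^bsub>M\<^esub> c \<odot>\<^bsub>M\<^esub> v k = lincomb M v (Suc k) (f(k := c))" by simp
    show "f(k := c) \<in> carrier (fmod R m)" using that by auto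
  qed
  have z: "submodule {\<zero>\<^bsub>M\<^esub>} R M" by (rule submodule_zero[OF assms(1)])
  have "pfin R {\<zero>} M {\<zero>\<^bsub>M\<^esub>} (?S k)" if "k \<le> m" for k
    using that
  proof (induction k)
    case 0
    have "\<zero>\<^bsub>fmod R m\<^esub> \<in> carrier (fmod R m)" by (rule G.zero_closed)
    then have "?S 0 = {\<zero>\<^bsub>M\<^esub>}" by auto
    then show ?case using plen_refl(1)[OF z zeroprimeideal] by simp
  next
    case (Suc k)
    then have k: "k \<le> m" "k < m" by auto
    have vk: "v k \<in> carrier M" using v(1) k(2) .
    have h: "(\<lambda>c. c \<odot>\<^bsub>M\<^esub> v k) \<in> mod_hom R (regular_mod R) M"
      by (rule mod_homI) (use vk in \<open>auto simp: M.smult_l_distr M.smult_assoc1\<close>)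
    \<comment> \<open>The ideal of scalars carrying \<open>v k\<close> into the previous span; the
      next layer is \<open>R\<close> modulo this ideal.\<close>
    let ?A = "{c \<in> carrier (regular_mod R). c \<odot>\<^bsub>M\<^esub> v k \<in> ?S k}"
    have A: "submodule ?A R (regular_mod R)"
      by (rule submodule_vimage[OF F assms(1) h F.carrier_is_submodule S[OF k(1)]])
    have sub: "?S k \<subseteq> ?S (Suc k)"
    proof
      fix x assume "x \<in> ?S k"
      then obtain f where f: "f \<in> carrier (fmod R m)" "x = lincomb M v k f" by auto
      then have "x = lincomb M v k f \<oplus>\<^bsub>M\<^esub> \<zero> \<odot>\<^bsub>M\<^esub> v k"
        using vk mod_hom_closed[OF hom[OF k(1)]] by simp
      then show "x \<in> ?S (Suc k)" using upd[OF Suc.prems f(1) zero_closed] by simp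
    qed
    have "pfin R {\<zero>} (regular_mod R) ?A (carrier (regular_mod R)) \<longleftrightarrow> pfin R {\<zero>} M (?S k) (?S (Suc k))"
    proof (rule plen_transfer(1)[OF F assms(1) h A F.carrier_is_submodule S[OF k(1)] S[OF Suc.prems] sub])
      fix c assume c: "c \<in> carrier (regular_mod R)"
      have "lincomb M v k \<zero>\<^bsub>fmod R m\<^esub> = \<zero>\<^bsub>M\<^esub>" by (rule mod_hom_zero[OF module_fmod assms(1) hom[OF k(1)]])
      then show "c \<odot>\<^bsub>M\<^esub> v k \<in> ?S (Suc k)"
        using upd[OF Suc.prems G.zero_closed, of c] c vk by simp
      show "c \<odot>\<^bsub>M\<^esub> v k \<in> ?S k \<longleftrightarrow> c \<in> ?A" using c by blast
    next
      fix y assume "y \<in> ?S (Suc k)"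
      then obtain f where f: "f \<in> carrier (fmod R m)" "y = lincomb M v k f \<oplus>\<^bsub>M\<^esub> f k \<odot>\<^bsub>M\<^esub> v k" by auto
      have "f k \<in> carrier (regular_mod R)" using f(1) by simp
      moreover have "y = f k \<odot>\<^bsub>M\<^esub> v k \<oplus>\<^bsub>M\<^esub> lincomb M v k f"
        using f vk mod_hom_closed[OF hom[OF k(1)] f(1)] by (simp add: M.a_comm)
      ultimately show "\<exists>x\<in>carrier (regular_mod R). \<exists>a\<in>?S k. y = x \<odot>\<^bsub>M\<^esub> v k \<oplus>\<^bsub>M\<^esub> a" using f(1) by blast
    qed auto
    moreover have "pfin R {\<zero>} (regular_mod R) ?A (carrier (regular_mod R))"
    proof -
      have "{\<zero>} \<subseteq> ?A" using submodule_zeroD[OF A] by simp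
      then show ?thesis
        using pfin_add_iff[OF F zeroprimeideal submodule_zero[OF F] A F.carrier_is_submodule] plen_zero_regular(1)
        by auto
    qed
    moreover have "{\<zero>\<^bsub>M\<^esub>} \<subseteq> ?S k" using submodule_zeroD[OF S[OF k(1)]] by blast
    ultimately show ?case
      using pfin_add_iff[OF assms(1) zeroprimeideal z S[OF k(1)] S[OF Suc.prems] _ sub] Suc.IH[OF k(1)] by blast
  qed
  from this[of m] show ?thesis unfolding v(2) by simp
qed

end

section \<open>Decomposition of perfect complexes\<close>

definition elementary :: "('a, 'r) ring_scheme \<Rightarrow> ('a, nat \<Rightarrow> 'a) cplx \<Rightarrow> bool" where
  "elementary R E \<longleftrightarrow> (\<exists>n. E = stalk_at (rfun R) n) \<or>
     (\<exists>n a. a \<in> carrier R - {\<zero>\<^bsub>R\<^esub>} \<and> E = two_term (rfun R) n a)"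

context cring
begin

lemma perfect_two_term:
  assumes "a \<in> carrier R"
  shows "perfect_cplx R (two_term (rfun R) n a)"
  unfolding perfect_cplx_def
proof (intro conjI allI)
  show "is_complex R (two_term (rfun R) n a)" by (rule is_complex_two_term[OF module_rfun assms])
  show "fg_projective R (cobj (two_term (rfun R) n a) k)" for k
    using fg_projective_rfun fg_projective_zero_submod[OF fg_projective_rfun] by simp
  show "\<exists>N. \<forall>k. N < \<bar>k\<bar> \<longrightarrow> carrier (cobj (two_term (rfun R) n a) k) = {\<zero>\<^bsub>cobj (two_term (rfun R) n a) k\<^esub>}"
    by (rule exI[of _ "\<bar>n\<bar> + 1"]) auto
qed

lemma perfect_stalk_at: "perfect_cplx R (stalk_at (rfun R) n)"
  unfolding perfect_cplx_def
proof (intro conjI allI)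
  show "is_complex R (stalk_at (rfun R) n)" by (rule is_complex_stalk_at[OF module_rfun])
  show "fg_projective R (cobj (stalk_at (rfun R) n) k)" for k
    using fg_projective_rfun fg_projective_zero_submod[OF fg_projective_rfun] by simp
  show "\<exists>N. \<forall>k. N < \<bar>k\<bar> \<longrightarrow> carrier (cobj (stalk_at (rfun R) n) k) = {\<zero>\<^bsub>cobj (stalk_at (rfun R) n) k\<^esub>}"
    by (rule exI[of _ "\<bar>n\<bar>"]) auto
qed

lemma perfect_elementary: "elementary R E \<Longrightarrow> perfect_cplx R E"
  unfolding elementary_def using perfect_two_term perfect_stalk_at by auto

end

lemma perfect_cplxD:
  assumes "perfect_cplx R U"
  shows "is_complex R U" "fg_projective R (cobj U n)"
  using assms unfolding perfect_cplx_def by auto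

context principal_domain
begin

text \<open>The entry found by \<open>split_entry\<close> spans a two-term subcomplex on
  \<open>x\<close> and \<open>y\<close>, with \<open>\<psi>\<close> and \<open>\<phi>\<close> as
  retraction. The neighbouring differentials fit because \<open>d d = 0\<close> may be divided by
  \<open>a\<close>: \<open>y\<close> is a cycle, and \<open>\<psi>\<close> kills boundaries.\<close>

lemma split_two_term:
  fixes U :: "('a, nat \<Rightarrow> 'a) cplx"
  assumes U: "perfect_cplx R U" and x0: "x0 \<in> carrier (cobj U n)" "cdiff U n x0 \<noteq> \<zero>\<^bsub>cobj U (n - 1)\<^esub>"
  shows "\<exists>a i r. a \<in> carrier R - {\<zero>} \<and> cplx_split R (two_term (rfun R) n a) U i r"
proof -
  note cx = perfect_cplxD(1)[OF U] and fg = perfect_cplxD(2)[OF U]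
  interpret U: module R "cobj U m" for m by (rule cx_module[OF cx])
  obtain a x y \<phi> \<psi> where e: "a \<in> carrier R" "a \<noteq> \<zero>" "x \<in> carrier (cobj U n)" "y \<in> carrier (cobj U (n - 1))"
    "\<phi> \<in> mod_hom R (cobj U (n - 1)) (regular_mod R)" "\<psi> \<in> mod_hom R (cobj U n) (regular_mod R)"
    "cdiff U n x = a \<odot>\<^bsub>cobj U (n - 1)\<^esub> y" "\<phi> y = \<one>" "\<psi> x = \<one>"
    "\<And>z. z \<in> carrier (cobj U n) \<Longrightarrow> \<phi> (cdiff U n z) = a \<otimes> \<psi> z"
    by (rule split_entry[where M = "cobj U n" and N = "cobj U (n - 1)" and d = "cdiff U n", OF fg fg cx_diff[OF cx] x0]) (rule that)
  note \<phi> = mod_homD[OF e(5)] and \<psi> = mod_homD[OF e(6)] and d = mod_homD[OF cx_diff[OF cx]]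
  let ?E = "two_term (rfun R) n a"
  have E: "is_complex R ?E" by (rule is_complex_two_term[OF module_rfun e(1)])
  have dy: "cdiff U (n - 1) y = \<zero>\<^bsub>cobj U (n - 2)\<^esub>"
  proof (rule fg_projective_torsionfree[OF fg _ e(1,2)])
    show "cdiff U (n - 1) y \<in> carrier (cobj U (n - 2))" using d(1)[OF e(4)] by simp
    have "a \<odot>\<^bsub>cobj U (n - 2)\<^esub> cdiff U (n - 1) y = cdiff U (n - 1) (cdiff U n x)"
      using d(3)[OF e(1,4)] e(7) by simp
    then show "a \<odot>\<^bsub>cobj U (n - 2)\<^esub> cdiff U (n - 1) y = \<zero>\<^bsub>cobj U (n - 2)\<^esub>" using cx_dd[OF cx e(3)] by simp
  qed
  have psid: "\<psi> (cdiff U (n + 1) z) = \<zero>" if z: "z \<in> carrier (cobj U (n + 1))" for z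
  proof -
    have dz: "cdiff U (n + 1) z \<in> carrier (cobj U n)" using d(1)[OF z] by simp
    have "a \<otimes> \<psi> (cdiff U (n + 1) z) = \<phi> (cdiff U n (cdiff U (n + 1) z))" using e(10)[OF dz] by simp
    also have "\<dots> = \<zero>"
      using cx_dd_Suc[OF cx z] mod_hom_zero[OF U.module_axioms module_regular[OF is_cring] e(5)] by simp
    finally show ?thesis using e(1,2) \<psi>(1)[OF dz] by (simp add: integral_iff)
  qed
  define i where "i k t = (if k = n then t 0 \<odot>\<^bsub>cobj U n\<^esub> x else if k = n - 1 then t 0 \<odot>\<^bsub>cobj U (n - 1)\<^esub> y
    else \<zero>\<^bsub>cobj U k\<^esub>)" for k and t :: "nat \<Rightarrow> 'a"
  define r where "r k z = (\<lambda>_::nat. if k = n then \<psi> z else if k = n - 1 then \<phi> z else \<zero>)" for k z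
  have i: "chain_map R ?E U i"
  proof (rule chain_mapI)
    fix k
    show "i k \<in> mod_hom R (cobj ?E k) (cobj U k)"
      by (rule mod_homI) (use e in \<open>auto simp: i_def U.smult_l_distr U.smult_assoc1 split: if_splits\<close>)
    fix t assume t: "t \<in> carrier (cobj ?E k)"
    consider "k = n" | "k = n - 1" | "k \<noteq> n" "k \<noteq> n - 1" by blast
    then show "cdiff U k (i k t) = i (k - 1) (cdiff ?E k t)"
    proof cases
      case 1
      then obtain c where c: "c \<in> carrier R" "t = (\<lambda>_. c)" using t by auto
      show ?thesis using 1 c e d(3)[OF c(1) e(3)] by (simp add: i_def U.smult_assoc1[symmetric] m_comm)
    next
      case 2
      then obtain c where c: "c \<in> carrier R" "t = (\<lambda>_. c)" using t by auto
      show ?thesis using 2 c d(3)[OF c(1) e(4)] dy by (simp add: i_def)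
    next
      case 3
      then have "i k t = \<zero>\<^bsub>cobj U k\<^esub>" by (simp add: i_def)
      moreover have "i (k - 1) (cdiff ?E k t) = \<zero>\<^bsub>cobj U (k - 1)\<^esub>"
        using 3 e by (auto simp: i_def)
      ultimately show ?thesis using mod_hom_zero[OF U.module_axioms U.module_axioms cx_diff[OF cx]] by simp
    qed
  qed
  have r: "chain_map R U ?E r"
  proof (rule chain_mapI)
    fix k
    show "r k \<in> mod_hom R (cobj U k) (cobj ?E k)"
      by (rule mod_homI) (use \<phi> \<psi> in \<open>auto simp: r_def\<close>)
    fix z assume z: "z \<in> carrier (cobj U k)"
    consider "k = n" | "k = n + 1" | "k \<noteq> n" "k \<noteq> n + 1" by blast
    then show "cdiff ?E k (r k z) = r (k - 1) (cdiff U k z)"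
    proof cases
      case 1
      then show ?thesis using e(10) z by (simp add: r_def)
    next
      case 2
      then show ?thesis using psid z by (simp add: r_def)
    qed (auto simp: r_def)
  qed
  have "r k (i k t) = t" if t: "t \<in> carrier (cobj ?E k)" for k t
    using t e \<phi>(3) \<psi>(3) by (auto simp: r_def i_def)
  then have "cplx_split R ?E U i r" using E cx i r by unfold_locales
  then show ?thesis using e(1,2) by blast
qed

lemma split_stalk:
  fixes U :: "('a, nat \<Rightarrow> 'a) cplx"
  assumes U: "perfect_cplx R U" and x0: "x0 \<in> carrier (cobj U n)" "x0 \<noteq> \<zero>\<^bsub>cobj U n\<^esub>"
    and d0: "\<And>k x. x \<in> carrier (cobj U k) \<Longrightarrow> cdiff U k x = \<zero>\<^bsub>cobj U (k - 1)\<^esub>"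
  shows "\<exists>i r. cplx_split R (stalk_at (rfun R) n) U i r"
proof -
  note cx = perfect_cplxD(1)[OF U] and fg = perfect_cplxD(2)[OF U]
  interpret U: module R "cobj U m" for m by (rule cx_module[OF cx])
  \<comment> \<open>Applied to the identity map, \<open>split_entry\<close> provides an element
    \<open>y\<close> and a functional with value 1 on it, so \<open>y\<close> spans a free
    summand.\<close>
  obtain y \<phi> where e: "y \<in> carrier (cobj U n)" "\<phi> \<in> mod_hom R (cobj U n) (regular_mod R)" "\<phi> y = \<one>"
    by (rule split_entry[where M = "cobj U n" and N = "cobj U n" and d = "\<lambda>x. x", OF fg fg mod_hom_id x0]) (rule that)
  note \<phi> = mod_homD[OF e(2)]
  let ?E = "stalk_at (rfun R) n"
  have E: "is_complex R ?E" by (rule is_complex_stalk_at[OF module_rfun])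
  define i where "i k t = (if k = n then t 0 \<odot>\<^bsub>cobj U n\<^esub> y else \<zero>\<^bsub>cobj U k\<^esub>)" for k and t :: "nat \<Rightarrow> 'a"
  define r where "r k z = (\<lambda>_::nat. if k = n then \<phi> z else \<zero>)" for k z
  have ih: "i k \<in> mod_hom R (cobj ?E k) (cobj U k)" for k
    by (rule mod_homI) (use e in \<open>auto simp: i_def U.smult_l_distr U.smult_assoc1 split: if_splits\<close>)
  have i: "chain_map R ?E U i"
  proof (rule chain_mapI[OF ih])
    fix k t assume t: "t \<in> carrier (cobj ?E k)"
    show "cdiff U k (i k t) = i (k - 1) (cdiff ?E k t)"
      using d0[OF mod_hom_closed[OF ih t]] e by (auto simp: i_def)
  qed
  have phi0: "\<phi> \<zero>\<^bsub>cobj U n\<^esub> = \<zero>" using mod_hom_zero[OF U.module_axioms module_regular[OF is_cring] e(2)] by simp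
  have r: "chain_map R U ?E r"
  proof (rule chain_mapI)
    fix k
    show "r k \<in> mod_hom R (cobj U k) (cobj ?E k)"
      by (rule mod_homI) (use \<phi> in \<open>auto simp: r_def\<close>)
    show "cdiff ?E k (r k z) = r (k - 1) (cdiff U k z)" if z: "z \<in> carrier (cobj U k)" for z
      using d0[OF z] phi0 by (auto simp: r_def)
  qed
  have "r k (i k t) = t" if t: "t \<in> carrier (cobj ?E k)" for k t
    using t e \<phi>(3) by (auto simp: r_def i_def split: if_splits)
  then have "cplx_split R ?E U i r" using E cx i r by unfold_locales
  then show ?thesis by blast
qed

text \<open>Stalks are split off only once all differentials vanish: a summand of a single term is
  then automatically a subcomplex with a compatible retraction.\<close>

lemma perfect_decompose:
  fixes U :: "('a, nat \<Rightarrow> 'a) cplx"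
  assumes "perfect_cplx R U"
  shows "(\<forall>n. carrier (cobj U n) = {\<zero>\<^bsub>cobj U n\<^esub>}) \<or> (\<exists>E i r. elementary R E \<and> cplx_split R E U i r)"
proof (cases "\<exists>n. \<exists>x\<in>carrier (cobj U n). cdiff U n x \<noteq> \<zero>\<^bsub>cobj U (n - 1)\<^esub>")
  case True
  then show ?thesis using split_two_term[OF assms] unfolding elementary_def by blast
next
  case d0: False
  interpret U: module R "cobj U m" for m by (rule cx_module[OF perfect_cplxD(1)[OF assms]])
  show ?thesis
  proof (cases "\<forall>n. carrier (cobj U n) = {\<zero>\<^bsub>cobj U n\<^esub>}")
    case False
    then obtain n x where "x \<in> carrier (cobj U n)" "x \<noteq> \<zero>\<^bsub>cobj U n\<^esub>" using U.zero_closed by blast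
    then show ?thesis using split_stalk[OF assms, of x n] d0 unfolding elementary_def by blast
  qed blast
qed

text \<open>Induction on the total rank over a fixed range of degrees. The complement vanishes
  outside the same range, and its rank drops wherever the split summand has a copy of
  \<open>R\<close>.\<close>

lemma perfect_induct [consumes 1, case_names zero split]:
  fixes U :: "('a, nat \<Rightarrow> 'a) cplx"
  assumes "perfect_cplx R U"
    and zero: "\<And>U. perfect_cplx R U \<Longrightarrow> (\<And>n. carrier (cobj U n) = {\<zero>\<^bsub>cobj U n\<^esub>}) \<Longrightarrow> Q U"
    and split: "\<And>E U i r. perfect_cplx R U \<Longrightarrow> elementary R E \<Longrightarrow> cplx_split R E U i r \<Longrightarrow>
      Q (compl_cplx E U r) \<Longrightarrow> Q U"
  shows "Q U"
proof -
  define rk where "rk M = plen R {\<zero>} M {\<zero>\<^bsub>M\<^esub>} (carrier M)" for M :: "('a, nat \<Rightarrow> 'a) module"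
  define b where "b N U \<longleftrightarrow> (\<forall>n. N < \<bar>n\<bar> \<longrightarrow> carrier (cobj U n) = {\<zero>\<^bsub>cobj U n\<^esub>})"
    for N and U :: "('a, nat \<Rightarrow> 'a) cplx"
  obtain N where "b N U" using assms(1) unfolding perfect_cplx_def b_def by blast
  then show ?thesis using assms(1)
  proof (induction "\<Sum>k\<in>{-N..N}. rk (cobj U k)" arbitrary: U rule: less_induct)
    case less
    note U = perfect_cplxD[OF less.prems(2)]
    consider "\<And>n. carrier (cobj U n) = {\<zero>\<^bsub>cobj U n\<^esub>}" |
      E i r where "elementary R E" "cplx_split R E U i r"
      using perfect_decompose[OF less.prems(2)] by blast
    then show ?case
    proof cases
      case 1
      then show ?thesis by (rule zero[OF less.prems(2)])
    next
      case 2
      interpret S: cplx_split R E U i r by (rule 2(2))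
      have fin: "pfin R {\<zero>} (cobj U k) {\<zero>\<^bsub>cobj U k\<^esub>} (carrier (cobj U k))" for k
        by (rule fin_gen_rank_finite[OF cx_module[OF U(1)] fg_projectiveD(2)[OF U(2)]])
      have rk: "rk (cobj U k) = rk (cobj S.C k) + rk (cobj E k)" for k
        unfolding rk_def by (rule S.rank_split[OF zeroprimeideal fin])
      have "cobj (stalk_at (rfun R) n) n = rfun R" "cobj (two_term (rfun R) n a) n = rfun R" for n a
        by simp_all
      then obtain k where k: "cobj E k = rfun R" using 2(1) unfolding elementary_def by metis
      have one: "(\<lambda>_. \<one>) \<in> carrier (cobj E k)" unfolding k by simp
      \<comment> \<open>The drop in degree \<open>k\<close> counts only if \<open>k\<close> lies in
        the summation range, which holds because the copy of \<open>R\<close> makes this term of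
        \<open>U\<close> nonzero.\<close>
      have "carrier (cobj U k) \<noteq> {\<zero>\<^bsub>cobj U k\<^esub>}"
      proof
        assume "carrier (cobj U k) = {\<zero>\<^bsub>cobj U k\<^esub>}"
        then have "i k (\<lambda>_. \<one>) = \<zero>\<^bsub>cobj U k\<^esub>" using S.i_simps(1)[OF one] by simp
        then have "(\<lambda>_::nat. \<one>) = (\<lambda>_. \<zero>)" using S.ri[OF one] S.r_simps(4)[of k] k by simp
        then show False using one_not_zero by (metis)
      qed
      then have kN: "k \<in> {-N..N}" using less.prems(1) unfolding b_def by (metis abs_le_iff atLeastAtMost_iff minus_le_iff not_le)
      have "(\<Sum>k\<in>{-N..N}. rk (cobj S.C k)) < (\<Sum>k\<in>{-N..N}. rk (cobj U k))"
      proof (rule sum_strict_mono_ex1)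
        show "\<exists>k\<in>{-N..N}. rk (cobj S.C k) < rk (cobj U k)"
          using kN rk[of k] plen_zero_rfun by (intro bexI[of _ k]) (auto simp: k rk_def)
      qed (auto simp: rk)
      moreover have "b N S.C" using less.prems(1) S.r_simps(4) unfolding b_def by auto
      ultimately have "Q S.C" using less.hyps S.perfect_compl[OF less.prems(2)] by blast
      then show ?thesis by (rule split[OF less.prems(2) 2])
    qed
  qed
qed


section \<open>Lengths of cyclic modules\<close>

text \<open>Prime factorisation in the form of an induction rule: the cofactor of an irreducible
  divisor is a proper divisor, and proper division is well-founded.\<close>

lemma factor_induct [consumes 1, case_names unit prime]:
  assumes "a \<in> carrier R - {\<zero>}"
    and unit: "\<And>u. u \<in> Units R \<Longrightarrow> Q u"
    and prime: "\<And>p b. p \<in> carrier R - {\<zero>} \<Longrightarrow> primeideal (PIdl p) R \<Longrightarrow> b \<in> carrier R - {\<zero>} \<Longrightarrow>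
      Q b \<Longrightarrow> Q (p \<otimes> b)"
  shows "Q a"
  using mult_of.division_wellfounded assms(1)
proof (induction a rule: wf_induct_rule)
  case (less a)
  show ?case
  proof (cases "a \<in> Units R")
    case False
    obtain p where p: "p \<in> carrier R" "ring_irreducible p" "p divides a"
      by (rule exists_irreducible_divisor[OF less.prems False]) (rule that)
    have p0: "p \<noteq> \<zero>" using p(2) by (simp add: ring_irreducible_def)
    obtain b where b: "b \<in> carrier R" "a = p \<otimes> b" using p(3) by (auto simp: factor_def)
    have b0: "b \<noteq> \<zero>" using b less.prems p(1) by auto
    have "\<not> a divides\<^bsub>mult_of R\<^esub> b"
    proof
      assume "a divides\<^bsub>mult_of R\<^esub> b"
      then obtain c where c: "c \<in> carrier R" "b = a \<otimes> c" by (auto simp: factor_def)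
      then have "b \<otimes> (p \<otimes> c) = b \<otimes> \<one>" using b p(1) by (simp add: m_ac)
      then have "p \<otimes> c = \<one>" using m_lcancel[of b "p \<otimes> c" \<one>] b b0 p(1) c(1) by simp
      then have "p \<in> Units R" using p(1) c(1) by (auto simp: Units_def m_comm intro!: bexI[of _ c])
      then show False using p(2) by (auto simp: ring_irreducible_def irreducible_def)
    qed
    moreover have "b divides\<^bsub>mult_of R\<^esub> a"
      using b p(1) p0 by (auto simp: factor_def m_comm intro!: bexI[of _ p])
    ultimately have "Q b" using less.IH[of b] less.prems b b0 by (auto simp: properfactor_def)
    moreover have "primeideal (PIdl p) R" by (rule maximalideal_prime[OF irreducible_imp_maximalideal[OF p(1,2)]])
    ultimately show ?thesis using prime[of p b] p(1) p0 b b0 by simp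
  qed (rule unit)
qed

lemma cgenideal_multI: "q \<in> carrier R \<Longrightarrow> x \<in> carrier R \<Longrightarrow> q \<otimes> x \<in> PIdl q"
  unfolding cgenideal_def using m_comm by blast

text \<open>Nonzero primes are maximal. Write \<open>P = (p)\<close> and \<open>q = c p\<close>: as
  \<open>q\<close> is prime, it divides \<open>p\<close>, or it divides \<open>c\<close>, and the
  latter would make \<open>p\<close> a unit.\<close>

lemma prime_eq_generated:
  assumes "q \<in> carrier R" "q \<noteq> \<zero>" "primeideal (PIdl q) R" "primeideal P R" "q \<in> P"
  shows "P = PIdl q"
proof -
  interpret Q: primeideal "PIdl q" R by fact
  interpret P: primeideal P R by fact
  obtain p where p: "p \<in> carrier R" "P = PIdl p" using exists_gen[OF P.is_ideal] by blast
  have "q \<in> {x \<otimes> p |x. x \<in> carrier R}" using assms(5) unfolding p(2) cgenideal_def .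
  then obtain c where c: "c \<in> carrier R" "q = c \<otimes> p" by blast
  have "c \<otimes> p \<in> PIdl q" unfolding c(2)[symmetric] by (rule cgenideal_self[OF assms(1)])
  from Q.I_prime[OF c(1) p(1) this] consider "c \<in> PIdl q" | "p \<in> PIdl q" by blast
  then show ?thesis
  proof cases
    case 1
    then obtain e where e: "e \<in> carrier R" "c = e \<otimes> q" unfolding cgenideal_def by blast
    have "q \<otimes> (e \<otimes> p) = e \<otimes> q \<otimes> p" using e(1) p(1) assms(1) by (simp add: m_ac)
    also have "\<dots> = q" using c(2) unfolding e(2) by (rule sym)
    finally have "q \<otimes> \<one> = q \<otimes> (e \<otimes> p)" using assms(1) by simp
    then have "e \<otimes> p = \<one>" using m_lcancel[of q \<one> "e \<otimes> p"] assms(1,2) e(1) p(1) by simp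
    then have "\<one> \<in> P" using e(1) cgenideal_multI[OF p(1) e(1)] p m_comm[OF e(1) p(1)] by simp
    then show ?thesis using P.I_notcarr P.one_imp_carrier by blast
  next
    case 2
    then have "PIdl p \<subseteq> PIdl q" by (rule cgenideal_minimal[OF Q.is_ideal])
    moreover have "PIdl q \<subseteq> PIdl p" using cgenideal_minimal[OF P.is_ideal assms(5)] p(2) by simp
    ultimately show ?thesis using p(2) by simp
  qed
qed

text \<open>If \<open>P\<close> differs from \<open>(q)\<close> then \<open>q \<notin> P\<close>. As
  \<open>q\<close> kills \<open>R / (q)\<close>, this quotient vanishes at \<open>P\<close>.\<close>

lemma cyclic_length_prime:
  assumes "q \<in> carrier R" "q \<noteq> \<zero>" "primeideal (PIdl q) R" "primeideal P R"
  shows "pfin R P (regular_mod R) (PIdl q) (carrier R)"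
    and "plen R P (regular_mod R) (PIdl q) (carrier R) = (if P = PIdl q then 1 else 0)"
proof -
  interpret F: module R "regular_mod R" by (rule module_regular[OF is_cring])
  have "pfin R P (regular_mod R) (PIdl q) (carrier R) \<and>
    plen R P (regular_mod R) (PIdl q) (carrier R) = (if P = PIdl q then 1 else 0)"
  proof (cases "P = PIdl q")
    case True
    then show ?thesis using plen_regular_prime[OF is_cring assms(4)] by simp
  next
    case False
    then have qP: "q \<notin> P" using prime_eq_generated[OF assms] by blast
    have "\<not> pchain R P (regular_mod R) (Suc 0) (PIdl q) (carrier R)"
    proof
      assume "pchain R P (regular_mod R) (Suc 0) (PIdl q) (carrier R)"
      then obtain N x where N: "PIdl q \<subseteq> N" "x \<in> carrier R" "\<And>r. r \<in> carrier R \<Longrightarrow> r \<otimes> x \<in> N \<Longrightarrow> r \<in> P"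
        by (auto simp: pstrict_def)
      have "q \<otimes> x \<in> PIdl q" by (rule cgenideal_multI[OF assms(1) N(2)])
      then show False using N assms(1) qP by blast
    qed
    moreover have "PIdl q \<subseteq> carrier R" using assms(1) by (auto simp: cgenideal_def)
    ultimately show ?thesis using plen_eqI2[of R P "regular_mod R" 0 "PIdl q" "carrier R"] False by auto
  qed
  then show "pfin R P (regular_mod R) (PIdl q) (carrier R)"
    "plen R P (regular_mod R) (PIdl q) (carrier R) = (if P = PIdl q then 1 else 0)" by blast+
qed

text \<open>Insert \<open>(b)\<close> between \<open>(p b)\<close> and \<open>R\<close>:
  multiplication by \<open>b\<close> identifies \<open>R / (p)\<close> with the lower layer, and the
  upper layer is covered by induction.\<close>

lemma cyclic_length_finite:
  assumes "a \<in> carrier R - {\<zero>}" "primeideal P R"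
  shows "pfin R P (regular_mod R) (PIdl a) (carrier R)"
  using assms(1)
proof (induction a rule: factor_induct)
  have F: "module R (regular_mod R)" by (rule module_regular[OF is_cring])
  interpret F: module R "regular_mod R" by (rule F)
  {
    case (unit u)
    then have "PIdl u = carrier R"
      by (auto simp: cgenideal_def Units_def) (metis m_assoc m_closed r_one)
    then show ?case using plen_refl(1)[OF F.carrier_is_submodule assms(2)] by simp
  next
    case (prime p b)
    have pb: "p \<in> carrier R" "b \<in> carrier R" "b \<noteq> \<zero>" using prime by auto
    note sub = submodule_regular_ideal[OF cgenideal_ideal]
    have h: "(\<lambda>x. b \<odot>\<^bsub>regular_mod R\<^esub> x) \<in> mod_hom R (regular_mod R) (regular_mod R)"
      by (rule mod_hom_scale[OF F pb(2)])
    have s1: "PIdl (p \<otimes> b) \<subseteq> PIdl b" using pb by (auto simp: cgenideal_def m_assoc[symmetric])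
    have s2: "PIdl b \<subseteq> carrier R" using pb by (auto simp: cgenideal_def)
    have "pfin R P (regular_mod R) (PIdl p) (carrier (regular_mod R)) \<longleftrightarrow>
      pfin R P (regular_mod R) (PIdl (p \<otimes> b)) (PIdl b)"
    proof (rule plen_transfer(1)[OF F F h sub[OF pb(1)] F.carrier_is_submodule sub sub[OF pb(2)] s1])
      show "b \<odot>\<^bsub>regular_mod R\<^esub> x \<in> PIdl b" if "x \<in> carrier (regular_mod R)" for x
        using cgenideal_multI[OF pb(2), of x] that by simp
      show "\<exists>x\<in>carrier (regular_mod R). \<exists>a\<in>PIdl (p \<otimes> b). y = b \<odot>\<^bsub>regular_mod R\<^esub> x \<oplus>\<^bsub>regular_mod R\<^esub> a"
        if "y \<in> PIdl b" for y
      proof -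
        have "\<zero> \<in> PIdl (p \<otimes> b)" using submodule_zeroD[OF sub[of "p \<otimes> b"]] pb by simp
        moreover obtain x where "x \<in> carrier R" "y = b \<otimes> x"
          using \<open>y \<in> PIdl b\<close> pb(2) by (auto simp: cgenideal_def m_comm)
        ultimately show ?thesis using pb(2) by (intro bexI[of _ x] bexI[of _ \<zero>]) auto
      qed
      show "b \<odot>\<^bsub>regular_mod R\<^esub> x \<in> PIdl (p \<otimes> b) \<longleftrightarrow> x \<in> PIdl p" if x: "x \<in> carrier (regular_mod R)" for x
      proof
        assume "b \<odot>\<^bsub>regular_mod R\<^esub> x \<in> PIdl (p \<otimes> b)"
        then obtain c where c: "c \<in> carrier R" "b \<otimes> x = c \<otimes> (p \<otimes> b)" by (auto simp: cgenideal_def)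
        then have "b \<otimes> x = b \<otimes> (c \<otimes> p)" using pb by (simp add: m_ac)
        then have "x = c \<otimes> p" using m_lcancel[of b x "c \<otimes> p"] pb c(1) x by simp
        then show "x \<in> PIdl p" using c(1) by (auto simp: cgenideal_def)
      next
        assume "x \<in> PIdl p"
        then obtain c where c: "c \<in> carrier R" "x = c \<otimes> p" by (auto simp: cgenideal_def)
        then have "b \<odot>\<^bsub>regular_mod R\<^esub> x = (p \<otimes> b) \<otimes> c" using pb by (simp add: m_ac)
        then show "b \<odot>\<^bsub>regular_mod R\<^esub> x \<in> PIdl (p \<otimes> b)" using cgenideal_multI[of "p \<otimes> b" c] pb c(1) by simp
      qed
      show "PIdl p \<subseteq> carrier (regular_mod R)" using pb by (auto simp: cgenideal_def)
    qed (use pb in simp)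
    then have "pfin R P (regular_mod R) (PIdl (p \<otimes> b)) (PIdl b)"
      using cyclic_length_prime(1)[OF pb(1) _ prime(2) assms(2)] prime(1) by simp
    then show ?case
      using pfin_add_iff[OF F assms(2) sub sub[OF pb(2)] F.carrier_is_submodule s1] prime(4) s2 pb by simp
  }
qed

lemma homology_two_term:
  assumes "a \<in> carrier R" "a \<noteq> \<zero>" "primeideal P R"
  shows "hfin R P (two_term (rfun R) n a) k"
    and "hlen R P (two_term (rfun R) n a) k =
      (if k = n - 1 then plen R P (regular_mod R) (PIdl a) (carrier R) else 0)"
proof -
  let ?E = "two_term (rfun R) n a"
  have E: "is_complex R ?E" by (rule is_complex_two_term[OF module_rfun assms(1)])
  have id: "ideal (PIdl a) R" by (rule cgenideal_ideal[OF assms(1)])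
  consider "k = n" | "k = n - 1" | "k \<noteq> n" "k \<noteq> n - 1" by blast
  then have "hfin R P ?E k \<and> hlen R P ?E k = (if k = n - 1 then plen R P (regular_mod R) (PIdl a) (carrier R) else 0)"
  proof cases
    case 1
    have "cyc ?E n \<subseteq> {\<zero>\<^bsub>rfun R\<^esub>}"
    proof
      fix t assume t: "t \<in> cyc ?E n"
      then obtain c where c: "c \<in> carrier R" "t = (\<lambda>_. c)" by (auto simp: cyc_def)
      then have "(\<lambda>_::nat. a \<otimes> c) = (\<lambda>_. \<zero>)" using t by (simp add: cyc_def)
      then have "a \<otimes> c = \<zero>" by metis
      then show "t \<in> {\<zero>\<^bsub>rfun R\<^esub>}" using assms c by (simp add: integral_iff)
    qed
    then have "cyc ?E n = {\<zero>\<^bsub>rfun R\<^esub>}" "bdry ?E n = {\<zero>\<^bsub>rfun R\<^esub>}"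
      using submodule_zeroD[OF submodule_bdry[OF E], of n] bdry_subset_cyc[OF E, of n] by auto
    then show ?thesis unfolding hfin_def hlen_def 1
      using plen_refl[OF submodule_zero[OF module_rfun] assms(3)] by simp
  next
    case 2
    have "cyc ?E (n - 1) = carrier (rfun R)" by (auto simp: cyc_def)
    moreover have "bdry ?E (n - 1) = (\<lambda>x _. x) ` (PIdl a)"
      unfolding bdry_pred using assms(1) by (auto simp: cgenideal_def image_iff m_comm)
    ultimately show ?thesis unfolding hfin_def hlen_def 2
      using plen_rfun_regular[OF id, of P] cyclic_length_finite[OF _ assms(3)] assms(1,2) by simp
  next
    case 3
    then show ?thesis using hlen_zero_object[OF E assms(3), of k] by auto
  qed
  then show "hfin R P ?E k" "hlen R P ?E k = (if k = n - 1 then plen R P (regular_mod R) (PIdl a) (carrier R) else 0)"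
    by blast+
qed

lemma homology_stalk:
  shows "hfin R {\<zero>} (stalk_at (rfun R) n) k"
    and "hlen R {\<zero>} (stalk_at (rfun R) n) k = (if k = n then 1 else 0)"
proof -
  let ?E = "stalk_at (rfun R) n"
  have E: "is_complex R ?E" by (rule is_complex_stalk_at[OF module_rfun])
  have z: "ideal {\<zero>} R" by (rule primeideal.axioms(1)[OF zeroprimeideal])
  have "hfin R {\<zero>} ?E k \<and> hlen R {\<zero>} ?E k = (if k = n then 1 else 0)"
  proof (cases "k = n")
    case True
    have "cyc ?E n = carrier (rfun R)" by (auto simp: cyc_def)
    moreover have "bdry ?E n = (\<lambda>x _. x) ` {\<zero>}"
      unfolding bdry_def by auto
    ultimately show ?thesis unfolding hfin_def hlen_def True
      using plen_rfun_regular[OF z, of "{\<zero>}"] plen_zero_regular by simp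
  next
    case False
    then show ?thesis using hlen_zero_object[OF E zeroprimeideal, of k] by auto
  qed
  then show "hfin R {\<zero>} ?E k" "hlen R {\<zero>} ?E k = (if k = n then 1 else 0)" by blast+
qed

text \<open>Placing the source in degree 1 puts the homology in degree 0, where it counts with a
  positive sign.\<close>

lemma euler_two_term:
  assumes "a \<in> carrier R" "a \<noteq> \<zero>" "primeideal P R"
  shows "euler R P (two_term (rfun R) 1 a) = int (plen R P (regular_mod R) (PIdl a) (carrier R))"
proof -
  have "hbounded R P (two_term (rfun R) 1 a) 0"
    unfolding hbounded_def homology_two_term(2)[OF assms] by auto
  then show ?thesis by (simp add: euler_eq_sum homology_two_term(2)[OF assms])
qed

lemma euler_stalk: "euler R {\<zero>} (stalk_at (rfun R) 0) = 1"
proof -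
  have "hbounded R {\<zero>} (stalk_at (rfun R) 0) 0"
    unfolding hbounded_def homology_stalk(2) by auto
  then show ?thesis by (simp add: euler_eq_sum homology_stalk(2))
qed

end

section \<open>Relations between elementary complexes\<close>

text \<open>A zero object on the type of \<open>F\<close>. The cone of a map into it is a shift,
  which provides the sign rule for shifts from cones alone.\<close>

definition zero_cx :: "('a, 'm) module \<Rightarrow> ('a, 'm) cplx" where
  "zero_cx F = \<lparr>cobj = (\<lambda>k. zero_submod F), cdiff = (\<lambda>k x. \<zero>\<^bsub>F\<^esub>)\<rparr>"

lemma zero_cx_simps [simp]: "cobj (zero_cx F) k = zero_submod F" "cdiff (zero_cx F) k x = \<zero>\<^bsub>F\<^esub>"
  by (simp_all add: zero_cx_def)

lemma homotopy_isomorphic_zero: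
  assumes "is_complex R U" "is_complex R V"
    and "\<And>n. carrier (cobj U n) = {\<zero>\<^bsub>cobj U n\<^esub>}" "\<And>n. carrier (cobj V n) = {\<zero>\<^bsub>cobj V n\<^esub>}"
  shows "homotopy_isomorphic R U V"
proof (rule homotopy_isomorphicI_iso[OF assms(1,2)])
  note U = cx_module[OF assms(1)] and V = cx_module[OF assms(2)]
  show "chain_map R U V (\<lambda>n x. \<zero>\<^bsub>cobj V n\<^esub>)"
    by (rule chain_mapI[OF mod_hom_const_zero[OF U V]]) (rule mod_hom_zero[OF V V cx_diff[OF assms(2)]])
  show "chain_map R V U (\<lambda>n x. \<zero>\<^bsub>cobj U n\<^esub>)"
    by (rule chain_mapI[OF mod_hom_const_zero[OF V U]]) (rule mod_hom_zero[OF U U cx_diff[OF assms(1)]])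
qed (use assms(3,4) in auto)

context
  fixes R :: "('a, 'r) ring_scheme" (structure) and F :: "('a, 'm) module"
  assumes F: "module R F"
begin

interpretation F: module R F by (rule F)

lemma minus_zero_submod: "\<ominus>\<^bsub>zero_submod F\<^esub> \<zero>\<^bsub>F\<^esub> = \<zero>\<^bsub>F\<^esub>"
proof -
  interpret Z: module R "zero_submod F" by (rule module_zero_submod[OF F])
  show ?thesis using Z.a_inv_zero by simp
qed

lemma is_complex_zero_cx: "is_complex R (zero_cx F)"
  unfolding is_complex_def using module_zero_submod[OF F] by (auto intro!: mod_homI)

lemma chain_map_to_zero_cx: "is_complex R U \<Longrightarrow> chain_map R U (zero_cx F) (\<lambda>k x. \<zero>\<^bsub>F\<^esub>)"
  by (rule chain_mapI) (auto intro!: mod_homI)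

lemma retract_zero_cx:
  assumes "is_complex R U"
  shows "cx_retract R (zero_cx F) U"
  unfolding cx_retract_def
proof (intro exI conjI)
  show "chain_map R (zero_cx F) U (\<lambda>n x. \<zero>\<^bsub>cobj U n\<^esub>)"
    by (rule chain_mapI[OF mod_hom_const_zero[OF cx_module[OF is_complex_zero_cx] cx_module[OF assms]]])
      (rule mod_hom_zero[OF cx_module[OF assms] cx_module[OF assms] cx_diff[OF assms]])
qed (use chain_map_to_zero_cx[OF assms] in auto)

lemma transport_two_term:
  assumes "module R F'" "f \<in> mod_hom R F F'" "a \<in> carrier R"
  shows "chain_map R (two_term F n a) (two_term F' n a) (\<lambda>k. f)"
proof (rule chain_mapI)
  fix k
  interpret F': module R F' by fact
  note f = mod_homD[OF assms(2)] and f0 = mod_hom_zero[OF F assms(1,2)]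
  show "f \<in> mod_hom R (cobj (two_term F n a) k) (cobj (two_term F' n a) k)"
    by (rule mod_homI) (auto simp: f f0 split: if_splits)
  show "cdiff (two_term F' n a) k (f x) = f (cdiff (two_term F n a) k x)" if "x \<in> carrier (cobj (two_term F n a) k)" for x
    using that assms(3) by (auto simp: f f0 split: if_splits)
qed

lemma transport_stalk_at:
  assumes "module R F'" "f \<in> mod_hom R F F'"
  shows "chain_map R (stalk_at F n) (stalk_at F' n) (\<lambda>k. f)"
proof (rule chain_mapI)
  fix k
  interpret F': module R F' by fact
  note f = mod_homD[OF assms(2)] and f0 = mod_hom_zero[OF F assms(1,2)]
  show "f \<in> mod_hom R (cobj (stalk_at F n) k) (cobj (stalk_at F' n) k)"
    by (rule mod_homI) (auto simp: f f0 split: if_splits)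
qed (auto simp: mod_hom_zero[OF F assms(1,2)])

text \<open>The differentials of stalks vanish, so the sign of the cone does not show and the
  comparison is an isomorphism of complexes.\<close>

lemma two_term_cone:
  assumes a: "a \<in> carrier R"
  shows "chain_map R (stalk_at F n) (stalk_at F n) (\<lambda>k x. a \<odot>\<^bsub>F\<^esub> x)"
    and "homotopy_isomorphic R (two_term F (n + 1) a) (mapping_cone (stalk_at F n) (stalk_at F n) (\<lambda>k x. a \<odot>\<^bsub>F\<^esub> x))"
proof -
  let ?S = "stalk_at F n"
  have S: "is_complex R ?S" by (rule is_complex_stalk_at[OF F])
  show cm: "chain_map R ?S ?S (\<lambda>k x. a \<odot>\<^bsub>F\<^esub> x)"
    by (rule chain_mapI)
      (use a in \<open>auto intro!: mod_homI simp: F.smult_r_distr F.smult_assoc1[symmetric] F.R.m_comm split: if_splits\<close>)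
  let ?K = "mapping_cone ?S ?S (\<lambda>k x. a \<odot>\<^bsub>F\<^esub> x)" and ?E = "two_term F (n + 1) a"
  let ?f = "\<lambda>k t. (if k = n + 1 then t else \<zero>\<^bsub>F\<^esub>, if k = n then t else \<zero>\<^bsub>F\<^esub>)"
  let ?g = "\<lambda>(k::int) (x, y). x \<oplus>\<^bsub>F\<^esub> y"
  have E: "is_complex R ?E" by (rule is_complex_two_term[OF F a])
  have K: "is_complex R ?K" by (rule is_complex_cone[OF S S cm])
  have k: "k - 1 = n \<longleftrightarrow> k = n + 1" for k by auto
  have z: "\<ominus>\<^bsub>(if b then F else zero_submod F)\<^esub> \<zero>\<^bsub>F\<^esub> = \<zero>\<^bsub>F\<^esub>" for b
    by (simp add: minus_zero_submod F.a_inv_zero)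
  show "homotopy_isomorphic R ?E ?K"
  proof (rule homotopy_isomorphicI_iso[OF E K])
    show "chain_map R ?E ?K ?f"
      by (rule chain_mapI) (use a in \<open>auto intro!: mod_homI simp: k z minus_zero_submod F.a_inv_zero split: if_splits\<close>)
    show "chain_map R ?K ?E ?g"
      by (rule chain_mapI) (use a in \<open>auto intro!: mod_homI simp: k z minus_zero_submod F.a_inv_zero split: if_splits\<close>)
  qed (auto simp: k split: if_splits)
qed

text \<open>The cone negates the differential of its source, whence the entry
  \<open>\<ominus> a\<close>.\<close>

lemma two_term_shift:
  assumes a: "a \<in> carrier R"
  shows "homotopy_isomorphic R (two_term F (n + 1) (\<ominus> a)) (mapping_cone (two_term F n a) (zero_cx F) (\<lambda>k x. \<zero>\<^bsub>F\<^esub>))"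
proof -
  let ?A = "two_term F n a" and ?E = "two_term F (n + 1) (\<ominus> a)"
  have A: "is_complex R ?A" by (rule is_complex_two_term[OF F a])
  have E: "is_complex R ?E" by (rule is_complex_two_term[OF F]) (use a in simp)
  let ?K = "mapping_cone ?A (zero_cx F) (\<lambda>k x. \<zero>\<^bsub>F\<^esub>)"
  have K: "is_complex R ?K" by (rule is_complex_cone[OF A is_complex_zero_cx chain_map_to_zero_cx[OF A]])
  have k: "k - 1 = n \<longleftrightarrow> k = n + 1" "k - 2 = n \<longleftrightarrow> k = n + 2" "k - 2 = n - 1 \<longleftrightarrow> k = n + 1" for k by auto
  have z: "\<ominus>\<^bsub>(if b then F else zero_submod F)\<^esub> \<zero>\<^bsub>F\<^esub> = \<zero>\<^bsub>F\<^esub>" for b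
    by (simp add: minus_zero_submod F.a_inv_zero)
  show ?thesis
  proof (rule homotopy_isomorphicI_iso[OF E K])
    show "chain_map R ?E ?K (\<lambda>k t. (t, \<zero>\<^bsub>F\<^esub>))"
      by (rule chain_mapI) (use a in \<open>auto intro!: mod_homI simp: k z minus_zero_submod F.a_inv_zero F.smult_l_minus split: if_splits\<close>)
    show "chain_map R ?K ?E (\<lambda>k. fst)"
      by (rule chain_mapI) (use a in \<open>auto intro!: mod_homI simp: k z minus_zero_submod F.a_inv_zero F.smult_l_minus split: if_splits\<close>)
  qed (auto simp: k split: if_splits)
qed

lemma stalk_shift:
  "homotopy_isomorphic R (stalk_at F (n + 1)) (mapping_cone (stalk_at F n) (zero_cx F) (\<lambda>k x. \<zero>\<^bsub>F\<^esub>))"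
proof -
  let ?A = "stalk_at F n" and ?E = "stalk_at F (n + 1)"
  have A: "is_complex R ?A" by (rule is_complex_stalk_at[OF F])
  have E: "is_complex R ?E" by (rule is_complex_stalk_at[OF F])
  let ?K = "mapping_cone ?A (zero_cx F) (\<lambda>k x. \<zero>\<^bsub>F\<^esub>)"
  have K: "is_complex R ?K" by (rule is_complex_cone[OF A is_complex_zero_cx chain_map_to_zero_cx[OF A]])
  have k: "k - 1 = n \<longleftrightarrow> k = n + 1" for k by auto
  have z: "\<ominus>\<^bsub>(if b then F else zero_submod F)\<^esub> \<zero>\<^bsub>F\<^esub> = \<zero>\<^bsub>F\<^esub>" for b
    by (simp add: minus_zero_submod F.a_inv_zero)
  show ?thesis
  proof (rule homotopy_isomorphicI_iso[OF E K])
    show "chain_map R ?E ?K (\<lambda>k t. (t, \<zero>\<^bsub>F\<^esub>))"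
      by (rule chain_mapI) (auto intro!: mod_homI simp: k z minus_zero_submod F.a_inv_zero split: if_splits)
    show "chain_map R ?K ?E (\<lambda>k. fst)"
      by (rule chain_mapI) (auto intro!: mod_homI simp: k z minus_zero_submod F.a_inv_zero split: if_splits)
  qed (auto simp: k split: if_splits)
qed

text \<open>The contraction is \<open>- v\<close>, where \<open>v\<close> is the inverse of
  \<open>u\<close>: the homotopy runs from zero to the identity, so its terms have to cancel
  \<open>x\<close>.\<close>

lemma two_term_unit:
  assumes "u \<in> Units R"
  shows "homotopy_isomorphic R (two_term F n u) (zero_cx F)"
proof -
  let ?E = "two_term F n u"
  have u: "u \<in> carrier R" using assms by auto
  obtain v where v: "v \<in> carrier R" "u \<otimes> v = \<one>" "v \<otimes> u = \<one>"
    using assms by (auto simp: Units_def)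
  have E: "is_complex R ?E" by (rule is_complex_two_term[OF F u])
  have uv: "u \<odot>\<^bsub>F\<^esub> (v \<odot>\<^bsub>F\<^esub> x) = x" "v \<odot>\<^bsub>F\<^esub> (u \<odot>\<^bsub>F\<^esub> x) = x" if "x \<in> carrier F" for x
    using that u v by (simp_all add: F.smult_assoc1[symmetric])
  have to: "chain_map R ?E (zero_cx F) (\<lambda>k x. \<zero>\<^bsub>F\<^esub>)" by (rule chain_map_to_zero_cx[OF E])
  have from_: "chain_map R (zero_cx F) ?E (\<lambda>k x. \<zero>\<^bsub>F\<^esub>)"
    by (rule chain_mapI) (use u in \<open>auto intro!: mod_homI\<close>)
  have h1: "chain_homotopic R ?E ?E (\<lambda>k x. \<zero>\<^bsub>F\<^esub>) (\<lambda>k x. x)"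
  proof (rule chain_homotopicI[OF E E, where s = "\<lambda>k x. if k = n - 1 then \<ominus>\<^bsub>F\<^esub> (v \<odot>\<^bsub>F\<^esub> x) else \<zero>\<^bsub>F\<^esub>"])
    fix k
    show "(\<lambda>x. if k = n - 1 then \<ominus>\<^bsub>F\<^esub> (v \<odot>\<^bsub>F\<^esub> x) else \<zero>\<^bsub>F\<^esub>) \<in> mod_hom R (cobj ?E k) (cobj ?E (k + 1))"
      by (rule mod_homI)
        (use v(1) in \<open>auto simp: F.smult_r_distr F.minus_add F.a_ac F.smult_r_minus F.smult_assoc1[symmetric] F.R.m_comm\<close>)
    fix x assume x: "x \<in> carrier (cobj ?E k)"
    consider "k = n" | "k = n - 1" | "k \<noteq> n" "k \<noteq> n - 1" by blast
    then show "\<zero>\<^bsub>F\<^esub> = cdiff ?E (k + 1) (if k = n - 1 then \<ominus>\<^bsub>F\<^esub> (v \<odot>\<^bsub>F\<^esub> x) else \<zero>\<^bsub>F\<^esub>) \<oplus>\<^bsub>cobj ?E k\<^esub>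
      (if k - 1 = n - 1 then \<ominus>\<^bsub>F\<^esub> (v \<odot>\<^bsub>F\<^esub> (cdiff ?E k x)) else \<zero>\<^bsub>F\<^esub>) \<oplus>\<^bsub>cobj ?E k\<^esub> x"
    proof cases
      case 1
      then show ?thesis using x u by (simp add: uv F.l_neg)
    next
      case 2
      then show ?thesis using x u v(1) by (simp add: uv F.smult_r_minus F.l_neg)
    next
      case 3
      then show ?thesis using x u by auto
    qed
  qed auto
  have h2: "chain_homotopic R (zero_cx F) (zero_cx F) (\<lambda>k x. \<zero>\<^bsub>F\<^esub>) (\<lambda>k x. x)"
    by (rule chain_homotopic_cong[OF is_complex_zero_cx is_complex_zero_cx]) auto
  show ?thesis
    unfolding homotopy_isomorphic_def homotopy_equiv_def using to from_ h1 h2 by blast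
qed

text \<open>The matrix with rows \<open>(b, 0)\<close> and \<open>(1, a)\<close> is equivalent to the diagonal matrix with entries
  \<open>1\<close> and \<open>a b\<close>.\<close>

lemma two_term_mult:
  fixes n :: int
  defines "u \<equiv> \<lambda>k x. if k = n - 1 then x else \<zero>\<^bsub>F\<^esub>"
  assumes a: "a \<in> carrier R" and b: "b \<in> carrier R"
  shows "chain_map R (two_term F (n - 1) (\<ominus> b)) (two_term F n a) u"
    and "homotopy_isomorphic R (two_term F n (a \<otimes> b)) (mapping_cone (two_term F (n - 1) (\<ominus> b)) (two_term F n a) u)"
proof -
  \<comment> \<open>The entry \<open>\<ominus> b\<close> compensates the sign of the cone, whose
    differential in degree \<open>n\<close> becomes
    \<open>(x, y) \<mapsto> (b x, x + a y)\<close>.\<close>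
  let ?A = "two_term F (n - 1) (\<ominus> b)" and ?B = "two_term F n a" and ?E = "two_term F n (a \<otimes> b)"
  have A: "is_complex R ?A" by (rule is_complex_two_term[OF F]) (use b in simp)
  have B: "is_complex R ?B" by (rule is_complex_two_term[OF F a])
  have E: "is_complex R ?E" by (rule is_complex_two_term[OF F]) (use a b in simp)
  show cm: "chain_map R ?A ?B u" unfolding u_def
    by (rule chain_mapI) (use a b in \<open>auto intro!: mod_homI split: if_splits\<close>)
  let ?K = "mapping_cone ?A ?B u"
  have K: "is_complex R ?K" by (rule is_complex_cone[OF A B cm])
  \<comment> \<open>The vector \<open>(- a t, t)\<close> is killed by the row \<open>(1, a)\<close>
    and sent to \<open>- a b t\<close> by the row \<open>(b, 0)\<close>; this dictates
    \<open>- t\<close> in degree \<open>n - 1\<close>.\<close>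
  let ?f = "\<lambda>k t. if k = n then (\<ominus>\<^bsub>F\<^esub> (a \<odot>\<^bsub>F\<^esub> t), t) else if k = n - 1 then (\<ominus>\<^bsub>F\<^esub> t, \<zero>\<^bsub>F\<^esub>) else (\<zero>\<^bsub>F\<^esub>, \<zero>\<^bsub>F\<^esub>)"
  let ?g = "\<lambda>k z. if k = n then snd z else if k = n - 1 then \<ominus>\<^bsub>F\<^esub> (fst z) \<oplus>\<^bsub>F\<^esub> b \<odot>\<^bsub>F\<^esub> snd z else \<zero>\<^bsub>F\<^esub>"
  \<comment> \<open>The homotopy uses the unit entry of the matrix to eliminate the summands that it
    matches.\<close>
  let ?s = "\<lambda>k z. (if k = n - 1 then \<ominus>\<^bsub>F\<^esub> (snd z) else \<zero>\<^bsub>F\<^esub>, \<zero>\<^bsub>F\<^esub>)"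
  have z: "\<ominus>\<^bsub>(if c then F else zero_submod F)\<^esub> \<zero>\<^bsub>F\<^esub> = \<zero>\<^bsub>F\<^esub>" for c
    by (simp add: minus_zero_submod F.a_inv_zero)
  have sw: "r \<odot>\<^bsub>F\<^esub> (q \<odot>\<^bsub>F\<^esub> x) = q \<odot>\<^bsub>F\<^esub> (r \<odot>\<^bsub>F\<^esub> x)"
    if "r \<in> carrier R" "q \<in> carrier R" "x \<in> carrier F" for r q x
    using that by (simp add: F.smult_assoc1[symmetric] F.R.m_comm)
  note sm = F.smult_r_distr F.smult_r_minus F.smult_l_minus F.smult_assoc1 sw F.ag_simps z minus_zero_submod F.a_inv_zero u_def
  have f: "chain_map R ?E ?K ?f"
  proof (rule chain_mapI)
    fix k
    show "?f k \<in> mod_hom R (cobj ?E k) (cobj ?K k)"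
      by (rule mod_homI) (use a b in \<open>auto simp: sm split: if_splits\<close>)
    fix t assume t: "t \<in> carrier (cobj ?E k)"
    consider "k = n" | "k = n - 1" | "k \<noteq> n" "k \<noteq> n - 1" by blast
    then show "cdiff ?K k (?f k t) = ?f (k - 1) (cdiff ?E k t)"
      by cases (use a b t in \<open>auto simp: sm\<close>)
  qed
  have g: "chain_map R ?K ?E ?g"
  proof (rule chain_mapI)
    fix k
    show "?g k \<in> mod_hom R (cobj ?K k) (cobj ?E k)"
      by (rule mod_homI) (use a b in \<open>auto simp: sm split: if_splits\<close>)
    fix w assume "w \<in> carrier (cobj ?K k)"
    then obtain x y where w: "w = (x, y)" "x \<in> carrier (cobj ?A (k - 1))" "y \<in> carrier (cobj ?B k)" by auto
    consider "k = n" | "k = n - 1" | "k \<noteq> n" "k \<noteq> n - 1" by blast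
    then show "cdiff ?E k (?g k w) = ?g (k - 1) (cdiff ?K k w)"
      by cases (use a b w in \<open>auto simp: sm\<close>)
  qed
  have h: "chain_homotopic R ?K ?K (\<lambda>k w. ?f k (?g k w)) (\<lambda>k w. w)"
  proof (rule chain_homotopicI[OF K K _ _, where s = ?s])
    fix k
    show "?s k \<in> mod_hom R (cobj ?K k) (cobj ?K (k + 1))"
      by (rule mod_homI) (use a b in \<open>auto simp: sm split: if_splits\<close>)
    fix w assume wK: "w \<in> carrier (cobj ?K k)"
    show "?f k (?g k w) \<in> carrier (cobj ?K k)"
      by (rule mod_hom_closed[OF chain_map_hom[OF f] mod_hom_closed[OF chain_map_hom[OF g] wK]])
    obtain x y where w: "w = (x, y)" "x \<in> carrier (cobj ?A (k - 1))" "y \<in> carrier (cobj ?B k)" using wK by auto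
    consider "k = n" | "k = n - 1" | "k \<noteq> n" "k \<noteq> n - 1" by blast
    then show "?f k (?g k w) = cdiff ?K (k + 1) (?s k w) \<oplus>\<^bsub>cobj ?K k\<^esub> ?s (k - 1) (cdiff ?K k w) \<oplus>\<^bsub>cobj ?K k\<^esub> w"
      by cases (use a b w in \<open>auto simp: sm\<close>)
  qed auto
  have h': "chain_homotopic R ?E ?E (\<lambda>k t. ?g k (?f k t)) (\<lambda>k t. t)"
    by (rule chain_homotopic_cong[OF E E])
      (use a b in \<open>auto simp: sm split: if_splits\<close>)
  show "homotopy_isomorphic R ?E ?K"
    unfolding homotopy_isomorphic_def homotopy_equiv_def using f g h h' by blast
qed

end

section \<open>Grothendieck groups\<close>

lemma shift_cplx_simps [simp]:
  "cobj (shift_cplx U) n = cobj U (n - 1)"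
  "cdiff (shift_cplx U) n x = \<ominus>\<^bsub>cobj U (n - 2)\<^esub> cdiff U (n - 1) x"
  by (simp_all add: shift_cplx_def)

lemma is_complex_shift:
  assumes "is_complex R U" shows "is_complex R (shift_cplx U)"
  unfolding is_complex_def
proof (intro allI conjI ballI)
  interpret U: module R "cobj U m" for m by (rule cx_module[OF assms])
  fix n
  show "module R (cobj (shift_cplx U) n)" by (simp add: U.module_axioms)
  have d: "cdiff U (n - 1) \<in> mod_hom R (cobj U (n - 1)) (cobj U (n - 2))" for n
    using cx_diff[OF assms, of "n - 1"] by simp
  have "(\<lambda>x. \<ominus>\<^bsub>cobj U (n - 2)\<^esub> cdiff U (n - 1) x) \<in> mod_hom R (cobj U (n - 1)) (cobj U (n - 2))"
    by (rule mod_hom_uminus[OF U.module_axioms U.module_axioms d])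
  then show "cdiff (shift_cplx U) n \<in> mod_hom R (cobj (shift_cplx U) n) (cobj (shift_cplx U) (n - 1))"
    by (simp add: shift_cplx_def)
  fix x assume "x \<in> carrier (cobj (shift_cplx U) n)"
  then have x: "x \<in> carrier (cobj U (n - 1))" by simp
  have "cdiff U (n - 2) (\<ominus>\<^bsub>cobj U (n - 2)\<^esub> cdiff U (n - 1) x) = \<ominus>\<^bsub>cobj U (n - 3)\<^esub> cdiff U (n - 2) (cdiff U (n - 1) x)"
    using mod_hom_minus[OF U.module_axioms U.module_axioms cx_diff[OF assms], of _ "n - 2"] mod_hom_closed[OF d x] by simp
  also have "\<dots> = \<zero>\<^bsub>cobj U (n - 3)\<^esub>" using cx_dd[OF assms x] by (simp add: U.a_inv_zero)
  finally show "cdiff (shift_cplx U) (n - 1) (cdiff (shift_cplx U) n x) = \<zero>\<^bsub>cobj (shift_cplx U) (n - 2)\<^esub>"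
    by (simp add: U.a_inv_zero)
qed

lemma DperfD: "U \<in> Dperf R \<Longrightarrow> is_complex R U"
  unfolding Dperf_def perfect_cplx_def by blast

text \<open>Take the identities for \<open>a\<close> and \<open>b\<close>. With \<open>g\<close>
  defined through a homotopy inverse \<open>c'\<close> of \<open>c\<close>, the only square that
  does not commute strictly is the one for \<open>g\<close>, and there \<open>c c'\<close> is
  homotopic to the identity.\<close>

lemma exact_triangle_cone:
  assumes "A \<in> Dperf R" "B \<in> Dperf R" "is_complex R W" "chain_map R A B u"
    and "homotopy_isomorphic R W (mapping_cone A B u)"
  shows "\<exists>g h. exact_triangle R A B W u g h"
proof -
  note A = DperfD[OF assms(1)] and B = DperfD[OF assms(2)]
  interpret A: module R "cobj A m" for m by (rule cx_module[OF A])
  interpret B: module R "cobj B m" for m by (rule cx_module[OF B])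
  let ?K = "mapping_cone A B u"
  have K: "is_complex R ?K" by (rule is_complex_cone[OF A B assms(4)])
  obtain c where c: "homotopy_equiv R W ?K c" using assms(5) unfolding homotopy_isomorphic_def by blast
  obtain c' where c': "chain_map R W ?K c" "chain_map R ?K W c'"
    "chain_homotopic R ?K ?K (\<lambda>n x. c n (c' n x)) (\<lambda>n x. x)"
    using homotopy_equivE[OF c assms(3) K] by blast
  let ?j = "\<lambda>n y. (\<zero>\<^bsub>cobj A (n - 1)\<^esub>, y)"
  have d0: "cdiff A (n - 1) \<zero>\<^bsub>cobj A (n - 1)\<^esub> = \<zero>\<^bsub>cobj A (n - 2)\<^esub>" for n
    using mod_hom_zero[OF A.module_axioms A.module_axioms cx_diff[OF A], of "n - 1"] by simp
  have u0: "u n \<zero>\<^bsub>cobj A n\<^esub> = \<zero>\<^bsub>cobj B n\<^esub>" for n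
    by (rule mod_hom_zero[OF A.module_axioms B.module_axioms chain_map_hom[OF assms(4)]])
  have j: "chain_map R B ?K ?j"
    by (rule chain_mapI)
      (auto intro!: mod_homI simp: d0 u0 A.a_inv_zero mod_hom_closed[OF cx_diff[OF B]])
  have p: "chain_map R ?K (shift_cplx A) (\<lambda>n. fst)"
    by (rule chain_mapI) (auto intro!: mod_homI)
  note hc = mod_hom_closed[OF chain_map_hom[OF c'(1)]] and hc' = mod_hom_closed[OF chain_map_hom[OF c'(2)]]
    and hj = mod_hom_closed[OF chain_map_hom[OF j]] and hp = mod_hom_closed[OF chain_map_hom[OF p]]
    and hu = mod_hom_closed[OF chain_map_hom[OF assms(4)]]
  have 1: "chain_homotopic R A B (\<lambda>n x. u n x) (\<lambda>n x. u n x)"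
    by (rule chain_homotopic_cong[OF A B]) (use hu in auto)
  have 2: "chain_homotopic R B ?K (\<lambda>n y. c n (c' n (?j n y))) (\<lambda>n y. (\<zero>\<^bsub>cobj A (n - 1)\<^esub>, y))"
    by (rule chain_homotopic_comp[OF c'(3) B K K K _ _ j chain_map_id]) (use hc hc' in blast)+
  have 3: "chain_homotopic R W (shift_cplx A) (\<lambda>n z. fst (c n z)) (\<lambda>n z. fst (c n z))"
    by (rule chain_homotopic_cong[OF assms(3) is_complex_shift[OF A]]) (use hc hp in blast)+
  have "exact_triangle R A B W u (\<lambda>n y. c' n (?j n y)) (\<lambda>n z. fst (c n z))"
    unfolding exact_triangle_def
    using assms(1,2,4) chain_map_comp[OF B j c'(2)] chain_map_comp[OF assms(3) c'(1) p]
      homotopy_equiv_id[OF A] homotopy_equiv_id[OF B] c 1 2 3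
    by (intro conjI bexI[of _ A] bexI[of _ B] exI[of _ u] exI[of _ "\<lambda>n x. x"] exI[of _ c]) auto
  then show ?thesis by blast
qed

lemma iso_class_eq:
  assumes "homotopy_isomorphic R U V" "is_complex R U" "is_complex R V" "T \<subseteq> Dperf R"
  shows "iso_class R T U = iso_class R T V"
  unfolding iso_class_def
  using homotopy_isomorphic_trans[OF assms(1) _ assms(2,3)]
    homotopy_isomorphic_trans[OF homotopy_isomorphic_sym[OF assms(1)] _ assms(3,2)] DperfD assms(4) by blast

lemma K0_class_eq:
  assumes "homotopy_isomorphic R U V" "is_complex R U" "is_complex R V" "T \<subseteq> Dperf R"
  shows "K0_class R T U = K0_class R T V"
  unfolding K0_class_def iso_class_eq[OF assms] ..

definition K0_gens ::
  "('a, 'r) ring_scheme \<Rightarrow> ('a, nat \<Rightarrow> 'a) cplx set \<Rightarrow> (('a, nat \<Rightarrow> 'a) cplx set \<Rightarrow>\<^sub>0 int) set" where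
  "K0_gens R T = {frag_of (iso_class R T V) - frag_of (iso_class R T U) - frag_of (iso_class R T W) | U V W f g h.
        U \<in> T \<and> V \<in> T \<and> W \<in> T \<and> exact_triangle R U V W f g h}"

lemma K0_rels_eq: "K0_rels R T = generate (free_Abelian_group (iso_class R T ` T)) (K0_gens R T)"
  unfolding K0_rels_def K0_free_def K0_gens_def ..

lemma K0_gens_carrier: "K0_gens R T \<subseteq> carrier (free_Abelian_group (iso_class R T ` T))"
  unfolding K0_gens_def
  by (intro subsetI, elim CollectE exE conjE) (simp add: keys_diff_subset keys_frag_of)

lemma subgroup_K0_rels: "subgroup (K0_rels R T) (free_Abelian_group (iso_class R T ` T))"
  unfolding K0_rels_eq by (rule subgroup_generate_free[OF K0_gens_carrier])

lemma normal_K0_rels: "K0_rels R T \<lhd> free_Abelian_group (iso_class R T ` T)"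
  by (rule comm_group.subgroup_imp_normal[OF abelian_free_Abelian_group subgroup_K0_rels])

lemma group_K0: "group (K0 R T)"
  unfolding K0_def K0_free_def by (rule normal.factorgroup_is_group[OF normal_K0_rels])

definition K0_coset ::
  "('a, 'r) ring_scheme \<Rightarrow> ('a, nat \<Rightarrow> 'a) cplx set \<Rightarrow> (('a, nat \<Rightarrow> 'a) cplx set \<Rightarrow>\<^sub>0 int) \<Rightarrow>
   (('a, nat \<Rightarrow> 'a) cplx set \<Rightarrow>\<^sub>0 int) set" where
  "K0_coset R T c = K0_rels R T #>\<^bsub>K0_free R T\<^esub> c"

lemma K0_class_coset: "K0_class R T U = K0_coset R T (frag_of (iso_class R T U))"
  by (simp add: K0_class_def K0_coset_def)

lemma K0_coset_eq_iff: "K0_coset R T a = K0_coset R T b \<longleftrightarrow> a - b \<in> K0_rels R T"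
  unfolding K0_coset_def K0_free_def by (rule coset_free_eq_iff[OF subgroup_K0_rels])

lemma carrier_K0: "carrier (K0 R T) = K0_coset R T ` {c. Poly_Mapping.keys c \<subseteq> iso_class R T ` T}"
  by (auto simp: K0_def K0_coset_def K0_free_def FactGroup_def RCOSETS_def)

lemma one_K0: "\<one>\<^bsub>K0 R T\<^esub> = K0_coset R T 0"
  by (simp add: K0_def K0_coset_def K0_free_def FactGroup_def coset_free)

lemma mult_K0: "K0_coset R T a \<otimes>\<^bsub>K0 R T\<^esub> K0_coset R T b = K0_coset R T (a + b)"
  unfolding K0_coset_def K0_def K0_free_def FactGroup_def
  using set_mult_coset_free[OF subgroup_K0_rels] by simp

lemma K0_rels_cone:
  assumes "A \<in> T" "B \<in> T" "W \<in> T" "T \<subseteq> Dperf R" "chain_map R A B u"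
    and "homotopy_isomorphic R W (mapping_cone A B u)"
  shows "frag_of (iso_class R T B) - frag_of (iso_class R T A) - frag_of (iso_class R T W) \<in> K0_rels R T"
proof -
  have "A \<in> Dperf R" "B \<in> Dperf R" "is_complex R W" using assms(1-4) DperfD by blast+
  then have "\<exists>g h. exact_triangle R A B W u g h" using exact_triangle_cone assms(5,6) by blast
  then show ?thesis unfolding K0_rels_eq K0_gens_def using assms(1-3) by (blast intro: generate.incl)
qed

text \<open>The integers are realised as formal sums over the one-point type, so that
  \<open>frag_extend\<close> and its rules apply; the coefficient is read off at the end.\<close>

definition linear_ext :: "('c \<Rightarrow> int) \<Rightarrow> ('c \<Rightarrow>\<^sub>0 int) \<Rightarrow> int" where
  "linear_ext e c = Poly_Mapping.lookup (frag_extend (\<lambda>C. frag_cmul (e C) (frag_of ())) c) ()"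

lemma linear_ext_simps [simp]:
  "linear_ext e 0 = 0" "linear_ext e (frag_of C) = e C" "linear_ext e (a + b) = linear_ext e a + linear_ext e b"
  "linear_ext e (- a) = - linear_ext e a" "linear_ext e (a - b) = linear_ext e a - linear_ext e b"
  by (simp_all add: linear_ext_def frag_extend_add frag_extend_minus frag_extend_diff lookup_add lookup_minus)

lemma linear_ext_cmul: "linear_ext e (frag_cmul m c) = m * linear_ext e c"
  by (simp add: linear_ext_def frag_extend_cmul)

text \<open>The choice of a representative is harmless: members of an isomorphism class are homotopy
  isomorphic and have the same Euler characteristic.\<close>

definition euler_class ::
  "('a, 'r) ring_scheme \<Rightarrow> 'a set \<Rightarrow> ('a, nat \<Rightarrow> 'a) cplx set \<Rightarrow> int" where
  "euler_class R P C = euler R P (SOME U. U \<in> C)"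

lemma euler_class_iso_class:
  assumes "U \<in> T" "T \<subseteq> Dperf R"
  shows "euler_class R P (iso_class R T U) = euler R P U"
proof -
  have U: "is_complex R U" using assms DperfD by blast
  have "U \<in> iso_class R T U" unfolding iso_class_def using assms(1) homotopy_isomorphic_refl[OF U] by blast
  then have "(SOME V. V \<in> iso_class R T U) \<in> iso_class R T U" by (rule someI)
  then have V: "(SOME V. V \<in> iso_class R T U) \<in> T" "homotopy_isomorphic R U (SOME V. V \<in> iso_class R T U)"
    unfolding iso_class_def by blast+
  then show ?thesis unfolding euler_class_def
    using euler_homotopy_isomorphic(1)[OF V(2) U] DperfD assms(2) by (metis subsetD)
qed

text \<open>The triangle agrees with a cone triangle only up to homotopy, so finiteness is first
  moved to \<open>A\<close> and \<open>B\<close>; their perfectness bounds the homology.\<close>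

lemma euler_exact_triangle:
  assumes "exact_triangle R U V W f g h" "is_complex R U" "is_complex R V" "is_complex R W" "primeideal P R"
    and "\<And>n. hfin R P U n" "\<And>n. hfin R P V n"
  shows "euler R P V = euler R P U + euler R P W"
proof -
  obtain A B u a b c where AB: "A \<in> Dperf R" "B \<in> Dperf R" "chain_map R A B u"
    "homotopy_equiv R U A a" "homotopy_equiv R V B b" "homotopy_equiv R W (mapping_cone A B u) c"
    using assms(1) unfolding exact_triangle_def by blast
  note A = DperfD[OF AB(1)] and B = DperfD[OF AB(2)]
  have K: "is_complex R (mapping_cone A B u)" by (rule is_complex_cone[OF A B AB(3)])
  have iso: "homotopy_isomorphic R U A" "homotopy_isomorphic R V B" "homotopy_isomorphic R W (mapping_cone A B u)"
    using AB unfolding homotopy_isomorphic_def by blast+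
  have fin: "hfin R P A n" "hfin R P B n" for n
    using assms(6,7) hfin_homotopy_isomorphic[OF iso(1) assms(2) A] hfin_homotopy_isomorphic[OF iso(2) assms(3) B] by blast+
  obtain N N' where "hbounded R P A N" "hbounded R P B N'"
    using hbounded_perfect[OF _ assms(5)] AB(1,2) unfolding Dperf_def by blast
  then have "euler R P (mapping_cone A B u) = euler R P B - euler R P A"
    by (rule euler_cone[OF A B AB(3) assms(5) fin])
  then show ?thesis
    using euler_homotopy_isomorphic(1)[OF iso(1) assms(2) A] euler_homotopy_isomorphic(1)[OF iso(2) assms(3) B]
      euler_homotopy_isomorphic(1)[OF iso(3) assms(4) K] by simp
qed

lemma linear_ext_K0_rels:
  assumes "T \<subseteq> Dperf R" "primeideal P R" "\<And>U n. U \<in> T \<Longrightarrow> hfin R P U n" "c \<in> K0_rels R T"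
  shows "linear_ext (euler_class R P) c = 0"
  using assms(4) unfolding K0_rels_eq
proof (elim generate_free_induct[OF _ K0_gens_carrier])
  fix a assume "a \<in> K0_gens R T"
  then obtain U V W f g h where t: "U \<in> T" "V \<in> T" "W \<in> T" "exact_triangle R U V W f g h"
    "a = frag_of (iso_class R T V) - frag_of (iso_class R T U) - frag_of (iso_class R T W)"
    unfolding K0_gens_def by blast
  have "euler R P V = euler R P U + euler R P W"
    by (rule euler_exact_triangle[OF t(4) _ _ _ assms(2)]) (use t assms(1,3) DperfD in blast)+
  then show "linear_ext (euler_class R P) a = 0"
    using t(1-3) unfolding t(5) by (simp add: euler_class_iso_class[OF _ assms(1)])
qed simp_all


section \<open>The Grothendieck group over a principal ideal domain\<close>

context principal_domain
begin

context
  fixes S :: "'a set set"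
begin

abbreviation "T \<equiv> T_supp R S"
abbreviation "cl U \<equiv> frag_of (iso_class R T U)"
abbreviation "tt n a \<equiv> two_term (rfun R) n a"
abbreviation "st n \<equiv> stalk_at (rfun R) n"
abbreviation "Z \<equiv> zero_cx (rfun R)"

lemma T_Dperf: "T \<subseteq> Dperf R"
  unfolding T_supp_def by blast

lemma T_perfect: "U \<in> T \<Longrightarrow> perfect_cplx R U"
  unfolding T_supp_def Dperf_def by blast

lemma T_retract:
  assumes "U \<in> T" "cx_retract R E U" "perfect_cplx R E"
  shows "E \<in> T"
  using assms Supp_retract[OF assms(2) perfect_cplxD(1)[OF assms(3)] perfect_cplxD(1)[OF T_perfect[OF assms(1)]] is_cring]
  unfolding T_supp_def Dperf_def by blast

lemma perfect_Z: "perfect_cplx R Z"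
  unfolding perfect_cplx_def
  using is_complex_zero_cx[OF module_rfun] fg_projective_zero_submod[OF fg_projective_rfun] by auto

lemma Z_T: "U \<in> T \<Longrightarrow> Z \<in> T"
  by (rule T_retract[OF _ retract_zero_cx[OF module_rfun] perfect_Z]) (auto dest: T_perfect perfect_cplxD(1))

text \<open>The copies of the complex on \<open>regular_mod R\<close> and on \<open>rfun R\<close>
  are retracts of each other, so the support computed for the former applies.\<close>

lemma Supp_tt:
  assumes "a \<in> carrier R"
  shows "Supp R (tt n a) = {P \<in> Spec R. a \<in> P}"
proof -
  have F: "module R (regular_mod R)" by (rule module_regular[OF is_cring])
  note cm = transport_two_term[OF F module_rfun mod_hom_const assms] transport_two_term[OF module_rfun F mod_hom_eval assms]
  have "cx_retract R (tt n a) (two_term (regular_mod R) n a)"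
    unfolding cx_retract_def by (intro exI conjI, rule cm(2), rule cm(1)) auto
  moreover have "cx_retract R (two_term (regular_mod R) n a) (tt n a)"
    unfolding cx_retract_def by (intro exI conjI, rule cm(1), rule cm(2)) auto
  ultimately have "Supp R (tt n a) = Supp R (two_term (regular_mod R) n a)"
    using Supp_retract[OF _ is_complex_two_term[OF F assms] is_complex_two_term[OF module_rfun assms] is_cring]
      Supp_retract[OF _ is_complex_two_term[OF module_rfun assms] is_complex_two_term[OF F assms] is_cring] by blast
  then show ?thesis using Supp_two_term[OF is_cring assms] by simp
qed

lemma Supp_st: "Supp R (st n) = Spec R"
proof -
  have F: "module R (regular_mod R)" by (rule module_regular[OF is_cring])
  note cm = transport_stalk_at[OF F module_rfun mod_hom_const] transport_stalk_at[OF module_rfun F mod_hom_eval]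
  have "cx_retract R (stalk_at (regular_mod R) n) (st n)"
    unfolding cx_retract_def by (intro exI conjI, rule cm(1), rule cm(2)) auto
  then have "Spec R \<subseteq> Supp R (st n)"
    using Supp_retract[OF _ is_complex_stalk_at[OF F] is_complex_stalk_at[OF module_rfun] is_cring]
      Supp_stalk_at[OF is_cring] by blast
  then show ?thesis unfolding Supp_def by blast
qed

lemma tt_T_iff: "a \<in> carrier R \<Longrightarrow> tt n a \<in> T \<longleftrightarrow> {P \<in> Spec R. a \<in> P} \<subseteq> S"
  using perfect_two_term Supp_tt unfolding T_supp_def Dperf_def by blast

lemma st_T_iff: "st n \<in> T \<longleftrightarrow> Spec R \<subseteq> S"
  using perfect_stalk_at Supp_st unfolding T_supp_def Dperf_def by blast

lemma tt_T_shift: "a \<in> carrier R \<Longrightarrow> tt n a \<in> T \<Longrightarrow> tt m a \<in> T"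
  using tt_T_iff by blast

lemma tt_T_neg:
  assumes "a \<in> carrier R" "tt n a \<in> T" shows "tt m (\<ominus> a) \<in> T"
proof -
  have "a \<in> P" if "P \<in> Spec R" "\<ominus> a \<in> P" for P
  proof -
    interpret P: primeideal P R using that(1) by (simp add: Spec_def)
    show ?thesis using P.a_inv_closed[OF that(2)] assms(1) by simp
  qed
  then show ?thesis using assms tt_T_iff by blast
qed

lemma Spec_mult_mem:
  assumes "P \<in> Spec R" "a \<in> carrier R" "b \<in> carrier R"
  shows "a \<otimes> b \<in> P \<longleftrightarrow> a \<in> P \<or> b \<in> P"
proof -
  interpret P: primeideal P R using assms(1) by (simp add: Spec_def)
  show ?thesis using P.I_prime[OF assms(2,3)] P.I_l_closed P.I_r_closed assms(2,3) by blast
qed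

lemma tt_T_mult:
  assumes "a \<in> carrier R" "b \<in> carrier R"
  shows "tt n (a \<otimes> b) \<in> T \<longleftrightarrow> tt n a \<in> T \<and> tt n b \<in> T"
  using assms Spec_mult_mem tt_T_iff by auto

lemma tt_T_unit:
  assumes "u \<in> Units R" shows "tt n u \<in> T"
proof -
  have "u \<notin> P" if "P \<in> Spec R" for P
  proof
    interpret P: primeideal P R using that by (simp add: Spec_def)
    assume "u \<in> P"
    then have "carrier R \<subseteq> P"
      using assms P.I_l_closed[of u] P.one_imp_carrier by (metis Units_l_inv_ex order_refl)
    then show False using P.I_notcarr P.Icarr by blast
  qed
  then show ?thesis using tt_T_iff assms by auto
qed

text \<open>\<open>L\<close> is the preimage of a subgroup of \<open>K\<^sub>0\<close> in the free abelian group.\<close>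

context
  fixes L :: "(('a, nat \<Rightarrow> 'a) cplx set \<Rightarrow>\<^sub>0 int) set"
  assumes LH: "K0_rels R T \<subseteq> L"
    and Ladd: "\<And>a b. a \<in> L \<Longrightarrow> b \<in> L \<Longrightarrow> a + b \<in> L" and Lneg: "\<And>a. a \<in> L \<Longrightarrow> - a \<in> L"
begin

lemma L_diff: "a \<in> L \<Longrightarrow> b \<in> L \<Longrightarrow> a - b \<in> L"
  using Ladd[of a "- b"] Lneg[of b] by simp

lemma L_diff_iff: "a - b \<in> L \<Longrightarrow> a \<in> L \<longleftrightarrow> b \<in> L"
  using Ladd[of "a - b" b] L_diff[of a "a - b"] by auto

lemma L_triangle:
  assumes "A \<in> T" "B \<in> T" "W \<in> T" "chain_map R A B u" "homotopy_isomorphic R W (mapping_cone A B u)"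
  shows "cl B - cl A - cl W \<in> L"
  using K0_rels_cone[OF assms(1-3) T_Dperf assms(4,5)] LH by blast

text \<open>A zero complex is isomorphic to the cone of its own identity, and that triangle reads
  \<open>[U] = [U] + [U]\<close>.\<close>

lemma L_zero:
  assumes "U \<in> T" "\<And>n. carrier (cobj U n) = {\<zero>\<^bsub>cobj U n\<^esub>}"
  shows "cl U \<in> L"
proof -
  have U: "is_complex R U" by (rule perfect_cplxD(1)[OF T_perfect[OF assms(1)]])
  have "homotopy_isomorphic R U (mapping_cone U U (\<lambda>n x. x))"
    by (rule homotopy_isomorphic_zero[OF U is_complex_cone[OF U U chain_map_id] assms(2)]) (simp add: assms(2))
  then have "cl U - cl U - cl U \<in> L" by (rule L_triangle[OF assms(1,1,1) chain_map_id])
  then show ?thesis using Lneg by fastforce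
qed

lemma L_zero_cx: "U \<in> T \<Longrightarrow> cl Z \<in> L"
  by (rule L_zero[OF Z_T]) auto

lemma L_shift:
  assumes a: "a \<in> carrier R" "tt n a \<in> T"
  shows "cl (tt n a) + cl (tt (n + 1) (\<ominus> a)) \<in> L"
proof -
  have cm: "chain_map R (tt n a) Z (\<lambda>k x. \<zero>\<^bsub>rfun R\<^esub>)"
    by (rule chain_map_to_zero_cx[OF module_rfun is_complex_two_term[OF module_rfun a(1)]])
  have "cl Z - cl (tt n a) - cl (tt (n + 1) (\<ominus> a)) \<in> L"
    by (rule L_triangle[OF a(2) Z_T[OF a(2)] tt_T_neg[OF a] cm two_term_shift[OF module_rfun a(1)]])
  from L_diff[OF L_zero_cx[OF a(2)] this] show ?thesis by (simp add: add.commute)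
qed

lemma L_stalk_shift:
  assumes "st n \<in> T"
  shows "cl (st n) + cl (st (n + 1)) \<in> L"
proof -
  have cm: "chain_map R (st n) Z (\<lambda>k x. \<zero>\<^bsub>rfun R\<^esub>)"
    by (rule chain_map_to_zero_cx[OF module_rfun is_complex_stalk_at[OF module_rfun]])
  have s: "st (n + 1) \<in> T" using assms st_T_iff by blast
  have "cl Z - cl (st n) - cl (st (n + 1)) \<in> L"
    by (rule L_triangle[OF assms Z_T[OF assms] s cm stalk_shift[OF module_rfun]])
  from L_diff[OF L_zero_cx[OF assms] this] show ?thesis by (simp add: add.commute)
qed

text \<open>The complex is the cone of an endomorphism of a stalk, so its class is
  \<open>[R] - [R]\<close> up to sign.\<close>

lemma L_two_term_stalk:
  assumes "a \<in> carrier R" "st n \<in> T" "tt (n + 1) a \<in> T"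
  shows "cl (tt (n + 1) a) \<in> L"
proof -
  have "cl (st n) - cl (st n) - cl (tt (n + 1) a) \<in> L"
    by (rule L_triangle[OF assms(2,2,3) two_term_cone[OF module_rfun assms(1)]])
  then show ?thesis using Lneg by fastforce
qed

lemma L_unit:
  assumes "u \<in> Units R"
  shows "cl (tt n u) \<in> L"
proof -
  have "iso_class R T (tt n u) = iso_class R T Z"
    by (rule iso_class_eq[OF two_term_unit[OF module_rfun assms] is_complex_two_term[OF module_rfun]
          is_complex_zero_cx[OF module_rfun] T_Dperf]) (use assms in auto)
  then show ?thesis using L_zero_cx[OF tt_T_unit[OF assms]] by simp
qed

text \<open>The triangle of \<open>two_term_mult\<close> involves \<open>\<ominus> b\<close> in
  degree \<open>n - 1\<close>; the shift relation trades it for \<open>b\<close> in degree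
  \<open>n\<close>, up to sign.\<close>

lemma L_mult:
  assumes a: "a \<in> carrier R" and b: "b \<in> carrier R" and ab: "tt n (a \<otimes> b) \<in> T"
  shows "cl (tt n (a \<otimes> b)) - cl (tt n a) - cl (tt n b) \<in> L"
proof -
  have T: "tt n a \<in> T" "tt n b \<in> T" using tt_T_mult[OF a b] ab by auto
  have T': "tt (n - 1) (\<ominus> b) \<in> T" by (rule tt_T_neg[OF b T(2)])
  have 1: "cl (tt n a) - cl (tt (n - 1) (\<ominus> b)) - cl (tt n (a \<otimes> b)) \<in> L"
    by (rule L_triangle[OF T' T(1) ab two_term_mult[OF module_rfun a b]])
  have 2: "cl (tt (n - 1) (\<ominus> b)) + cl (tt n b) \<in> L"
    using L_shift[OF _ T'] b by simp
  have "- ((cl (tt n a) - cl (tt (n - 1) (\<ominus> b)) - cl (tt n (a \<otimes> b))) + (cl (tt (n - 1) (\<ominus> b)) + cl (tt n b))) \<in> L"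
    by (rule Lneg[OF Ladd[OF 1 2]])
  then show ?thesis by (simp add: algebra_simps)
qed

lemma L_unit_mult:
  assumes "u \<in> Units R" "b \<in> carrier R" "tt n b \<in> T"
  shows "cl (tt n (u \<otimes> b)) \<in> L \<longleftrightarrow> cl (tt n b) \<in> L"
proof -
  have u: "u \<in> carrier R" using assms(1) by auto
  have "tt n (u \<otimes> b) \<in> T" using tt_T_mult[OF u assms(2)] tt_T_unit[OF assms(1)] assms(3) by blast
  from Ladd[OF L_mult[OF u assms(2) this] L_unit[OF assms(1), of n]]
  have "cl (tt n (u \<otimes> b)) - cl (tt n b) \<in> L" by (simp add: algebra_simps)
  then show ?thesis by (rule L_diff_iff)
qed

text \<open>A shift changes the entry to \<open>\<ominus> a\<close>; the factor
  \<open>\<ominus> \<one>\<close> is a unit and does not affect the class.\<close>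

lemma L_two_term_Suc:
  assumes a: "a \<in> carrier R" "tt n a \<in> T"
  shows "cl (tt (n + 1) a) \<in> L \<longleftrightarrow> cl (tt n a) \<in> L"
proof -
  have u: "\<ominus> \<one> \<in> Units R" by (rule Units_minus_one_closed)
  have eq: "\<ominus> \<one> \<otimes> a = \<ominus> a" using a(1) by (simp add: l_minus)
  have "cl (tt (n + 1) (\<ominus> a)) \<in> L \<longleftrightarrow> cl (tt (n + 1) a) \<in> L"
    using L_unit_mult[OF u a(1) tt_T_shift[OF a, of "n + 1"]] unfolding eq .
  moreover have "cl (tt n a) - (- cl (tt (n + 1) (\<ominus> a))) \<in> L" using L_shift[OF a] by simp
  then have "cl (tt n a) \<in> L \<longleftrightarrow> - cl (tt (n + 1) (\<ominus> a)) \<in> L" by (rule L_diff_iff)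
  ultimately show ?thesis using Lneg[of "cl (tt (n + 1) (\<ominus> a))"] Lneg[of "- cl (tt (n + 1) (\<ominus> a))"] by auto
qed

lemma L_two_term_any:
  assumes a: "a \<in> carrier R" "tt m a \<in> T" "cl (tt m a) \<in> L"
  shows "cl (tt n a) \<in> L"
proof (induction n rule: int_induct[of _ m])
  case (step1 i)
  then show ?case using L_two_term_Suc[OF a(1) tt_T_shift[OF a(1,2), of i]] by blast
next
  case (step2 i)
  then show ?case using L_two_term_Suc[OF a(1) tt_T_shift[OF a(1,2), of "i - 1"]] by simp
qed (rule a(3))

lemma L_stalk_any:
  assumes "st m \<in> T" "cl (st m) \<in> L"
  shows "cl (st n) \<in> L"
proof -
  have s: "st i \<in> T" for i using assms st_T_iff by blast
  have Suc: "cl (st (i + 1)) \<in> L \<longleftrightarrow> cl (st i) \<in> L" for i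
  proof -
    have "cl (st i) - (- cl (st (i + 1))) \<in> L" using L_stalk_shift[OF s] by simp
    then have "cl (st i) \<in> L \<longleftrightarrow> - cl (st (i + 1)) \<in> L" by (rule L_diff_iff)
    then show ?thesis using Lneg[of "cl (st (i + 1))"] Lneg[of "- cl (st (i + 1))"] by auto
  qed
  show ?thesis
  proof (induction n rule: int_induct[of _ m])
    case (step1 i)
    then show ?case using Suc by blast
  next
    case (step2 i)
    then show ?case using Suc[of "i - 1"] by simp
  qed (rule assms(2))
qed

text \<open>Both parts of a splitting are retracts of \<open>U\<close> and therefore lie in
  \<open>T\<close>, so the triangle of \<open>cone_compl\<close> is available inside
  \<open>T\<close> at every stage.\<close>

lemma L_generated:
  assumes el: "\<And>E. elementary R E \<Longrightarrow> E \<in> T \<Longrightarrow> cl E \<in> L" and U: "U \<in> T"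
  shows "cl U \<in> L"
  using T_perfect[OF U] U
proof (induction U rule: perfect_induct)
  case (zero U)
  then show ?case by (intro L_zero)
next
  case (split E U i r)
  interpret cplx_split R E U i r by fact
  have E_T: "E \<in> T" by (rule T_retract[OF split.prems retract_E perfect_elementary[OF split.hyps(2)]])
  have C_T: "C \<in> T" by (rule T_retract[OF split.prems retract_compl perfect_compl[OF split.hyps(1)]])
  have "cl U - cl E - cl C \<in> L"
    by (rule L_triangle[OF E_T split.prems C_T i cone_compl])
  from Ladd[OF this Ladd[OF el[OF split.hyps(2) E_T] split.IH[OF C_T]]]
  show ?case by (simp add: algebra_simps)
qed

lemma L_all_two_term:
  assumes gen: "\<And>p. p \<in> carrier R - {\<zero>} \<Longrightarrow> primeideal (PIdl p) R \<Longrightarrow> tt 1 p \<in> T \<Longrightarrow> cl (tt 1 p) \<in> L"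
    and "a \<in> carrier R - {\<zero>}" "tt n a \<in> T"
  shows "cl (tt n a) \<in> L"
  using assms(2,3)
proof (induction a rule: factor_induct)
  case (unit u)
  then show ?case by (intro L_unit)
next
  case (prime p b)
  have pb: "p \<in> carrier R" "b \<in> carrier R" using prime.hyps by auto
  have T: "tt n p \<in> T" "tt n b \<in> T" using tt_T_mult[OF pb] prime.prems by auto
  have "cl (tt 1 p) \<in> L" by (rule gen[OF prime.hyps(1,2) tt_T_shift[OF pb(1) T(1)]])
  then have "cl (tt n p) \<in> L" by (rule L_two_term_any[OF pb(1) tt_T_shift[OF pb(1) T(1)]])
  from Ladd[OF L_mult[OF pb prime.prems] Ladd[OF this prime.IH[OF T(2)]]]
  show ?case by (simp add: algebra_simps)
qed

end

lemma hfin_perfect_zero: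
  fixes U :: "('a, nat \<Rightarrow> 'a) cplx"
  assumes "perfect_cplx R U"
  shows "hfin R {\<zero>} U n"
  using assms
proof (induction U arbitrary: n rule: perfect_induct)
  case (zero U n)
  then show ?case using hlen_zero_object(1)[OF perfect_cplxD(1) zeroprimeideal] by blast
next
  case (split E U i r n)
  interpret cplx_split R E U i r by fact
  have "hfin R {\<zero>} E n"
    using split.hyps(2) homology_stalk(1) homology_two_term(1)[OF _ _ zeroprimeideal]
    unfolding elementary_def by auto
  then show ?case by (rule hfin_split[OF zeroprimeideal _ split.IH])
qed

text \<open>At a nonzero prime a stalk has infinite length. No summand can be a stalk here, because
  a stalk has full support.\<close>

lemma hfin_T:
  assumes "\<not> Spec R \<subseteq> S" "primeideal P R" "U \<in> T"
  shows "hfin R P U n"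
  using T_perfect[OF assms(3)] assms(3)
proof (induction U arbitrary: n rule: perfect_induct)
  case (zero U n)
  then show ?case using hlen_zero_object(1)[OF perfect_cplxD(1) assms(2)] by blast
next
  case (split E U i r n)
  interpret cplx_split R E U i r by fact
  have E_T: "E \<in> T" by (rule T_retract[OF split.prems retract_E perfect_elementary[OF split.hyps(2)]])
  have C_T: "C \<in> T" by (rule T_retract[OF split.prems retract_compl perfect_compl[OF split.hyps(1)]])
  have "hfin R P E n"
    using split.hyps(2) E_T st_T_iff assms(1) homology_two_term(1)[OF _ _ assms(2)]
    unfolding elementary_def by auto
  then show ?case by (rule hfin_split[OF assms(2) _ split.IH[OF C_T]])
qed

lemma K0_class_stalk: "K0_class R T (stalk_cplx (regular_mod R)) = K0_coset R T (cl (st 0))"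
proof -
  have F: "module R (regular_mod R)" by (rule module_regular[OF is_cring])
  have eq: "stalk_cplx (regular_mod R) = stalk_at (regular_mod R) 0"
    by (simp add: stalk_cplx_def stalk_at_def)
  have "homotopy_isomorphic R (stalk_at (regular_mod R) 0) (st 0)"
    by (rule homotopy_isomorphicI_iso[OF is_complex_stalk_at[OF F] is_complex_stalk_at[OF module_rfun]
          transport_stalk_at[OF F module_rfun mod_hom_const] transport_stalk_at[OF module_rfun F mod_hom_eval]])
      (auto split: if_splits)
  then show ?thesis unfolding eq K0_class_coset[symmetric]
    by (rule K0_class_eq[OF _ is_complex_stalk_at[OF F] is_complex_stalk_at[OF module_rfun] T_Dperf])
qed

text \<open>The Moore complex lives on pairs; its class is computed through the isomorphic two-term
  complexes, first on \<open>regular_mod R\<close> and then on \<open>rfun R\<close>.\<close>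

lemma K0_class_moore:
  assumes a: "a \<in> carrier R"
  shows "K0_class R T (moore_cplx R a) = K0_coset R T (cl (tt 1 a))"
proof -
  let ?F = "regular_mod R"
  have F: "module R ?F" by (rule module_regular[OF is_cring])
  have eq: "moore_cplx R a = mapping_cone (stalk_at ?F 0) (stalk_at ?F 0) (\<lambda>k x. a \<odot>\<^bsub>?F\<^esub> x)"
    by (simp add: moore_cplx_def stalk_cplx_def stalk_at_def)
  note tF = is_complex_two_term[OF F a, of 1] and tR = is_complex_two_term[OF module_rfun a, of 1]
  have K: "is_complex R (moore_cplx R a)" unfolding eq
    by (rule is_complex_cone[OF is_complex_stalk_at[OF F] is_complex_stalk_at[OF F] two_term_cone(1)[OF F a]])
  have "homotopy_isomorphic R (two_term ?F 1 a) (moore_cplx R a)"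
    using two_term_cone(2)[OF F a, of 0] unfolding eq by simp
  moreover have "homotopy_isomorphic R (two_term ?F 1 a) (tt 1 a)"
    by (rule homotopy_isomorphicI_iso[OF tF tR
          transport_two_term[OF F module_rfun mod_hom_const a] transport_two_term[OF module_rfun F mod_hom_eval a]])
      (auto split: if_splits)
  ultimately have "homotopy_isomorphic R (moore_cplx R a) (tt 1 a)"
    using homotopy_isomorphic_trans[OF homotopy_isomorphic_sym _ K tF tR] by blast
  then show ?thesis unfolding K0_class_coset[symmetric] by (rule K0_class_eq[OF _ K tR T_Dperf])
qed

lemma K0_Spec:
  assumes S: "S = Spec R"
  shows "K0_class R T (stalk_cplx (regular_mod R)) \<in> carrier (K0 R T)"
    and "generate (K0 R T) {K0_class R T (stalk_cplx (regular_mod R))} = carrier (K0 R T)"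
    and "infinite (carrier (K0 R T))"
proof -
  interpret K: group "K0 R T" by (rule group_K0)
  let ?I = "iso_class R T ` T"
  let ?k = "K0_coset R T (cl (st 0))"
  have sT: "st n \<in> T" for n using st_T_iff S by blast
  have clI: "Poly_Mapping.keys (cl U) \<subseteq> ?I" if "U \<in> T" for U using that by (simp add: keys_frag_of)
  have kc: "?k \<in> carrier (K0 R T)" unfolding carrier_K0 using clI[OF sT] by blast
  then show "K0_class R T (stalk_cplx (regular_mod R)) \<in> carrier (K0 R T)" unfolding K0_class_stalk .
  note sg = subgroup_freeD[OF subgroup_K0_rels[of R T]]
  \<comment> \<open>The preimage of the subgroup generated by the class of \<open>R\<close>; it
    remains to put the elementary complexes into it.\<close>
  define L where "L = {c. Poly_Mapping.keys c \<subseteq> ?I \<and> K0_coset R T c \<in> generate (K0 R T) {?k}}"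
  have LH: "K0_rels R T \<subseteq> L"
  proof
    fix h assume h: "h \<in> K0_rels R T"
    then have "K0_coset R T h = \<one>\<^bsub>K0 R T\<^esub>" unfolding one_K0 K0_coset_eq_iff by simp
    then show "h \<in> L" unfolding L_def using sg(1)[OF h] generate.one by auto
  qed
  have Ladd: "a + b \<in> L" if "a \<in> L" "b \<in> L" for a b
    using that generate.eng[of "K0_coset R T a" "K0 R T" "{?k}" "K0_coset R T b"]
    unfolding L_def by (auto simp: mult_K0 intro: keys_plus_subset[THEN subsetD])
  have Lneg: "- a \<in> L" if "a \<in> L" for a
  proof -
    have a: "Poly_Mapping.keys a \<subseteq> ?I" "K0_coset R T a \<in> generate (K0 R T) {?k}" using that unfolding L_def by auto
    have "inv\<^bsub>K0 R T\<^esub> K0_coset R T a = K0_coset R T (- a)"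
      by (rule K.inv_equality) (use a in \<open>auto simp: mult_K0 one_K0 carrier_K0\<close>)
    then show ?thesis using K.generate_m_inv_closed[OF _ a(2)] kc a(1) unfolding L_def by simp
  qed
  have st0: "cl (st 0) \<in> L" unfolding L_def using clI[OF sT] by (simp add: generate.incl)
  have "cl E \<in> L" if E: "elementary R E" "E \<in> T" for E
    using E(1) unfolding elementary_def
  proof (elim disjE exE conjE)
    fix n assume "E = st n"
    then show ?thesis using L_stalk_any[OF LH Ladd Lneg sT st0] by simp
  next
    fix n a assume "a \<in> carrier R - {\<zero>}" "E = tt n a"
    then show ?thesis using L_two_term_stalk[OF LH Ladd Lneg _ sT, of a "n - 1"] E(2) by simp
  qed
  then have cl: "cl U \<in> L" if "U \<in> T" for U using L_generated[OF LH Ladd Lneg _ that] by blast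
  have "c \<in> L" if "Poly_Mapping.keys c \<subseteq> ?I" for c
    using that
  proof (induction c rule: free_induct)
    case zero
    then show ?case using LH sg(2) by blast
  next
    case (diff x y)
    then show ?case using Ladd[OF diff(3) Lneg[OF diff(4)]] by simp
  qed (use cl in auto)
  then have "carrier (K0 R T) \<subseteq> generate (K0 R T) {?k}" unfolding carrier_K0 L_def by blast
  moreover have "generate (K0 R T) {?k} \<subseteq> carrier (K0 R T)" using K.generate_incl[of "{?k}"] kc by simp
  ultimately show "generate (K0 R T) {K0_class R T (stalk_cplx (regular_mod R))} = carrier (K0 R T)"
    unfolding K0_class_stalk by blast
  \<comment> \<open>The Euler characteristic at the zero ideal is 1 on \<open>R\<close>, so it
    recovers the multiplicity \<open>m\<close>.\<close>
  have inj: "inj (\<lambda>m. K0_coset R T (frag_cmul m (cl (st 0))))"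
  proof (rule injI)
    fix m m' :: int
    assume "K0_coset R T (frag_cmul m (cl (st 0))) = K0_coset R T (frag_cmul m' (cl (st 0)))"
    then have "frag_cmul m (cl (st 0)) - frag_cmul m' (cl (st 0)) \<in> K0_rels R T"
      unfolding K0_coset_eq_iff .
    then have "linear_ext (euler_class R {\<zero>}) (frag_cmul m (cl (st 0)) - frag_cmul m' (cl (st 0))) = 0"
      using linear_ext_K0_rels[OF T_Dperf zeroprimeideal hfin_perfect_zero[OF T_perfect]] by blast
    then show "m = m'"
      by (simp add: linear_ext_cmul euler_class_iso_class[OF sT T_Dperf] euler_stalk)
  qed
  have "range (\<lambda>m. K0_coset R T (frag_cmul m (cl (st 0)))) \<subseteq> carrier (K0 R T)"
    unfolding carrier_K0 using clI[OF sT] keys_cmul by (blast intro: order_trans)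
  then show "infinite (carrier (K0 R T))"
    using finite_imageD[OF _ inj] infinite_UNIV_int finite_subset by blast
qed

lemma K0_proper:
  assumes sc: "specialisation_closed R S" and S: "S \<noteq> Spec R"
    and gen: "\<And>P. P \<in> S \<Longrightarrow> gen P \<in> carrier R" "\<And>P. P \<in> S \<Longrightarrow> PIdl (gen P) = P"
  shows "\<exists>\<phi> \<in> iso (free_Abelian_group S) (K0 R T).
    \<forall>P\<in>S. \<phi> (frag_of P) = K0_class R T (moore_cplx R (gen P))"
proof -
  let ?I = "iso_class R T ` T"
  obtain \<C> where C: "\<And>C. C \<in> \<C> \<Longrightarrow> zariski_closed R C" "S = \<Union>\<C>"
    using sc unfolding specialisation_closed_def by blast
  have SSpec: "S \<subseteq> Spec R" using C unfolding zariski_closed_def by blast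
  then have nS: "\<not> Spec R \<subseteq> S" using S by blast
  have prime: "primeideal P R" if "P \<in> S" for P using that SSpec unfolding Spec_def by blast
  \<comment> \<open>If the zero ideal were in \<open>S\<close>, a closed set containing it would be
    contained in \<open>S\<close>; such a set is all of \<open>Spec R\<close>.\<close>
  have nz: "gen P \<noteq> \<zero>" if P: "P \<in> S" for P
  proof
    assume "gen P = \<zero>"
    then have P0: "P = {\<zero>}" using gen(2)[OF P] by (simp add: cgenideal_def) (auto intro: exI[of _ \<zero>])
    obtain D where D: "D \<in> \<C>" "P \<in> D" using C(2) P by blast
    obtain J where J: "ideal J R" "D = {Q \<in> Spec R. J \<subseteq> Q}" using C(1)[OF D(1)] unfolding zariski_closed_def by blast
    have "J \<subseteq> {\<zero>}" using D(2) J(2) P0 by blast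
    moreover have "\<zero> \<in> Q" if "Q \<in> Spec R" for Q
      using that additive_subgroup.zero_closed[OF ideal.axioms(1)[OF primeideal.axioms(1)]] unfolding Spec_def by blast
    ultimately have "Spec R \<subseteq> D" unfolding J(2) by blast
    then show False using nS D(1) C(2) by blast
  qed
  \<comment> \<open>The support consists of the primes containing \<open>gen P\<close>, and
    \<open>P\<close> is the only one since nonzero primes are maximal.\<close>
  have ttT: "tt n (gen P) \<in> T" if P: "P \<in> S" for P n
  proof -
    have "Q \<in> S" if Q: "Q \<in> Spec R" "gen P \<in> Q" for Q
    proof -
      have "Q = PIdl (gen P)"
        by (rule prime_eq_generated[OF gen(1)[OF P] nz[OF P]]) (use P gen(2) prime Q in \<open>auto simp: Spec_def\<close>)
      then show ?thesis using gen(2)[OF P] P by simp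
    qed
    then show ?thesis using tt_T_iff[OF gen(1)[OF P]] by blast
  qed
  define F where "F = frag_extend (\<lambda>P. cl (tt 1 (gen P)))"
  have Fs: "F 0 = 0" "F (frag_of P) = cl (tt 1 (gen P))" "F (a + b) = F a + F b" "F (- a) = - F a" "F (a - b) = F a - F b"
    for P a b by (simp_all add: F_def frag_extend_add frag_extend_minus frag_extend_diff)
  have Fk: "Poly_Mapping.keys (F x) \<subseteq> ?I" if "Poly_Mapping.keys x \<subseteq> S" for x
    using that by (induction x rule: free_induct) (use ttT in \<open>auto simp: Fs keys_frag_of intro: keys_diff_subset[THEN subsetD]\<close>)
  note sg = subgroup_freeD[OF subgroup_K0_rels[of R T]]
  \<comment> \<open>The Euler characteristic at \<open>P\<close> is 1 on the Moore complex of
    \<open>P\<close> and 0 on the others, so it reads off the coefficient of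
    \<open>P\<close>.\<close>
  have inj: "x = 0" if x: "Poly_Mapping.keys x \<subseteq> S" "F x \<in> K0_rels R T" for x
  proof (rule poly_mapping_eqI)
    fix P
    show "Poly_Mapping.lookup x P = Poly_Mapping.lookup 0 P"
    proof (cases "P \<in> S")
      case True
      have e: "linear_ext (euler_class R P) (F y) = Poly_Mapping.lookup y P" if "Poly_Mapping.keys y \<subseteq> S" for y
        using that
      proof (induction y rule: free_induct)
        case (of Q)
        have "euler_class R P (iso_class R T (tt 1 (gen Q))) = (if P = Q then 1 else 0)"
          using euler_two_term[OF gen(1)[OF of] nz[OF of] prime[OF True]]
            cyclic_length_prime(2)[OF gen(1)[OF of] nz[OF of] _ prime[OF True]] gen(2)[OF of] prime[OF of]
          by (simp add: euler_class_iso_class[OF ttT[OF of] T_Dperf])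
        then show ?case by (simp add: Fs)
      qed (auto simp: Fs lookup_minus)
      show ?thesis
        using e[OF x(1)] linear_ext_K0_rels[OF T_Dperf prime[OF True] hfin_T[OF nS prime[OF True]] x(2)] by simp
    next
      case False
      then show ?thesis using x(1) by (metis in_keys_iff lookup_zero subsetD)
    qed
  qed
  \<comment> \<open>The image of \<open>F\<close> enlarged by the relations; that it contains every
    formal sum is surjectivity onto the Grothendieck group.\<close>
  define L where "L = {c. \<exists>x. Poly_Mapping.keys x \<subseteq> S \<and> c - F x \<in> K0_rels R T}"
  have LI: "c \<in> L" if "Poly_Mapping.keys x \<subseteq> S" "c - F x \<in> K0_rels R T" for c x
    unfolding L_def using that by blast
  have LH: "K0_rels R T \<subseteq> L"
    using LI[of 0] by (auto simp: Fs)
  have Ladd: "a + b \<in> L" if ab: "a \<in> L" "b \<in> L" for a b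
  proof -
    obtain x y where xy: "Poly_Mapping.keys x \<subseteq> S" "a - F x \<in> K0_rels R T" "Poly_Mapping.keys y \<subseteq> S" "b - F y \<in> K0_rels R T"
      using ab unfolding L_def by blast
    have "a + b - F (x + y) \<in> K0_rels R T" using sg(3)[OF xy(2,4)] by (simp add: Fs algebra_simps)
    then show ?thesis using LI[OF keys_plus_subset[OF xy(1,3)]] by blast
  qed
  have Lneg: "- a \<in> L" if a: "a \<in> L" for a
  proof -
    obtain x where x: "Poly_Mapping.keys x \<subseteq> S" "a - F x \<in> K0_rels R T" using a unfolding L_def by blast
    have "- a - F (- x) \<in> K0_rels R T" using sg(4)[OF x(2)] by (simp add: Fs algebra_simps)
    then show ?thesis using LI[of "- x"] x(1) by simp
  qed
  have gL: "cl (tt 1 (gen P)) \<in> L" if "P \<in> S" for P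
    by (rule LI[of "frag_of P"]) (use that sg(2) in \<open>auto simp: Fs keys_frag_of\<close>)
  \<comment> \<open>A prime element \<open>p\<close> and the chosen generator of \<open>(p)\<close>
    differ by a unit, whose class vanishes.\<close>
  have pL: "cl (tt 1 p) \<in> L" if p: "p \<in> carrier R - {\<zero>}" "primeideal (PIdl p) R" "tt 1 p \<in> T" for p
  proof -
    have pR: "p \<in> carrier R" using p by auto
    have PS: "PIdl p \<in> S" using p tt_T_iff[OF pR] cgenideal_self[OF pR] unfolding Spec_def by blast
    let ?g = "gen (PIdl p)"
    note g = gen[OF PS] and g0 = nz[OF PS]
    obtain v where v: "v \<in> carrier R" "p = v \<otimes> ?g" using cgenideal_self[OF pR] g(2) unfolding cgenideal_def by blast
    obtain w where w: "w \<in> carrier R" "?g = w \<otimes> p" using cgenideal_self[OF g(1)] g(2) unfolding cgenideal_def by blast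
    have "p \<otimes> (v \<otimes> w) = v \<otimes> (w \<otimes> p)" using pR v(1) w(1) by (simp add: m_ac)
    also have "\<dots> = p" using v(2) unfolding w(2)[symmetric] by simp
    finally have "p \<otimes> (v \<otimes> w) = p \<otimes> \<one>" using pR by simp
    then have "v \<otimes> w = \<one>" using m_lcancel[of p "v \<otimes> w" \<one>] p(1) v(1) w(1) by simp
    then have "v \<in> Units R" using v(1) w(1) by (auto simp: Units_def m_comm intro!: bexI[of _ w])
    then show ?thesis
      using L_unit_mult[OF LH Ladd Lneg _ g(1) ttT[OF PS], of v 1] gL[OF PS] v(2) by simp
  qed
  have "cl E \<in> L" if E: "elementary R E" "E \<in> T" for E
    using E(1) unfolding elementary_def
  proof (elim disjE exE conjE)
    fix n assume "E = st n"
    then show ?thesis using E(2) st_T_iff nS by blast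
  next
    fix n a assume "a \<in> carrier R - {\<zero>}" "E = tt n a"
    then show ?thesis using L_all_two_term[OF LH Ladd Lneg pL] E(2) by blast
  qed
  then have cl: "cl U \<in> L" if "U \<in> T" for U using L_generated[OF LH Ladd Lneg _ that] by blast
  have all: "c \<in> L" if "Poly_Mapping.keys c \<subseteq> ?I" for c
    using that
  proof (induction c rule: free_induct)
    case zero
    then show ?case using LH sg(2) by blast
  next
    case (diff x y)
    then show ?case using Ladd[OF diff(3) Lneg[OF diff(4)]] by simp
  qed (use cl in auto)
  let ?\<phi> = "\<lambda>x. K0_coset R T (F x)"
  have "?\<phi> \<in> hom (free_Abelian_group S) (K0 R T)"
    by (rule homI) (use Fk in \<open>auto simp: carrier_K0 mult_K0 Fs\<close>)
  moreover have "bij_betw ?\<phi> (carrier (free_Abelian_group S)) (carrier (K0 R T))"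
    unfolding bij_betw_def
  proof
    show "inj_on ?\<phi> (carrier (free_Abelian_group S))"
    proof (rule inj_onI)
      fix x y assume "x \<in> carrier (free_Abelian_group S)" "y \<in> carrier (free_Abelian_group S)" "?\<phi> x = ?\<phi> y"
      then have "x - y = 0" by (intro inj) (auto simp: K0_coset_eq_iff Fs intro: keys_diff_subset[THEN subsetD])
      then show "x = y" by simp
    qed
    show "?\<phi> ` carrier (free_Abelian_group S) = carrier (K0 R T)"
    proof
      show "?\<phi> ` carrier (free_Abelian_group S) \<subseteq> carrier (K0 R T)" using Fk by (auto simp: carrier_K0)
      show "carrier (K0 R T) \<subseteq> ?\<phi> ` carrier (free_Abelian_group S)"
      proof
        fix z assume "z \<in> carrier (K0 R T)"
        then obtain c where c: "Poly_Mapping.keys c \<subseteq> ?I" "z = K0_coset R T c" by (auto simp: carrier_K0)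
        obtain x where x: "Poly_Mapping.keys x \<subseteq> S" "c - F x \<in> K0_rels R T" using all[OF c(1)] unfolding L_def by blast
        show "z \<in> ?\<phi> ` carrier (free_Abelian_group S)"
          using x K0_coset_eq_iff[of R T c "F x"] c(2) by (intro image_eqI[of _ _ x]) simp_all
      qed
    qed
  qed
  ultimately have iso: "?\<phi> \<in> iso (free_Abelian_group S) (K0 R T)" unfolding iso_def by blast
  show ?thesis
  proof (rule bexI[OF _ iso], rule ballI)
    show "?\<phi> (frag_of P) = K0_class R T (moore_cplx R (gen P))" if "P \<in> S" for P
      using K0_class_moore[OF gen(1)[OF that]] by (simp add: Fs)
  qed
qed

end

end

theorem theorem4p3p1:
  fixes R :: "('a, 'r) ring_scheme" and S :: "'a set set"
  assumes "principal_domain R"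
    and "specialisation_closed R S"
  shows "(S = Spec R \<longrightarrow>
            group (K0 R (T_supp R S)) \<and>
            K0_class R (T_supp R S) (stalk_cplx (regular_mod R)) \<in> carrier (K0 R (T_supp R S)) \<and>
            generate (K0 R (T_supp R S)) {K0_class R (T_supp R S) (stalk_cplx (regular_mod R))}
              = carrier (K0 R (T_supp R S)) \<and>
            infinite (carrier (K0 R (T_supp R S)))) \<and>
         (S \<noteq> Spec R \<longrightarrow>
            (\<forall>gen. (\<forall>P\<in>S. gen P \<in> carrier R \<and> PIdl\<^bsub>R\<^esub> (gen P) = P) \<longrightarrow>
               (\<exists>\<phi> \<in> iso (free_Abelian_group S) (K0 R (T_supp R S)).
                  \<forall>P\<in>S. \<phi> (frag_of P) = K0_class R (T_supp R S) (moore_cplx R (gen P)))))"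
proof -
  interpret principal_domain R by fact
  show ?thesis
  proof (intro conjI impI allI)
    assume "S = Spec R"
    note K0_Spec[OF this]
    then show "K0_class R (T_supp R S) (stalk_cplx (regular_mod R)) \<in> carrier (K0 R (T_supp R S))"
      "generate (K0 R (T_supp R S)) {K0_class R (T_supp R S) (stalk_cplx (regular_mod R))}
        = carrier (K0 R (T_supp R S))"
      "infinite (carrier (K0 R (T_supp R S)))" by blast+
  next
    fix gen
    assume "S \<noteq> Spec R" "\<forall>P\<in>S. gen P \<in> carrier R \<and> PIdl\<^bsub>R\<^esub> (gen P) = P"
    then show "\<exists>\<phi>\<in>iso (free_Abelian_group S) (K0 R (T_supp R S)).
        \<forall>P\<in>S. \<phi> (frag_of P) = K0_class R (T_supp R S) (moore_cplx R (gen P))"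
      by (intro K0_proper[OF assms(2)]) auto
  qed (rule group_K0)
qed

end
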